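(* Let $f:\mathbb{R}^2\to\mathbb{R}$ be a polynomial function with $f(0,0)=0$ and with a strict local minimum at the origin $O$. Suppose that the vertical direction (the direction of projection of $\Pi(x,y)=x$) is generic with respect to $\mathcal{C}_\varepsilon$ for all sufficiently small $\varepsilon>0$. Then the asymptotic Poincaré-Reeb tree of $f$ relative to $x$ (which is then called a generic asymptotic Poincaré-Reeb tree) is a complete binary tree, and its vertices are endowed with a total order relation (that is, the total preorder induced by $x$ on its vertices is a total order).
   Context: For $\varepsilon>0$, $\mathcal{D}_\varepsilon$ is the connected component containing the origin $O$ of $f^{-1}([0,\varepsilon])$, and $\mathcal{C}_\varepsilon:=\mathcal{D}_\varepsilon\setminus\mathrm{Int}\,\mathcal{D}_\varepsilon$. For all sufficiently small $\varepsilon>0$, $\mathcal{D}_\varepsilon$ is a topological disk bounded by the smooth Jordan curve $\mathcal{C}_\varepsilon$. Generic direction: a direction $d$ of lines in the plane is generic with respect to $\mathcal{C}_\varepsilon$ if (1) $d$ is not the direction of any bitangent of $\mathcal{C}_\varepsilon$ (a line tangent to $\mathcal{C}_\varepsilon$ at two distinct points), and (2) $d$ is not the direction of the tangent line to $\mathcal{C}_\varepsilon$ at any inflection point of $\mathcal{C}_\varepsilon$. Poincaré-Reeb tree: let $\Pi:\mathbb{R}^2\to\mathbb{R}$, $\Pi(x,y)=x$. Call two points of $\mathcal{D}_\varepsilon$ equivalent if they lie in the same connected component of $\mathcal{D}_\varepsilon\cap\Pi^{-1}(x_0)$ for some $x_0$. The quotient of $\mathcal{D}_\varepsilon$ by this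 relation is a plane tree, the Poincaré-Reeb tree of $\mathcal{C}_\varepsilon$ with respect to $x$. Its root is the image of the origin, and its other vertices are the images of the points of $\mathcal{C}_\varepsilon$ at which the tangent line is vertical. The function $x$ descends to the quotient and induces a total preorder on the vertices. For all sufficiently small $\varepsilon>0$ the combinatorial type of this tree with its preorder does not depend on $\varepsilon$; it is called the asymptotic Poincaré-Reeb tree of $f$ relative to $x$. Children of a vertex are its neighbours in the tree that are farther from the root. A complete binary tree is a rooted tree in which every internal vertex (vertex having at least one child) has exactly two children. *)

theory Defs
  imports "HOL-Analysis.Analysis"
begin

section \<open>The level curves near the origin\<close>

type_synonym plane = "real \<times> real"

definition strict_local_min_at :: "(plane \<Rightarrow> real) \<Rightarrow> plane \<Rightarrow> bool" where
  "strict_local_min_at f p \<longleftrightarrow> (\<forall>\<^sub>F q in at p. f p < f q)"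

definition level_disk :: "(plane \<Rightarrow> real) \<Rightarrow> real \<Rightarrow> plane set" where
  "level_disk f \<epsilon> = connected_component_set (f -` {0..\<epsilon>}) (0, 0)"

definition level_curve :: "(plane \<Rightarrow> real) \<Rightarrow> real \<Rightarrow> plane set" where
  "level_curve f \<epsilon> = level_disk f \<epsilon> - interior (level_disk f \<epsilon>)"


section \<open>Tangent lines and generic directions\<close>

text \<open>Tangent line at \<open>p\<close> to the level curve of \<open>f\<close> through \<open>p\<close>. It is a line exactly when
  the gradient of \<open>f\<close> does not vanish at \<open>p\<close>; otherwise it is the whole plane, which
  has no direction in the sense of \<open>has_direction\<close>.\<close>

definition tangent_line :: "(plane \<Rightarrow> real) \<Rightarrow> plane \<Rightarrow> plane set" where
  "tangent_line f p = {q. frechet_derivative f (at p) (q - p) = 0}"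

definition has_direction :: "plane set \<Rightarrow> plane \<Rightarrow> bool" where
  "has_direction L d \<longleftrightarrow> d \<noteq> 0 \<and> (\<exists>p. L = {p + t *\<^sub>R d |t. True})"

definition bitangent :: "(plane \<Rightarrow> real) \<Rightarrow> real \<Rightarrow> plane set \<Rightarrow> bool" where
  "bitangent f \<epsilon> L \<longleftrightarrow> (\<exists>d. has_direction L d) \<and>
     (\<exists>p\<in>level_curve f \<epsilon>. \<exists>q\<in>level_curve f \<epsilon>.
        p \<noteq> q \<and> tangent_line f p = L \<and> tangent_line f q = L)"

text \<open>The curve meets its tangent line at \<open>p\<close> with multiplicity at least three, equivalently
  its curvature vanishes at \<open>p\<close>. The value and the first derivative at \<open>0\<close> of
  \<open>t \<mapsto> f (p + t v) - f p\<close> vanish because \<open>v\<close> is a tangent vector.\<close>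

definition inflection_point :: "(plane \<Rightarrow> real) \<Rightarrow> real \<Rightarrow> plane \<Rightarrow> bool" where
  "inflection_point f \<epsilon> p \<longleftrightarrow> p \<in> level_curve f \<epsilon> \<and>
     (\<exists>v. has_direction (tangent_line f p) v \<and>
          (deriv ^^ 2) (\<lambda>t. f (p + t *\<^sub>R v)) 0 = 0)"

definition generic_direction :: "(plane \<Rightarrow> real) \<Rightarrow> real \<Rightarrow> plane \<Rightarrow> bool" where
  "generic_direction f \<epsilon> d \<longleftrightarrow>
     \<not> (\<exists>L. bitangent f \<epsilon> L \<and> has_direction L d) \<and>
     \<not> (\<exists>p. inflection_point f \<epsilon> p \<and> has_direction (tangent_line f p) d)"


section \<open>Rooted trees with a relation on the vertices\<close>

text \<open>\<open>adj\<close> is the adjacency relation of a simple graph. \<open>vle\<close> is meant to be a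
  preorder on the vertices.\<close>

record 'v rooted_graph =
  vertices :: "'v set"
  root :: 'v
  adj :: "'v rel"
  vle :: "'v rel"

definition is_cycle :: "'v rel \<Rightarrow> 'v list \<Rightarrow> bool" where
  "is_cycle A c \<longleftrightarrow> 3 \<le> length c \<and> distinct c \<and>
     (\<forall>i<length c. (c ! i, c ! (Suc i mod length c)) \<in> A)"

definition rooted_tree :: "'v rooted_graph \<Rightarrow> bool" where
  "rooted_tree T \<longleftrightarrow>
     finite (vertices T) \<and> root T \<in> vertices T \<and>
     adj T \<subseteq> vertices T \<times> vertices T \<and> sym (adj T) \<and> irrefl (adj T) \<and>
     (\<forall>u\<in>vertices T. \<forall>v\<in>vertices T. (u, v) \<in> (adj T)\<^sup>*) \<and>
     (\<nexists>c. is_cycle (adj T) c)"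

definition depth :: "'v rooted_graph \<Rightarrow> 'v \<Rightarrow> nat" where
  "depth T v = (LEAST n. (root T, v) \<in> adj T ^^ n)"

definition children :: "'v rooted_graph \<Rightarrow> 'v \<Rightarrow> 'v set" where
  "children T v = {w. (v, w) \<in> adj T \<and> depth T v < depth T w}"

definition complete_binary_tree :: "'v rooted_graph \<Rightarrow> bool" where
  "complete_binary_tree T \<longleftrightarrow> rooted_tree T \<and>
     (\<forall>v\<in>vertices T. children T v \<noteq> {} \<longrightarrow> card (children T v) = 2)"

definition same_combinatorial_type :: "'v rooted_graph \<Rightarrow> 'w rooted_graph \<Rightarrow> bool" where
  "same_combinatorial_type S T \<longleftrightarrow>
     (\<exists>h. bij_betw h (vertices S) (vertices T) \<and> h (root S) = root T \<and>
          map_prod h h ` adj S = adj T \<and> map_prod h h ` vle S = vle T)"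


section \<open>The Poincare-Reeb tree\<close>

definition quotient_topology :: "'a topology \<Rightarrow> ('a \<Rightarrow> 'b) \<Rightarrow> 'b topology" where
  "quotient_topology X q =
     topology (\<lambda>U. U \<subseteq> q ` topspace X \<and> openin X {x \<in> topspace X. q x \<in> U})"

lemma openin_quotient_topology:
  "openin (quotient_topology X q) U \<longleftrightarrow>
     U \<subseteq> q ` topspace X \<and> openin X {x \<in> topspace X. q x \<in> U}"
proof -
  let ?P = "\<lambda>U. U \<subseteq> q ` topspace X \<and> openin X {x \<in> topspace X. q x \<in> U}"
  have "?P (S \<inter> T)" if "?P S" "?P T" for S T
  proof -
    have "{x \<in> topspace X. q x \<in> S \<inter> T} =
        {x \<in> topspace X. q x \<in> S} \<inter> {x \<in> topspace X. q x \<in> T}" by auto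
    with that show ?thesis by auto
  qed
  moreover have "?P (\<Union>\<K>)" if "\<forall>K\<in>\<K>. ?P K" for \<K>
  proof -
    have "{x \<in> topspace X. q x \<in> \<Union>\<K>} = (\<Union>K\<in>\<K>. {x \<in> topspace X. q x \<in> K})" by auto
    moreover have "openin X (\<Union>K\<in>\<K>. {x \<in> topspace X. q x \<in> K})"
      using that by (intro openin_Union) auto
    ultimately show ?thesis using that by auto
  qed
  ultimately have "istopology ?P" unfolding istopology_def by blast
  then show ?thesis by (simp add: quotient_topology_def topology_inverse')
qed

lemma topspace_quotient_topology [simp]:
  "topspace (quotient_topology X q) = q ` topspace X"
proof
  show "topspace (quotient_topology X q) \<subseteq> q ` topspace X"
    using openin_topspace openin_quotient_topology by metis
  have "{x \<in> topspace X. q x \<in> q ` topspace X} = topspace X" by auto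
  then have "openin (quotient_topology X q) (q ` topspace X)"
    by (simp add: openin_quotient_topology)
  then show "q ` topspace X \<subseteq> topspace (quotient_topology X q)"
    by (rule openin_subset)
qed

lemma quotient_map_quotient_topology:
  "quotient_map X (quotient_topology X q) q"
  by (auto simp: quotient_map_def openin_quotient_topology)

text \<open>Points of \<open>D\<close> in the same connected component of a vertical slice of \<open>D\<close>.\<close>

definition reeb_rel :: "plane set \<Rightarrow> plane rel" where
  "reeb_rel D = {(p, q). \<exists>x\<^sub>0. connected_component (D \<inter> fst -` {x\<^sub>0}) p q}"

definition reeb_class :: "plane set \<Rightarrow> plane \<Rightarrow> plane set" where
  "reeb_class D p = reeb_rel D `` {p}"

definition reeb_quotient :: "plane set \<Rightarrow> plane set topology" where
  "reeb_quotient D = quotient_topology (top_of_set D) (reeb_class D)"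

definition reeb_vertices :: "(plane \<Rightarrow> real) \<Rightarrow> real \<Rightarrow> plane set set" where
  "reeb_vertices f \<epsilon> =
     insert (reeb_class (level_disk f \<epsilon>) (0, 0))
       (reeb_class (level_disk f \<epsilon>) `
          {p \<in> level_curve f \<epsilon>. has_direction (tangent_line f p) (0, 1)})"

text \<open>The open edges are the connected components of the quotient space with the vertices
  removed, and the vertices in the closure of an open edge are its endpoints. Since \<open>fst\<close> is
  constant on every equivalence class, \<open>vle\<close> compares the values of the function induced
  by \<open>fst\<close> on the quotient.\<close>

definition poincare_reeb_tree :: "(plane \<Rightarrow> real) \<Rightarrow> real \<Rightarrow> plane set rooted_graph" where
  "poincare_reeb_tree f \<epsilon> =
     (let D = level_disk f \<epsilon>; Q = reeb_quotient D; V = reeb_vertices f \<epsilon> in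
      \<lparr> vertices = V,
        root = reeb_class D (0, 0),
        adj = {(u, v). u \<noteq> v \<and>
          (\<exists>e\<in>connected_components_of (subtopology Q (topspace Q - V)).
             V \<inter> Q closure_of e = {u, v})},
        vle = {(u, v). u \<in> V \<and> v \<in> V \<and> (\<exists>p\<in>u. \<exists>q\<in>v. fst p \<le> fst q)} \<rparr>)"

text \<open>\<open>T\<close> represents the common combinatorial type of the Poincare-Reeb trees of
  all sufficiently small levels.\<close>

definition asymptotic_poincare_reeb_tree :: "(plane \<Rightarrow> real) \<Rightarrow> 'v rooted_graph \<Rightarrow> bool" where
  "asymptotic_poincare_reeb_tree f T \<longleftrightarrow>
     (\<forall>\<^sub>F \<epsilon> in at_right 0. same_combinatorial_type (poincare_reeb_tree f \<epsilon>) T)"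

end

theory Submission
  imports Defs "HOL-Computational_Algebra.Field_as_Ring" "HOL-Computational_Algebra.Polynomial_Factorial"
begin

text \<open>
  The origin is an isolated critical point of \<open>f\<close>: near it, every other critical point would lie on
  a common curve factor \<open>p = 0\<close> of the two partial derivatives, \<open>f\<close> is constant along that curve,
  and following the curve towards the axis \<open>x = 0\<close> leads to the origin, where \<open>f\<close> vanishes.
  Hence a small level disk \<open>D\<close> has no holes, so it is unicoherent: cutting it along
  a vertical strip between two regular slices disconnects it. This says that every edge of the quotient is
  a bridge, so the quotient is a tree. Genericity gives \<open>f\<^sub>y\<^sub>y \<noteq> 0\<close> at the vertical
  tangencies, and at most one of them on each vertical line. A slice through a tangency is then either
  an extremal point of \<open>D\<close> (degree one) or a point where a slice splits in two (degree three), while the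
  root has one edge on either side.
\<close>

section \<open>Polynomials in two variables\<close>

text \<open>The obstacle in the first step is that a critical curve has to be followed without
  parametrising its branches. A polynomial is therefore kept as a polynomial in \<open>y\<close>
  over the polynomials in \<open>x\<close>: a Bezout identity whose right-hand side involves
  \<open>x\<close> alone confines common zeros to finitely many vertical lines, and the leftmost
  point of a compact piece of the curve takes the place of a branch running to the axis. Topology
  and analysis are separated by the locale \<open>reeb_disk\<close>, which asks only for tubes
  around regular classes and stars around vertices; the degree of a vertex is the number of members
  of its star. \<open>small_level\<close> supplies tubes and stars from the signs of three partial
  derivatives in small boxes. That edges are bridges is used twice: it excludes cycles, and it
  excludes two arcs with the same ends, so that counting arcs counts neighbours. Degrees 1 and 3
  become 0 and 2 children since exactly one neighbour of a vertex other than the root is not deeper.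
  The root has degree two because no vertical tangency lies over \<open>x = 0\<close>.\<close>

definition poly2 :: "real poly poly \<Rightarrow> plane \<Rightarrow> real" where
  "poly2 P p = poly (poly P [:snd p:]) (fst p)"

lemma poly2_simps [simp]:
  "poly2 0 p = 0" "poly2 1 p = 1" "poly2 (P + Q) p = poly2 P p + poly2 Q p"
  "poly2 (P * Q) p = poly2 P p * poly2 Q p"  "poly2 (- P) p = - poly2 P p"
  "poly2 (pCons a P) p = poly a (fst p) + snd p * poly2 P p"
  by (simp_all add: poly2_def)

text \<open>The outer variable is \<open>y\<close>, so \<open>pderiv\<close> is the partial
  derivative in \<open>y\<close>, while the one in \<open>x\<close> acts on the
  coefficients.\<close>

definition poly2_dx :: "real poly poly \<Rightarrow> real poly poly" where
  "poly2_dx P = map_poly pderiv P"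

lemma poly2_has_derivative:
  "(poly2 P has_derivative (\<lambda>h. poly2 (poly2_dx P) p * fst h + poly2 (pderiv P) p * snd h)) (at p within S)"
proof (induction P)
  case 0
  show ?case by (simp add: poly2_dx_def pderiv_0)
next
  case (pCons a P)
  have [derivative_intros]: "((\<lambda>p. poly a (fst p)) has_derivative (\<lambda>h. poly (pderiv a) (fst p) * fst h)) (at p within S)"
    using has_derivative_compose[OF has_derivative_fst[OF has_derivative_ident] poly_DERIV[unfolded has_field_derivative_def]] .
  show ?case
    by (rule has_derivative_eq_rhs, subst poly2_simps(6)[abs_def], (rule derivative_intros pCons.IH)+)
       (auto simp: poly2_dx_def map_poly_pCons pderiv_0 pderiv_pCons algebra_simps fun_eq_iff)
qed

lemma continuous_on_poly2 [continuous_intros]: "continuous_on S (poly2 P)"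
  by (rule has_derivative_continuous_on[OF poly2_has_derivative])

lemma real_polynomial_function_poly2:
  fixes f :: "plane \<Rightarrow> real"
  assumes "real_polynomial_function f"
  obtains F where "f = poly2 F"
proof -
  from assms have "\<exists>F. f = poly2 F"
  proof (induction f rule: real_polynomial_function.induct)
    case (linear f)
    interpret bounded_linear f by fact
    have *: "f p = fst p * f (1, 0) + snd p * f (0, 1)" for p
    proof -
      have "f p = f (fst p *\<^sub>R (1, 0) + snd p *\<^sub>R (0, 1))" by simp
      then show ?thesis by (simp add: add scaleR del: scaleR_Pair)
    qed
    have "f p = poly2 [:[:0, f (1, 0):], [:f (0, 1):]:] p" for p by (subst *) simp
    then have "f = poly2 [:[:0, f (1, 0):], [:f (0, 1):]:]" by blast
    then show ?case by blast
  next
    case (const c)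
    have "(\<lambda>_. c) = poly2 [:[:c:]:]" by auto
    then show ?case by blast
  next
    case (add f g)
    then obtain F G where "f = poly2 F" "g = poly2 G" by blast
    then have "(\<lambda>x. f x + g x) = poly2 (F + G)" by auto
    then show ?case by blast
  next
    case (mult f g)
    then obtain F G where "f = poly2 F" "g = poly2 G" by blast
    then have "(\<lambda>x. f x * g x) = poly2 (F * G)" by auto
    then show ?case by blast
  qed
  then show thesis using that by blast
qed

text \<open>Pseudo-division replaces division over the fraction field: a nonzero element
  \<open>d\<close> of least degree in the ideal of \<open>p\<close> and \<open>q\<close> divides
  both of them up to nonzero constant factors, and primality of \<open>p\<close> then forces
  \<open>d\<close> to be constant.\<close>

lemma bezout_over_coefficients:
  fixes p q :: "'a :: idom poly"
  assumes p: "prime_elem p" and pq: "\<not> p dvd q"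
  obtains u v r where "r \<noteq> 0" "u * p + v * q = [:r:]"
proof (cases "degree p = 0")
  case True
  then obtain a where "p = [:a:]" by (rule degree_eq_zeroE)
  moreover have "p \<noteq> 0" using p by (simp add: prime_elem_def)
  ultimately show ?thesis using that[of a 1 0] by simp
next
  case False
  define I where "I d \<longleftrightarrow> d \<noteq> 0 \<and> (\<exists>u v. d = u * p + v * q)" for d
  have "p = 1 * p + 0 * q" by simp
  then have "I p" using p unfolding I_def prime_elem_def by blast
  then obtain d where d: "I d" and min: "\<And>d'. I d' \<Longrightarrow> degree d \<le> degree d'"
    using ex_has_least_nat[of I p degree] by auto
  from d obtain u v where uv: "d = u * p + v * q" and "d \<noteq> 0" by (auto simp: I_def)
  have div: "\<exists>a. a \<noteq> 0 \<and> d dvd smult a g" if "g = u' * p + v' * q" for g u' v'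
  proof -
    obtain a t where at: "a \<noteq> 0" "smult a g = d * t + pseudo_mod g d"
      using pseudo_mod(1)[OF \<open>d \<noteq> 0\<close>] by blast
    have "pseudo_mod g d = smult a g - d * t" using at by simp
    also have "\<dots> = (smult a u' - t * u) * p + (smult a v' - t * v) * q"
      by (simp add: uv that algebra_simps smult_add_right)
    finally have "pseudo_mod g d \<noteq> 0 \<Longrightarrow> I (pseudo_mod g d)" unfolding I_def by blast
    then have "pseudo_mod g d = 0" using min pseudo_mod(2)[OF \<open>d \<noteq> 0\<close>, of g] by fastforce
    then show ?thesis using at by auto
  qed
  have nd: "\<not> p dvd [:a:]" if "a \<noteq> 0" for a
    using False that dvd_imp_degree_le[of p "[:a:]"] by auto
  obtain a where a: "a \<noteq> 0" "d dvd [:a:] * p" using div[of p 1 0] by auto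
  obtain b where b: "b \<noteq> 0" "d dvd [:b:] * q" using div[of q 0 1] by auto
  from a obtain s where s: "[:a:] * p = d * s" by blast
  \<comment> \<open>If \<open>p\<close> divides \<open>d\<close>, it divides
    \<open>[:b:] * q\<close>, which is excluded. If it divides \<open>s\<close>, cancelling
    \<open>p\<close> leaves \<open>d\<close> as a divisor of the constant
    \<open>[:a:]\<close>.\<close>
  then have "p dvd d \<or> p dvd s" using p by (metis dvd_triv_right prime_elem_dvd_mult_iff)
  then have "degree d = 0"
  proof
    assume "p dvd d"
    then have "p dvd [:b:] * q" using b by (metis dvd_trans)
    then show ?thesis using nd[OF b(1)] pq p by (metis prime_elem_dvd_mult_iff)
  next
    assume "p dvd s"
    then obtain s' where "s = p * s'" by blast
    then have "p * [:a:] = p * (d * s')" using s by (simp add: ac_simps)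
    moreover have "p \<noteq> 0" using p by (simp add: prime_elem_def)
    ultimately have "[:a:] = d * s'" by (metis mult_left_cancel)
    then have "d dvd [:a:]" by simp
    then show ?thesis using a dvd_imp_degree_le[of d "[:a:]"] by simp
  qed
  then obtain r where "d = [:r:]" by (rule degree_eq_zeroE)
  then show ?thesis using that[of r u v] uv \<open>d \<noteq> 0\<close> by simp
qed

lemma poly2_prime_factor_zero:
  assumes "P \<noteq> 0" "poly2 P z = 0"
  obtains p where "p \<in> prime_factors P" "poly2 p z = 0"
proof -
  \<comment> \<open>The prime factorisation only recovers the normalised polynomial; a unit has an
    inverse and hence no zeros, so the zero set is the same.\<close>
  have norm: "poly2 (normalize X) z = 0 \<longleftrightarrow> poly2 X z = 0" for X
  proof (cases "X = 0")
    case False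
    then have "unit_factor X dvd 1" by simp
    then obtain v where "1 = unit_factor X * v" by blast
    then have "1 = poly2 (unit_factor X) z * poly2 v z" by (metis poly2_simps(2,4))
    then have "poly2 (unit_factor X) z \<noteq> 0" by auto
    moreover have "poly2 X z = poly2 (unit_factor X) z * poly2 (normalize X) z"
      by (metis poly2_simps(4) unit_factor_mult_normalize)
    ultimately show ?thesis by simp
  qed simp
  then have 0: "poly2 (prod_mset (prime_factorization P)) z = 0"
    using assms(2) prod_mset_prime_factorization_weak[OF assms(1)] by metis
  have "\<exists>p \<in># A. poly2 p z = 0" if "poly2 (prod_mset A) z = 0" for A
    using that by (induction A) auto
  with 0 show thesis using that by blast
qed

lemma eventually_poly_nonzero:
  fixes q :: "real poly"
  assumes "q \<noteq> 0"
  shows "\<forall>\<^sub>F x in at a. poly q x \<noteq> 0"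
proof -
  let ?S = "{x. poly q x = 0} - {a}"
  have "finite ?S" using poly_roots_finite[OF assms] by simp
  then have "open (- ?S)" by (simp only: finite_imp_closed open_Compl)
  then show ?thesis unfolding eventually_at_topological by (intro exI[of _ "- ?S"]) auto
qed

section \<open>Continuing a curve of critical points towards the axis\<close>

lemma poly2_DERIV_y: "((\<lambda>y. poly2 P (x, y)) has_real_derivative poly2 (pderiv P) (x, y)) (at y within S)"
  using has_derivative_compose[OF has_derivative_Pair[OF has_derivative_const has_derivative_ident] poly2_has_derivative[of P]]
  by (simp add: has_field_derivative_def mult.commute[of _ "poly2 _ _"])

lemma poly2_DERIV_x: "((\<lambda>x. poly2 P (x, y)) has_real_derivative poly2 (poly2_dx P) (x, y)) (at x within S)"
  using has_derivative_compose[OF has_derivative_Pair[OF has_derivative_ident has_derivative_const] poly2_has_derivative[of P]]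
  by (simp add: has_field_derivative_def mult.commute[of _ "poly2 _ _"])

lemma open_contains_box:
  fixes U :: "plane set"
  assumes "open U" "(a, b) \<in> U"
  obtains \<eta> where "\<eta> > 0" "\<And>x y. \<bar>x - a\<bar> \<le> \<eta> \<Longrightarrow> \<bar>y - b\<bar> \<le> \<eta> \<Longrightarrow> (x, y) \<in> U"
proof -
  obtain e where e: "e > 0" "ball (a, b) e \<subseteq> U" using assms openE by blast
  have "(x, y) \<in> U" if "\<bar>x - a\<bar> \<le> e / 3" "\<bar>y - b\<bar> \<le> e / 3" for x y
  proof -
    have "dist (a, b) (x, y) \<le> \<bar>a - x\<bar> + \<bar>b - y\<bar>"
      unfolding dist_prod_def by (simp add: dist_real_def sqrt_sum_squares_le_sum_abs)
    also have "\<dots> < e" using that e by linarith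
    finally show ?thesis using e by auto
  qed
  then show thesis using that[of "e / 3"] e by auto
qed

lemma open_poly2_less: "open {z. c < poly2 P z}" "open {z. poly2 P z < c}"
  by (intro open_Collect_less continuous_intros)+

text \<open>An implicit function argument in Lipschitz form: the lower bound \<open>m\<close> on the
  derivative of \<open>p\<close> in \<open>y\<close> and the upper bound \<open>M\<close> on the one
  in \<open>x\<close> produce a Lipschitz graph \<gamma> of zeros of \<open>p\<close> over an
  interval to the left of \<open>a\<close>. By \<open>crit\<close> the graph consists of critical
  points of \<open>F\<close>, so \<open>F\<close> is constant on it.\<close>

lemma continue_left_pos:
  assumes pz: "poly2 p (a, b) = 0" and py: "poly2 (pderiv p) (a, b) > 0"
    and crit: "\<And>z. poly2 p z = 0 \<Longrightarrow> poly2 (poly2_dx F) z = 0 \<and> poly2 (pderiv F) z = 0"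
    and e: "e > 0"
  shows "\<exists>x y. a - e < x \<and> x < a \<and> \<bar>y - b\<bar> < e \<and> poly2 p (x, y) = 0 \<and> poly2 F (x, y) = poly2 F (a, b)"
proof -
  define m where "m = poly2 (pderiv p) (a, b) / 2"
  have m: "m > 0" "m < poly2 (pderiv p) (a, b)" using py by (auto simp: m_def)
  obtain \<eta>0 where \<eta>0: "\<eta>0 > 0" "\<And>x y. \<bar>x - a\<bar> \<le> \<eta>0 \<Longrightarrow> \<bar>y - b\<bar> \<le> \<eta>0 \<Longrightarrow> m < poly2 (pderiv p) (x, y)"
    using open_contains_box[OF open_poly2_less(1)[of m "pderiv p"], of a b] m by auto
  define \<eta> where "\<eta> = min \<eta>0 (e / 2)"
  have \<eta>: "\<eta> > 0" "\<eta> < e" and dy: "\<And>x y. \<bar>x - a\<bar> \<le> \<eta> \<Longrightarrow> \<bar>y - b\<bar> \<le> \<eta> \<Longrightarrow> m < poly2 (pderiv p) (x, y)"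
    using \<eta>0 e by (auto simp: \<eta>_def)
  have "bounded (poly2 (poly2_dx p) ` ({a - \<eta>..a + \<eta>} \<times> {b - \<eta>..b + \<eta>}))"
    by (intro compact_imp_bounded compact_continuous_image continuous_intros compact_Times compact_Icc)
  then obtain M where M0: "M > 0" and M': "\<And>z. z \<in> {a - \<eta>..a + \<eta>} \<times> {b - \<eta>..b + \<eta>} \<Longrightarrow> \<bar>poly2 (poly2_dx p) z\<bar> \<le> M"
    unfolding bounded_pos by auto
  have M: "\<bar>poly2 (poly2_dx p) (x, y)\<bar> \<le> M" if "\<bar>x - a\<bar> \<le> \<eta>" "\<bar>y - b\<bar> \<le> \<eta>" for x y
    by (rule M') (use that in auto)
  have mono: "m * (y2 - y1) \<le> poly2 p (x, y2) - poly2 p (x, y1)"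
    if "\<bar>x - a\<bar> \<le> \<eta>" "\<bar>y1 - b\<bar> \<le> \<eta>" "\<bar>y2 - b\<bar> \<le> \<eta>" "y1 \<le> y2" for x y1 y2
  proof (cases "y1 = y2")
    case False
    then have "y1 < y2" using that by simp
    then obtain z where "y1 < z" "z < y2" "poly2 p (x, y2) - poly2 p (x, y1) = (y2 - y1) * poly2 (pderiv p) (x, z)"
      using MVT2[of y1 y2 "\<lambda>y. poly2 p (x, y)" "\<lambda>y. poly2 (pderiv p) (x, y)"] poly2_DERIV_y by blast
    moreover have "m < poly2 (pderiv p) (x, z)" using dy that calculation by (auto simp: abs_le_iff)
    ultimately show ?thesis using that by (simp add: mult.commute[of m])
  qed simp
  have mono': "m * \<bar>y2 - y1\<bar> \<le> \<bar>poly2 p (x, y2) - poly2 p (x, y1)\<bar>"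
    if "\<bar>x - a\<bar> \<le> \<eta>" "\<bar>y1 - b\<bar> \<le> \<eta>" "\<bar>y2 - b\<bar> \<le> \<eta>" for x y1 y2
    using mono[OF that] mono[OF that(1,3,2)] by (cases "y1 \<le> y2") (auto simp: abs_if)
  have lip: "\<bar>poly2 p (x2, y) - poly2 p (x1, y)\<bar> \<le> M * \<bar>x2 - x1\<bar>"
    if "\<bar>x1 - a\<bar> \<le> \<eta>" "\<bar>x2 - a\<bar> \<le> \<eta>" "\<bar>y - b\<bar> \<le> \<eta>" for x1 x2 y
  proof -
    have "norm (poly2 p (x2, y) - poly2 p (x1, y)) \<le> M * norm (x2 - x1)"
    proof (rule field_differentiable_bound)
      show "convex {a - \<eta>..a + \<eta>}" by simp
      show "((\<lambda>x. poly2 p (x, y)) has_field_derivative poly2 (poly2_dx p) (x, y)) (at x within {a - \<eta>..a + \<eta>})" for x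
        by (rule poly2_DERIV_x)
      show "norm (poly2 (poly2_dx p) (x, y)) \<le> M" if "x \<in> {a - \<eta>..a + \<eta>}" for x
        using M[of x y] that \<open>\<bar>y - b\<bar> \<le> \<eta>\<close> by auto
    qed (use that in auto)
    then show ?thesis by simp
  qed
  have ends: "poly2 p (a, b + \<eta>) > 0" "poly2 p (a, b - \<eta>) < 0"
    using mono[of a b "b + \<eta>"] mono[of a "b - \<eta>" b] \<eta> m pz by auto (smt (verit) mult_pos_pos)+
  obtain \<delta>1 where \<delta>1: "\<delta>1 > 0" "\<And>x y. \<bar>x - a\<bar> \<le> \<delta>1 \<Longrightarrow> \<bar>y - (b + \<eta>)\<bar> \<le> \<delta>1 \<Longrightarrow> poly2 p (x, y) > 0"
    using open_contains_box[OF open_poly2_less(1)[of 0 p], of a "b + \<eta>"] ends by auto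
  obtain \<delta>2 where \<delta>2: "\<delta>2 > 0" "\<And>x y. \<bar>x - a\<bar> \<le> \<delta>2 \<Longrightarrow> \<bar>y - (b - \<eta>)\<bar> \<le> \<delta>2 \<Longrightarrow> poly2 p (x, y) < 0"
    using open_contains_box[OF open_poly2_less(2)[of p 0], of a "b - \<eta>"] ends by auto
  define \<delta> where "\<delta> = min \<eta> (min \<delta>1 \<delta>2)"
  have \<delta>: "\<delta> > 0" "\<delta> \<le> \<eta>" using \<delta>1 \<delta>2 \<eta> by (auto simp: \<delta>_def)
  let ?I = "{a - \<delta>..a}"
  have "\<exists>y. \<bar>y - b\<bar> \<le> \<eta> \<and> poly2 p (x, y) = 0" if "x \<in> ?I" for x
  proof -
    have "\<bar>x - a\<bar> \<le> \<delta>" using that by auto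
    then have "poly2 p (x, b - \<eta>) \<le> 0" "0 \<le> poly2 p (x, b + \<eta>)"
      using \<delta>1(2)[of x "b + \<eta>"] \<delta>2(2)[of x "b - \<eta>"] \<delta>1(1) \<delta>2(1) by (auto simp: \<delta>_def)
    moreover have "continuous_on {b - \<eta>..b + \<eta>} (\<lambda>y. poly2 p (x, y))"
      by (rule DERIV_continuous_on[OF poly2_DERIV_y])
    ultimately obtain y where "b - \<eta> \<le> y" "y \<le> b + \<eta>" "poly2 p (x, y) = 0"
      using IVT'[of "\<lambda>y. poly2 p (x, y)" "b - \<eta>" 0 "b + \<eta>"] \<eta> by auto
    then show ?thesis by (intro exI[of _ y]) auto
  qed
  then obtain \<gamma> where \<gamma>: "\<And>x. x \<in> ?I \<Longrightarrow> \<bar>\<gamma> x - b\<bar> \<le> \<eta>" "\<And>x. x \<in> ?I \<Longrightarrow> poly2 p (x, \<gamma> x) = 0"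
    by metis
  have near: "\<bar>x - a\<bar> \<le> \<eta>" if "x \<in> ?I" for x using that \<delta> by auto
  have "m * \<bar>\<gamma> a - b\<bar> \<le> 0" using mono'[of a b "\<gamma> a"] \<gamma>[of a] pz \<delta> \<eta> by auto
  then have \<gamma>a: "\<gamma> a = b" using m by (simp add: mult_le_0_iff)
  have \<gamma>lip: "\<bar>\<gamma> x' - \<gamma> x\<bar> \<le> M / m * \<bar>x' - x\<bar>" if "x \<in> ?I" "x' \<in> ?I" for x x'
  proof -
    have "m * \<bar>\<gamma> x' - \<gamma> x\<bar> \<le> \<bar>poly2 p (x, \<gamma> x') - poly2 p (x, \<gamma> x)\<bar>"
      by (rule mono') (use near \<gamma>(1) that in blast)+
    also have "\<dots> = \<bar>poly2 p (x', \<gamma> x') - poly2 p (x, \<gamma> x')\<bar>" using \<gamma> that by simp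
    also have "\<dots> \<le> M * \<bar>x' - x\<bar>" by (rule lip) (use near \<gamma>(1) that in blast)+
    finally show ?thesis using m by (simp add: field_simps)
  qed
  define g where "g x = poly2 F (x, \<gamma> x)" for x
  have "(g has_derivative (\<lambda>_. 0)) (at x within ?I)" if x: "x \<in> ?I" for x
    unfolding has_derivative_within_alt
  proof (intro conjI allI impI)
    show "bounded_linear (\<lambda>_::real. 0::real)" by simp
    fix e :: real assume e: "e > 0"
    define L where "L = 1 + M / m"
    have L: "L > 0" using M0 m by (simp add: L_def add_pos_pos)
    have "(poly2 F has_derivative (\<lambda>_. 0)) (at (x, \<gamma> x))"
      using poly2_has_derivative[of F "(x, \<gamma> x)" UNIV] crit \<gamma>(2)[OF x] by simp
    moreover have "e / L > 0" using e L by simp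
    ultimately have "\<exists>d>0. \<forall>z. norm (z - (x, \<gamma> x)) < d \<longrightarrow> norm (poly2 F z - poly2 F (x, \<gamma> x) - 0) \<le> e / L * norm (z - (x, \<gamma> x))"
      unfolding has_derivative_at_alt by blast
    then obtain d where d: "d > 0" "\<And>z. norm (z - (x, \<gamma> x)) < d \<Longrightarrow> norm (poly2 F z - poly2 F (x, \<gamma> x)) \<le> e / L * norm (z - (x, \<gamma> x))"
      unfolding diff_0_right by blast
    show "\<exists>d>0. \<forall>y\<in>?I. norm (y - x) < d \<longrightarrow> norm (g y - g x - 0) \<le> e * norm (y - x)"
    proof (intro exI[of _ "d / L"] conjI ballI impI)
      show "d / L > 0" using d L by simp
      fix x' assume x': "x' \<in> ?I" "norm (x' - x) < d / L"
      have "norm ((x', \<gamma> x') - (x, \<gamma> x)) \<le> \<bar>x' - x\<bar> + \<bar>\<gamma> x' - \<gamma> x\<bar>"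
        by (simp add: norm_Pair sqrt_sum_squares_le_sum_abs)
      also have "\<dots> \<le> L * \<bar>x' - x\<bar>" using \<gamma>lip[OF x x'(1)] by (simp add: L_def algebra_simps)
      finally have 1: "norm ((x', \<gamma> x') - (x, \<gamma> x)) \<le> L * \<bar>x' - x\<bar>" .
      also have "\<dots> < d" using x' L by (simp add: field_simps)
      finally have "norm (g x' - g x) \<le> e / L * norm ((x', \<gamma> x') - (x, \<gamma> x))"
        using d(2)[of "(x', \<gamma> x')"] unfolding g_def by blast
      also have "\<dots> \<le> e / L * (L * \<bar>x' - x\<bar>)" using 1 e L by (intro mult_left_mono) auto
      finally show "norm (g x' - g x - 0) \<le> e * norm (x' - x)" using L by simp
    qed
  qed
  then obtain c where c: "\<And>x. x \<in> ?I \<Longrightarrow> g x = c"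
    using has_derivative_zero_constant[of ?I g] convex_real_interval(5) by blast
  have "poly2 F (a - \<delta> / 2, \<gamma> (a - \<delta> / 2)) = poly2 F (a, b)"
    using c[of a] c[of "a - \<delta> / 2"] \<delta> \<gamma>a by (simp add: g_def)
  moreover have "a - \<delta> / 2 \<in> ?I" using \<delta> by simp
  ultimately show ?thesis
    using \<gamma>[of "a - \<delta> / 2"] \<delta> \<eta> by (intro exI[of _ "a - \<delta> / 2"] exI[of _ "\<gamma> (a - \<delta> / 2)"]) auto
qed

lemma continue_left:
  assumes "poly2 p (a, b) = 0" and "poly2 (pderiv p) (a, b) \<noteq> 0"
    and "\<And>z. poly2 p z = 0 \<Longrightarrow> poly2 (poly2_dx F) z = 0 \<and> poly2 (pderiv F) z = 0"
    and "e > 0"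
  shows "\<exists>x y. a - e < x \<and> x < a \<and> \<bar>y - b\<bar> < e \<and> poly2 p (x, y) = 0 \<and> poly2 F (x, y) = poly2 F (a, b)"
proof (cases "poly2 (pderiv p) (a, b) > 0")
  case True
  then show ?thesis using continue_left_pos assms by blast
next
  case False
  then have "poly2 (pderiv (- p)) (a, b) > 0" using assms(2) by (simp add: pderiv_minus)
  then show ?thesis using continue_left_pos[of "- p" a b F e] assms by simp
qed

text \<open>The abscissa of a common zero of \<open>p\<close> and \<open>q\<close> is a root of the
  polynomial \<open>r\<close> from the Bezout identity, and \<open>r\<close> has finitely many
  roots.\<close>

lemma bezout_zero_free:
  assumes "prime_elem p" "\<not> p dvd q"
  shows "\<forall>\<^sub>F x in at a. \<forall>y. poly2 p (x, y) = 0 \<longrightarrow> poly2 q (x, y) \<noteq> 0"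
proof -
  obtain u v r where r: "r \<noteq> 0" "u * p + v * q = [:r:]" using bezout_over_coefficients[OF assms] .
  have *: "poly r x = poly2 u (x, y) * poly2 p (x, y) + poly2 v (x, y) * poly2 q (x, y)" for x y
    using arg_cong[OF r(2), of "\<lambda>P. poly2 P (x, y)"] by simp
  show ?thesis
    using eventually_poly_nonzero[OF r(1), of a] by eventually_elim (metis * add.right_neutral mult_zero_right)
qed

text \<open>If \<open>p\<close> does not divide the derivative in \<open>x\<close>, Bezout settles
  the claim. Otherwise all of \<open>p = 0\<close> is critical for \<open>F\<close>; when
  \<open>p\<close> has degree zero in \<open>y\<close>, its zeros form finitely many vertical lines,
  and in the remaining case a zero close to the axis is refuted by continuation to the left.\<close>

lemma critical_prime_factor:
  fixes F :: "real poly poly"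
  assumes r: "r > 0" and F0: "poly2 F (0, 0) = 0"
    and pos: "\<And>x y. \<bar>x\<bar> \<le> r \<Longrightarrow> \<bar>y\<bar> \<le> r \<Longrightarrow> (x, y) \<noteq> (0, 0) \<Longrightarrow> poly2 F (x, y) > 0"
    and y0: "\<And>y. \<bar>y\<bar> \<le> r \<Longrightarrow> y \<noteq> 0 \<Longrightarrow> poly2 (pderiv F) (0, y) \<noteq> 0"
    and p: "prime_elem p" and dy: "p dvd pderiv F"
  shows "\<forall>\<^sub>F x in at_right 0. \<forall>y. \<bar>y\<bar> \<le> r \<longrightarrow> poly2 p (x, y) = 0 \<longrightarrow> poly2 (poly2_dx F) (x, y) \<noteq> 0"
proof (cases "p dvd poly2_dx F")
  case False
  have "\<forall>\<^sub>F x in at 0. \<forall>y. poly2 p (x, y) = 0 \<longrightarrow> poly2 (poly2_dx F) (x, y) \<noteq> 0"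
    by (rule bezout_zero_free[OF p False])
  then have "\<forall>\<^sub>F x in at_right 0. \<forall>y. poly2 p (x, y) = 0 \<longrightarrow> poly2 (poly2_dx F) (x, y) \<noteq> 0"
    by (rule filter_leD[OF at_le, rotated]) simp
  then show ?thesis by eventually_elim blast
next
  case dx: True
  have p0: "p \<noteq> 0" using p by (simp add: prime_elem_def)
  show ?thesis
  proof (cases "degree p = 0")
    case True
    then obtain a where a: "p = [:a:]" by (rule degree_eq_zeroE)
    have "\<forall>\<^sub>F x in at 0. poly a x \<noteq> 0" using p0 a by (intro eventually_poly_nonzero) auto
    then have "\<forall>\<^sub>F x in at_right 0. poly a x \<noteq> 0"
      by (rule filter_leD[OF at_le, rotated]) simp
    then show ?thesis by eventually_elim (simp add: a)
  next
    case False
    \<comment> \<open>The lower degree in \<open>y\<close> keeps \<open>p\<close> from dividing its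
      derivative, so Bezout applies once more and singular points of the curve stay away from a
      one-sided neighbourhood of the axis.\<close>
    then have "pderiv p \<noteq> 0" "degree (pderiv p) < degree p" by (auto simp: pderiv_eq_0_iff degree_pderiv)
    then have "\<not> p dvd pderiv p" using dvd_imp_degree_le by fastforce
    then have "\<forall>\<^sub>F x in at 0. \<forall>y. poly2 p (x, y) = 0 \<longrightarrow> poly2 (pderiv p) (x, y) \<noteq> 0"
      by (rule bezout_zero_free[OF p])
    then have "\<forall>\<^sub>F x in at_right 0. \<forall>y. poly2 p (x, y) = 0 \<longrightarrow> poly2 (pderiv p) (x, y) \<noteq> 0"
      by (rule filter_leD[OF at_le, rotated]) simp
    then obtain \<delta>1 where \<delta>1: "\<delta>1 > 0" "\<And>x y. 0 < x \<Longrightarrow> x < \<delta>1 \<Longrightarrow> poly2 p (x, y) = 0 \<Longrightarrow> poly2 (pderiv p) (x, y) \<noteq> 0"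
      unfolding eventually_at_right_field by auto
    have crit: "poly2 (poly2_dx F) z = 0 \<and> poly2 (pderiv F) z = 0" if "poly2 p z = 0" for z
      using dx dy that by (auto simp: dvd_def)
    have p0y: "poly2 p (0, y) \<noteq> 0" if "\<bar>y\<bar> \<le> r" "y \<noteq> 0" for y
      using crit y0 that by blast
    have open_ne: "open {z. poly2 p z \<noteq> 0}" by (intro open_Collect_neq continuous_intros)
    obtain \<delta>2 where \<delta>2: "\<delta>2 > 0" "\<And>x y. \<bar>x - 0\<bar> \<le> \<delta>2 \<Longrightarrow> \<bar>y - r\<bar> \<le> \<delta>2 \<Longrightarrow> (x, y) \<in> {z. poly2 p z \<noteq> 0}"
      using open_contains_box[OF open_ne, of 0 r] p0y r by auto
    obtain \<delta>3 where \<delta>3: "\<delta>3 > 0" "\<And>x y. \<bar>x - 0\<bar> \<le> \<delta>3 \<Longrightarrow> \<bar>y - (- r)\<bar> \<le> \<delta>3 \<Longrightarrow> (x, y) \<in> {z. poly2 p z \<noteq> 0}"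
      using open_contains_box[OF open_ne, of 0 "- r"] p0y r by auto
    define \<delta> where "\<delta> = min r (min \<delta>1 (min \<delta>2 \<delta>3))"
    have \<delta>: "\<delta> > 0" using r \<delta>1 \<delta>2 \<delta>3 by (auto simp: \<delta>_def)
    have "poly2 p (x1, y1) \<noteq> 0" if x1: "0 < x1" "x1 < \<delta>" and y1: "\<bar>y1\<bar> \<le> r" for x1 y1
    proof
      assume p1: "poly2 p (x1, y1) = 0"
      define c where "c = poly2 F (x1, y1)"
      have "c > 0" unfolding c_def using x1 y1 by (intro pos) (auto simp: \<delta>_def)
      \<comment> \<open>\<open>Z\<close> is the part of the curve at the level \<open>c\<close> of
        the given point. Its leftmost point is not on the axis, where the curve can only meet the
        origin and \<open>F\<close> vanishes, and not on the horizontal sides by the choice of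
        \<open>\<delta>2\<close> and \<open>\<delta>3\<close>. \<open>continue_left\<close> then
        yields a point of \<open>Z\<close> further left.\<close>
      define Z where "Z = ({0..x1} \<times> {-r..r}) \<inter> {z. poly2 p z = 0} \<inter> {z. poly2 F z = c}"
      have "compact Z" unfolding Z_def
        by (intro compact_Int_closed closed_Collect_eq continuous_intros compact_Times compact_Icc)
      moreover have "(x1, y1) \<in> Z" using x1 y1 p1 by (auto simp: Z_def c_def)
      ultimately have "\<exists>z\<in>Z. \<forall>w\<in>Z. fst z \<le> fst w"
        by (intro continuous_attains_inf continuous_on_fst continuous_on_id) auto
      then obtain z where z: "z \<in> Z" "\<And>w. w \<in> Z \<Longrightarrow> fst z \<le> fst w" by blast
      obtain a b where ab: "z = (a, b)" by force
      have b: "0 \<le> a" "a \<le> x1" "\<bar>b\<bar> \<le> r" "poly2 p (a, b) = 0" "poly2 F (a, b) = c"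
        using z(1) by (auto simp: ab Z_def)
      have "a \<noteq> 0"
      proof
        assume "a = 0"
        then have "b = 0" using p0y b by auto
        then show False using \<open>a = 0\<close> b F0 \<open>c > 0\<close> by simp
      qed
      then have "a > 0" using b by simp
      have "\<bar>b\<bar> \<noteq> r" using \<delta>2(2)[of a b] \<delta>3(2)[of a b] \<delta>2(1) \<delta>3(1) b x1 by (auto simp: \<delta>_def abs_if split: if_splits)
      then have "\<bar>b\<bar> < r" using b by simp
      define e where "e = min a (r - \<bar>b\<bar>)"
      have e: "e > 0" "e \<le> a" "e \<le> r - \<bar>b\<bar>" using \<open>a > 0\<close> \<open>\<bar>b\<bar> < r\<close> by (auto simp: e_def)
      have "poly2 (pderiv p) (a, b) \<noteq> 0" using \<delta>1(2)[of a b] \<open>a > 0\<close> b x1 by (auto simp: \<delta>_def)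
      from continue_left[OF b(4) this crit e(1)]
      obtain x y where xy: "a - e < x" "x < a" "\<bar>y - b\<bar> < e" "poly2 p (x, y) = 0" "poly2 F (x, y) = poly2 F (a, b)"
        by blast
      then have "(x, y) \<in> Z" using e b by (auto simp: Z_def)
      then show False using z(2)[of "(x, y)"] xy by (simp add: ab)
    qed
    then show ?thesis unfolding eventually_at_right_field using \<delta> by blast
  qed
qed

text \<open>A critical point is a zero of one of the finitely many prime factors of
  \<open>pderiv F\<close>, and each factor is handled separately.\<close>

lemma critical_points_right:
  fixes F :: "real poly poly"
  assumes r: "r > 0" and F0: "poly2 F (0, 0) = 0"
    and pos: "\<And>x y. \<bar>x\<bar> \<le> r \<Longrightarrow> \<bar>y\<bar> \<le> r \<Longrightarrow> (x, y) \<noteq> (0, 0) \<Longrightarrow> poly2 F (x, y) > 0"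
    and y0: "\<And>y. \<bar>y\<bar> \<le> r \<Longrightarrow> y \<noteq> 0 \<Longrightarrow> poly2 (pderiv F) (0, y) \<noteq> 0"
  shows "\<forall>\<^sub>F x in at_right 0. \<forall>y. \<bar>y\<bar> \<le> r \<longrightarrow> poly2 (poly2_dx F) (x, y) \<noteq> 0 \<or> poly2 (pderiv F) (x, y) \<noteq> 0"
proof -
  have "pderiv F \<noteq> 0" using y0[of r] r by auto
  have "\<forall>\<^sub>F x in at_right 0. \<forall>p\<in>prime_factors (pderiv F). \<forall>y. \<bar>y\<bar> \<le> r \<longrightarrow> poly2 p (x, y) = 0 \<longrightarrow> poly2 (poly2_dx F) (x, y) \<noteq> 0"
    by (intro eventually_ball_finite ballI critical_prime_factor[OF r F0 pos y0])
       (auto dest: in_prime_factors_imp_prime)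
  then show ?thesis
    by eventually_elim (metis poly2_prime_factor_zero[OF \<open>pderiv F \<noteq> 0\<close>])
qed

lemma poly2_restrict_y: "\<exists>q. \<forall>y. poly2 P (0, y) = poly q y"
proof (induction P)
  case (pCons a P)
  then obtain q where "\<forall>y. poly2 P (0, y) = poly q y" by blast
  then show ?case by (intro exI[of _ "pCons (poly a 0) q"]) simp
qed (auto intro: exI[of _ 0])

lemma isolated_critical_point:
  assumes f: "real_polynomial_function f" and f0: "f (0, 0) = 0" and min: "strict_local_min_at f (0, 0)"
  obtains F r where "f = poly2 F" "r > 0" "\<And>x y. \<bar>x\<bar> \<le> r \<Longrightarrow> \<bar>y\<bar> \<le> r \<Longrightarrow> (x, y) \<noteq> (0, 0) \<Longrightarrow> poly2 F (x, y) > 0"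
    "\<And>y. \<bar>y\<bar> \<le> r \<Longrightarrow> y \<noteq> 0 \<Longrightarrow> poly2 (pderiv F) (0, y) \<noteq> 0"
    "\<And>x y. \<bar>x\<bar> \<le> r \<Longrightarrow> \<bar>y\<bar> \<le> r \<Longrightarrow> (x, y) \<noteq> (0, 0) \<Longrightarrow> poly2 (poly2_dx F) (x, y) \<noteq> 0 \<or> poly2 (pderiv F) (x, y) \<noteq> 0"
proof -
  obtain F where F: "f = poly2 F" using real_polynomial_function_poly2[OF f] .
  have "\<forall>\<^sub>F q in at (0, 0). 0 < f q" using min f0 by (simp add: strict_local_min_at_def)
  then obtain U where U: "open U" "(0, 0) \<in> U" "\<And>q. q \<in> U \<Longrightarrow> q \<noteq> (0, 0) \<Longrightarrow> 0 < f q"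
    unfolding eventually_at_topological by blast
  obtain r1 where r1: "r1 > 0" "\<And>x y. \<bar>x\<bar> \<le> r1 \<Longrightarrow> \<bar>y\<bar> \<le> r1 \<Longrightarrow> (x, y) \<in> U"
    using open_contains_box[OF U(1,2)] by auto
  obtain q where q: "\<And>y. poly2 (pderiv F) (0, y) = poly q y" using poly2_restrict_y by blast
  have "q \<noteq> 0"
  proof
    assume "q = 0"
    then have "((\<lambda>y. poly2 F (0, y)) has_real_derivative 0) (at y)" for y
      using poly2_DERIV_y[of F 0 y UNIV] q[of y] by simp
    then have "poly2 F (0, r1) = poly2 F (0, 0)" using DERIV_isconst_all[of "\<lambda>y. poly2 F (0, y)"] by blast
    moreover have "0 < f (0, r1)" using U(3) r1 by simp
    ultimately show False using f0 F by simp
  qed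
  then have "\<forall>\<^sub>F y in at 0. poly q y \<noteq> 0" by (rule eventually_poly_nonzero)
  then obtain r2 where r2: "r2 > 0" "\<And>y. y \<noteq> 0 \<Longrightarrow> \<bar>y\<bar> < r2 \<Longrightarrow> poly q y \<noteq> 0"
    unfolding eventually_at by (auto simp: dist_real_def)
  define r where "r = min r1 (r2 / 2)"
  have r: "r > 0" using r1 r2 by (auto simp: r_def)
  have pos: "poly2 F (x, y) > 0" if "\<bar>x\<bar> \<le> r" "\<bar>y\<bar> \<le> r" "(x, y) \<noteq> (0, 0)" for x y
    using U(3)[of "(x, y)"] r1 that F by (auto simp: r_def)
  have y0: "poly2 (pderiv F) (0, y) \<noteq> 0" if "\<bar>y\<bar> \<le> r" "y \<noteq> 0" for y
    using r2 that by (auto simp: r_def q)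
  have F0: "poly2 F (0, 0) = 0" using f0 F by simp
  have "\<forall>\<^sub>F x in at_right 0. \<forall>y. \<bar>y\<bar> \<le> r \<longrightarrow> poly2 (poly2_dx F) (x, y) \<noteq> 0 \<or> poly2 (pderiv F) (x, y) \<noteq> 0"
    by (rule critical_points_right[OF r F0 pos y0])
  then obtain \<delta>1 where \<delta>1: "\<delta>1 > 0" "\<And>x y. 0 < x \<Longrightarrow> x < \<delta>1 \<Longrightarrow> \<bar>y\<bar> \<le> r \<Longrightarrow> poly2 (poly2_dx F) (x, y) \<noteq> 0 \<or> poly2 (pderiv F) (x, y) \<noteq> 0"
    unfolding eventually_at_right_field by blast
  \<comment> \<open>\<open>G\<close> is \<open>F\<close> reflected in the axis \<open>x = 0\<close>;
    it turns the statement for the right half into the one for the left half.\<close>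
  define G where "G = map_poly (\<lambda>a. pcompose a [:0, -1:]) F"
  have G: "poly2 (map_poly (\<lambda>a. pcompose a [:0, -1:]) P) (x, y) = poly2 P (- x, y)" for P x y
    by (induction P) (simp_all add: map_poly_pCons poly_pcompose)
  have G0: "poly2 G (x, y) = poly2 F (- x, y)" for x y by (simp add: G_def G)
  have Gy: "poly2 (pderiv G) (x, y) = poly2 (pderiv F) (- x, y)" for x y
    by (rule DERIV_unique[OF poly2_DERIV_y[of G x y UNIV]]) (simp add: G0 poly2_DERIV_y)
  have Gx: "poly2 (poly2_dx G) (x, y) = - poly2 (poly2_dx F) (- x, y)" for x y
  proof -
    have "((\<lambda>x. poly2 F (- x, y)) has_real_derivative poly2 (poly2_dx F) (- x, y) * (- 1)) (at x)"
      by (rule DERIV_chain2[OF poly2_DERIV_x]) (auto intro!: derivative_eq_intros)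
    then show ?thesis
      by (intro DERIV_unique[OF poly2_DERIV_x[of G y x UNIV]]) (simp add: G0)
  qed
  have "\<forall>\<^sub>F x in at_right 0. \<forall>y. \<bar>y\<bar> \<le> r \<longrightarrow> poly2 (poly2_dx G) (x, y) \<noteq> 0 \<or> poly2 (pderiv G) (x, y) \<noteq> 0"
    using pos y0 F0 by (intro critical_points_right[OF r]) (auto simp: Gy G0)
  then obtain \<delta>2 where \<delta>2: "\<delta>2 > 0" "\<And>x y. 0 < x \<Longrightarrow> x < \<delta>2 \<Longrightarrow> \<bar>y\<bar> \<le> r \<Longrightarrow> poly2 (poly2_dx F) (- x, y) \<noteq> 0 \<or> poly2 (pderiv F) (- x, y) \<noteq> 0"
    unfolding eventually_at_right_field Gx Gy by auto
  define R where "R = min r (min (\<delta>1 / 2) (\<delta>2 / 2))"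
  have R: "R > 0" "R \<le> r" using r \<delta>1 \<delta>2 by (auto simp: R_def)
  have crit: "poly2 (poly2_dx F) (x, y) \<noteq> 0 \<or> poly2 (pderiv F) (x, y) \<noteq> 0"
    if "\<bar>x\<bar> \<le> R" "\<bar>y\<bar> \<le> R" "(x, y) \<noteq> (0, 0)" for x y
  proof -
    consider "x = 0" | "x > 0" | "x < 0" by linarith
    then show ?thesis
    proof cases
      case 1 then show ?thesis using y0 that R by auto
    next
      case 2 then show ?thesis using \<delta>1(2)[of x y] \<delta>1(1) that R by (auto simp: R_def)
    next
      case 3 then show ?thesis using \<delta>2(2)[of "- x" y] \<delta>2(1) that R by (auto simp: R_def)
    qed
  qed
  show thesis
    by (rule that[OF F R(1)]) (use pos y0 crit R in auto)
qed

section \<open>Rooted graphs in which every edge is a bridge\<close>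

text \<open>The rest of a cycle runs from \<open>c ! 1\<close> round to \<open>c ! 0\<close> and
  bypasses the edge between them.\<close>

lemma bridges_no_cycle:
  assumes "sym A"
    and bridge: "\<And>u v. (u, v) \<in> A \<Longrightarrow> (u, v) \<notin> (A - {(u, v), (v, u)})\<^sup>*"
  shows "\<not> is_cycle A c"
proof
  assume c: "is_cycle A c"
  define n where "n = length c"
  have n: "3 \<le> n" and dist: "distinct c"
    and step: "\<And>i. i < n \<Longrightarrow> (c ! i, c ! (Suc i mod n)) \<in> A"
    using c by (auto simp: is_cycle_def n_def)
  have eq: "c ! i = c ! j \<longleftrightarrow> i = j" if "i < n" "j < n" for i j
    using that dist by (simp add: n_def nth_eq_iff_index_eq)
  let ?B = "A - {(c ! 0, c ! 1), (c ! 1, c ! 0)}"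
  have "(c ! 1, c ! j) \<in> ?B\<^sup>*" if "1 \<le> j" "j < n" for j
    using that
  proof (induction j rule: dec_induct)
    case (step j)
    have "(c ! j, c ! Suc j) \<in> A" using step assms(1) \<open>\<And>i. i < n \<Longrightarrow> (c ! i, c ! (Suc i mod n)) \<in> A\<close>[of j] by simp
    moreover have "c ! j \<noteq> c ! 0" "c ! Suc j \<noteq> c ! 0" using eq step n by auto
    ultimately have "(c ! j, c ! Suc j) \<in> ?B" by auto
    with step show ?case by (simp add: rtrancl.rtrancl_into_rtrancl)
  qed simp
  from this[of "n - 1"] have "(c ! 1, c ! (n - 1)) \<in> ?B\<^sup>*" using n by simp
  moreover have "(c ! (n - 1), c ! 0) \<in> ?B"
  proof -
    have "(c ! (n - 1), c ! 0) \<in> A" using step[of "n - 1"] n by simp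
    moreover have "c ! (n - 1) \<noteq> c ! 0" "c ! (n - 1) \<noteq> c ! 1" using eq n by auto
    ultimately show ?thesis by auto
  qed
  ultimately have "(c ! 1, c ! 0) \<in> ?B\<^sup>*" by (rule rtrancl_into_rtrancl)
  moreover have "sym ?B" using assms(1) by (auto simp: sym_def)
  ultimately have "(c ! 0, c ! 1) \<in> ?B\<^sup>*" by (meson sym_rtrancl symE)
  moreover have "(c ! 0, c ! 1) \<in> A" using step[of 0] n by simp
  ultimately show False using bridge by blast
qed

text \<open>Acyclicity is replaced by the bridge property because the latter is what unicoherence
  delivers.\<close>

locale bridge_graph =
  fixes T :: "'v rooted_graph"
  assumes fin: "finite (vertices T)" and rootV: "root T \<in> vertices T"
    and adjV: "adj T \<subseteq> vertices T \<times> vertices T" and symA: "sym (adj T)" and irr: "irrefl (adj T)"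
    and conn: "\<And>v. v \<in> vertices T \<Longrightarrow> (root T, v) \<in> (adj T)\<^sup>*"
    and bridge: "\<And>u v. (u, v) \<in> adj T \<Longrightarrow> (u, v) \<notin> (adj T - {(u, v), (v, u)})\<^sup>*"
begin

lemma rooted_tree: "rooted_tree T"
proof -
  have "(u, v) \<in> (adj T)\<^sup>*" if "u \<in> vertices T" "v \<in> vertices T" for u v
    using conn[OF that(1)] conn[OF that(2)] symA by (meson rtrancl_trans sym_rtrancl symE)
  moreover have "\<not> is_cycle (adj T) c" for c using symA bridge by (rule bridges_no_cycle)
  ultimately show ?thesis using fin rootV adjV symA irr by (auto simp: rooted_tree_def)
qed

lemma depth_relpow: "v \<in> vertices T \<Longrightarrow> (root T, v) \<in> adj T ^^ depth T v"
  unfolding depth_def using conn[of v] by (metis (mono_tags, lifting) LeastI rtrancl_power)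

lemma depth_le: "(root T, v) \<in> adj T ^^ n \<Longrightarrow> depth T v \<le> n"
  unfolding depth_def by (rule Least_le)

lemma depth_root [simp]: "depth T (root T) = 0"
  using depth_le[of "root T" 0] by simp

lemma depth_eq_0: "v \<in> vertices T \<Longrightarrow> depth T v = 0 \<Longrightarrow> v = root T"
  using depth_relpow by fastforce

lemma pred:
  assumes "v \<in> vertices T" "v \<noteq> root T"
  obtains w where "(w, v) \<in> adj T" "depth T w < depth T v"
proof -
  obtain n where n: "depth T v = Suc n" using depth_eq_0 assms by (cases "depth T v") auto
  then have "(root T, v) \<in> adj T ^^ Suc n" using depth_relpow assms by metis
  then obtain w where "(root T, w) \<in> adj T ^^ n" "(w, v) \<in> adj T" by auto
  then show ?thesis using that depth_le n by (metis less_Suc_eq_le)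
qed

text \<open>Along a chain of predecessors the depth strictly decreases, so all vertices after
  \<open>w\<close> are less deep than \<open>v\<close> and thus different from it.\<close>

lemma root_path_avoiding:
  assumes "w \<in> vertices T" "depth T w \<le> depth T v" "w \<noteq> v"
  shows "(root T, w) \<in> {(x, y) \<in> adj T. x \<noteq> v \<and> y \<noteq> v}\<^sup>*"
  using assms
proof (induction "depth T w" arbitrary: w rule: less_induct)
  case less
  show ?case
  proof (cases "w = root T")
    case False
    then obtain w' where w': "(w', w) \<in> adj T" "depth T w' < depth T w" using pred less by blast
    then have "w' \<noteq> v" using less.prems by auto
    have "(root T, w') \<in> {(x, y) \<in> adj T. x \<noteq> v \<and> y \<noteq> v}\<^sup>*"
    proof (rule less.hyps)
      show "w' \<in> vertices T" using w' adjV by auto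
    qed (use w' less.prems \<open>w' \<noteq> v\<close> in auto)
    moreover have "(w', w) \<in> {(x, y) \<in> adj T. x \<noteq> v \<and> y \<noteq> v}" using w' less.prems \<open>w' \<noteq> v\<close> by simp
    ultimately show ?thesis by (rule rtrancl_into_rtrancl)
  qed simp
qed

text \<open>Two such neighbours are joined through the root without meeting \<open>v\<close>.
  Together with the edge from \<open>v\<close> to \<open>w'\<close> this bypasses the edge from
  \<open>v\<close> to \<open>w\<close>.\<close>

lemma parent_unique:
  assumes "(v, w) \<in> adj T" "depth T w \<le> depth T v" "(v, w') \<in> adj T" "depth T w' \<le> depth T v"
  shows "w = w'"
proof (rule ccontr)
  assume ne: "w \<noteq> w'"
  let ?P = "{(x, y) \<in> adj T. x \<noteq> v \<and> y \<noteq> v}"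
  let ?B = "adj T - {(v, w), (w, v)}"
  have v: "w \<noteq> v" "w' \<noteq> v" using assms irr by (auto simp: irrefl_def)
  have "(root T, w) \<in> ?P\<^sup>*" "(root T, w') \<in> ?P\<^sup>*"
    using assms v adjV by (auto intro!: root_path_avoiding)
  moreover have "sym ?P" using symA by (auto simp: sym_def)
  ultimately have "(w', w) \<in> ?P\<^sup>*" by (meson rtrancl_trans sym_rtrancl symE)
  moreover have "?P \<subseteq> ?B" by auto
  ultimately have "(w', w) \<in> ?B\<^sup>*" using rtrancl_mono by blast
  moreover have "(v, w') \<in> ?B" using assms ne v by auto
  ultimately have "(v, w) \<in> ?B\<^sup>*" by (simp add: converse_rtrancl_into_rtrancl)
  then show False using bridge assms by blast
qed

text \<open>Exactly one neighbour is not deeper: \<open>pred\<close> provides one, and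
  \<open>parent_unique\<close> allows no second.\<close>

lemma card_children:
  assumes "v \<in> vertices T" "v \<noteq> root T"
  shows "card (children T v) = card (adj T `` {v}) - 1"
proof -
  obtain w where w: "(w, v) \<in> adj T" "depth T w < depth T v" using pred assms .
  then have vw: "(v, w) \<in> adj T" using symA by (meson symE)
  have "depth T v < depth T x \<longleftrightarrow> x \<noteq> w" if "(v, x) \<in> adj T" for x
    using parent_unique[OF vw _ that] w by (metis linorder_not_le order_less_imp_le)
  then have "children T v = adj T `` {v} - {w}" using w by (auto simp: children_def)
  moreover have "finite (adj T `` {v})" by (rule finite_subset[OF _ fin]) (use adjV in auto)
  ultimately show ?thesis using vw by simp
qed

lemma children_root: "children T (root T) = adj T `` {root T}"
proof -
  have "depth T w > 0" if "(root T, w) \<in> adj T" for w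
    using that irr adjV depth_eq_0 by (metis SigmaD2 irreflD neq0_conv subsetD)
  then show ?thesis by (auto simp: children_def)
qed

text \<open>The root has no parent and keeps its two neighbours as children; one or three neighbours
  of another vertex leave zero or two children.\<close>

lemma complete_binary_treeI:
  assumes "card (adj T `` {root T}) = 2"
    and "\<And>v. v \<in> vertices T \<Longrightarrow> v \<noteq> root T \<Longrightarrow> card (adj T `` {v}) \<in> {1, 3}"
  shows "complete_binary_tree T"
  unfolding complete_binary_tree_def
proof (intro conjI ballI impI)
  show "rooted_tree T" by (rule rooted_tree)
  fix v assume v: "v \<in> vertices T" "children T v \<noteq> {}"
  have "finite (adj T `` {v})" by (rule finite_subset[OF _ fin]) (use adjV in auto)
  then have "finite (children T v)" by (rule rev_finite_subset) (auto simp: children_def)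
  then have "card (children T v) \<noteq> 0" using v by simp
  then show "card (children T v) = 2"
    using assms children_root card_children v by (cases "v = root T") fastforce+
qed

end

text \<open>Transport of structure along the isomorphism \<open>h\<close>, which allows
  \<open>T\<close> to have vertices of an arbitrary type.\<close>

lemma same_combinatorial_type_tree:
  fixes S :: "'v rooted_graph" and T :: "'w rooted_graph"
  assumes st: "same_combinatorial_type S T" and S: "complete_binary_tree S"
    and lin: "linear_order_on (vertices S) (vle S)"
  shows "complete_binary_tree T \<and> linear_order_on (vertices T) (vle T)"
proof -
  obtain h where h: "bij_betw h (vertices S) (vertices T)" and hr: "h (root S) = root T"
    and ha: "map_prod h h ` adj S = adj T" and hv: "map_prod h h ` vle S = vle T"
    using st by (auto simp: same_combinatorial_type_def)
  have tree: "rooted_tree S" using S by (simp add: complete_binary_tree_def)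
  have adjS: "adj S \<subseteq> vertices S \<times> vertices S" and "root S \<in> vertices S" and finS: "finite (vertices S)"
    using tree by (auto simp: rooted_tree_def)
  have inj: "inj_on h (vertices S)" and im: "h ` vertices S = vertices T"
    using h by (auto simp: bij_betw_def)
  have mem: "(h u, h v) \<in> map_prod h h ` R \<longleftrightarrow> (u, v) \<in> R"
    if "u \<in> vertices S" "v \<in> vertices S" "R \<subseteq> vertices S \<times> vertices S" for u v and R
  proof
    assume "(h u, h v) \<in> map_prod h h ` R"
    then obtain x y where xy: "(x, y) \<in> R" "h u = h x" "h v = h y" by auto
    then have "x \<in> vertices S" "y \<in> vertices S" using that by auto
    then have "u = x" "v = y" using xy that inj by (auto dest: inj_onD)
    then show "(u, v) \<in> R" using xy by simp
  qed (auto intro: image_eqI[of _ _ "(u, v)"])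
  have adj: "(h u, h v) \<in> adj T \<longleftrightarrow> (u, v) \<in> adj S" if "u \<in> vertices S" "v \<in> vertices S" for u v
    using mem[OF that adjS] ha by simp
  have adjT: "adj T \<subseteq> vertices T \<times> vertices T"
    using adjS im by (force simp: ha[symmetric])
  have vleS: "vle S \<subseteq> vertices S \<times> vertices S"
    using lin by (auto simp: linear_order_on_def partial_order_on_def preorder_on_def refl_on_def)
  have vle: "(h u, h v) \<in> vle T \<longleftrightarrow> (u, v) \<in> vle S" if "u \<in> vertices S" "v \<in> vertices S" for u v
    using mem[OF that vleS] hv by simp
  have vleT: "vle T \<subseteq> vertices T \<times> vertices T"
    using vleS im by (force simp: hv[symmetric])
  \<comment> \<open>Depth is defined by powers of the adjacency relation. Intermediate vertices of a
    walk in \<open>T\<close> are images under \<open>h\<close>, since \<open>adj T\<close> relates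
    only vertices.\<close>
  have pow: "(h u, h v) \<in> adj T ^^ n \<longleftrightarrow> (u, v) \<in> adj S ^^ n" if "u \<in> vertices S" "v \<in> vertices S" for u v n
    using that
  proof (induction n arbitrary: v)
    case 0 then show ?case using inj by (auto simp: inj_on_def)
  next
    case (Suc n)
    show ?case
    proof
      assume "(h u, h v) \<in> adj T ^^ Suc n"
      then obtain w where w: "(h u, w) \<in> adj T ^^ n" "(w, h v) \<in> adj T" by auto
      then obtain w' where "w = h w'" "w' \<in> vertices S" using adjT unfolding im[symmetric] by blast
      then show "(u, v) \<in> adj S ^^ Suc n" using w Suc adj by auto
    next
      assume "(u, v) \<in> adj S ^^ Suc n"
      then obtain w where w: "(u, w) \<in> adj S ^^ n" "(w, v) \<in> adj S" by auto
      then have "w \<in> vertices S" using adjS by auto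
      then show "(h u, h v) \<in> adj T ^^ Suc n" using w Suc adj by auto
    qed
  qed
  have depth: "depth T (h v) = depth S v" if "v \<in> vertices S" for v
    using pow[of "root S" v] that \<open>root S \<in> vertices S\<close> hr by (simp add: depth_def)
  have ch: "children T (h v) = h ` children S v" if v: "v \<in> vertices S" for v
  proof
    show "children T (h v) \<subseteq> h ` children S v"
    proof
      fix w assume w: "w \<in> children T (h v)"
      then obtain w' where "w = h w'" "w' \<in> vertices S" using adjT unfolding children_def im[symmetric] by blast
      then show "w \<in> h ` children S v" using w adj v depth by (auto simp: children_def)
    qed
    show "h ` children S v \<subseteq> children T (h v)"
      using adj adjS depth v by (auto simp: children_def subset_iff)
  qed
  have card: "card (children T (h v)) = card (children S v)" if "v \<in> vertices S" for v
    unfolding ch[OF that] using adjS inj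
    by (intro card_image inj_on_subset[OF inj]) (auto simp: children_def)
  have conn: "(h u, h v) \<in> (adj T)\<^sup>*" if "u \<in> vertices S" "v \<in> vertices S" for u v
  proof -
    have "(u, v) \<in> (adj S)\<^sup>*" using tree that by (auto simp: rooted_tree_def)
    then obtain n where "(u, v) \<in> adj S ^^ n" by (auto simp: rtrancl_power)
    then show ?thesis using pow that by (auto simp: rtrancl_power)
  qed
  have cyc: "\<not> is_cycle (adj T) c" for c
  proof
    assume c: "is_cycle (adj T) c"
    then have "\<forall>i<length c. c ! i \<in> vertices T" using adjT unfolding is_cycle_def by blast
    then have "c \<in> lists (vertices T)" by (auto simp: in_set_conv_nth)
    then obtain c' where c': "c = map h c'" "set c' \<subseteq> vertices S"
      unfolding im[symmetric] lists_image by (auto simp: in_lists_conv_set)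
    have in1: "c' ! i \<in> vertices S" if "i < length c'" for i using c' that by auto
    have "(c' ! i, c' ! (Suc i mod length c')) \<in> adj S" if i: "i < length c'" for i
    proof -
      have "Suc i mod length c' < length c'" using i by (intro mod_less_divisor) auto
      moreover have "(c ! i, c ! (Suc i mod length c)) \<in> adj T" using c i c' by (auto simp: is_cycle_def)
      ultimately show ?thesis using adj[OF in1 in1] i by (simp add: c')
    qed
    then have "is_cycle (adj S) c'" using c c' by (auto simp: is_cycle_def distinct_map)
    then show False using tree by (auto simp: rooted_tree_def)
  qed
  have symS: "sym (adj S)" "irrefl (adj S)" using tree by (auto simp: rooted_tree_def)
  have "sym (adj T)"
  proof (rule symI)
    fix a b assume ab: "(a, b) \<in> adj T"
    then obtain a' b' where "(a', b') \<in> adj S" "a = h a'" "b = h b'" unfolding ha[symmetric] by auto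
    then show "(b, a) \<in> adj T" using adj adjS symS(1) by (metis SigmaD1 SigmaD2 subsetD symE)
  qed
  moreover have "irrefl (adj T)"
  proof (rule irreflI)
    fix a show "(a, a) \<notin> adj T"
    proof
      assume a: "(a, a) \<in> adj T"
      then obtain b where "a = h b" "b \<in> vertices S" using adjT unfolding im[symmetric] by blast
      then show False using adj a symS(2) by (auto simp: irrefl_def)
    qed
  qed
  moreover have "\<forall>u\<in>vertices T. \<forall>v\<in>vertices T. (u, v) \<in> (adj T)\<^sup>*" using conn by (auto simp: im[symmetric])
  moreover have "root T \<in> vertices T" by (metis hr im imageI \<open>root S \<in> vertices S\<close>)
  moreover have "finite (vertices T)" by (metis finS im finite_imageI)
  ultimately have "rooted_tree T" using adjT cyc by (simp add: rooted_tree_def)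
  moreover have "card (children T v) = 2" if "v \<in> vertices T" "children T v \<noteq> {}" for v
  proof -
    have "v \<in> h ` vertices S" using that(1) im by simp
    then obtain u where "u \<in> vertices S" "v = h u" by blast
    then show ?thesis using card ch that S by (auto simp: complete_binary_tree_def)
  qed
  moreover have "linear_order_on (vertices T) (vle T)"
  proof -
    have t: "trans (vle S)" and r: "refl_on (vertices S) (vle S)" and a: "antisym (vle S)" and tot: "total_on (vertices S) (vle S)"
      using lin by (auto simp: linear_order_on_def partial_order_on_def preorder_on_def)
    have "\<exists>u'\<in>vertices S. u = h u'" if "u \<in> vertices T" for u using that unfolding im[symmetric] by blast
    note ex = this
    have "trans (vle T)"
    proof (rule transI)
      fix x y z assume xy: "(x, y) \<in> vle T" "(y, z) \<in> vle T"
      then obtain x' y' z' where "x = h x'" "y = h y'" "z = h z'" "x' \<in> vertices S" "y' \<in> vertices S" "z' \<in> vertices S"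
        using vleT ex by (metis SigmaD1 SigmaD2 subsetD)
      then show "(x, z) \<in> vle T" using xy vle t by (meson transD)
    qed
    moreover have "antisym (vle T)"
    proof (rule antisymI)
      fix x y assume xy: "(x, y) \<in> vle T" "(y, x) \<in> vle T"
      then obtain x' y' where "x = h x'" "y = h y'" "x' \<in> vertices S" "y' \<in> vertices S"
        using vleT ex by (metis SigmaD1 SigmaD2 subsetD)
      moreover from this have "(x', y') \<in> vle S" "(y', x') \<in> vle S" using xy vle by simp_all
      then have "x' = y'" by (rule antisymD[OF a])
      ultimately show "x = y" by simp
    qed
    moreover have "refl_on (vertices T) (vle T)"
      using vle ex r by (metis refl_on_def)
    moreover have "total_on (vertices T) (vle T)"
    proof (rule total_onI)
      fix x y assume xy: "x \<in> vertices T" "y \<in> vertices T" "x \<noteq> y"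
      then obtain x' y' where "x = h x'" "y = h y'" "x' \<in> vertices S" "y' \<in> vertices S"
        using ex by meson
      then show "(x, y) \<in> vle T \<or> (y, x) \<in> vle T" using xy vle tot by (metis total_on_def)
    qed
    ultimately show ?thesis using vleT by (auto simp: linear_order_on_def partial_order_on_def preorder_on_def)
  qed
  ultimately show ?thesis by (auto simp: complete_binary_tree_def)
qed

section \<open>Reeb quotients of planar disks\<close>

lemma mem_reeb_class: "q \<in> reeb_class D p \<longleftrightarrow> connected_component (D \<inter> fst -` {fst p}) p q"
proof -
  have "x = fst p" if "connected_component (D \<inter> fst -` {x}) p q" for x
    using connected_component_in[OF that] by auto
  then show ?thesis unfolding reeb_class_def reeb_rel_def by auto
qed

lemma reeb_class_eq: "reeb_class D p = connected_component_set (D \<inter> fst -` {fst p}) p"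
  by (rule set_eqI) (simp only: mem_reeb_class mem_Collect_eq)

lemma reeb_class_refl [simp]: "p \<in> reeb_class D p \<longleftrightarrow> p \<in> D"
  by (simp add: mem_reeb_class)

lemma reeb_class_sub:
  assumes "q \<in> reeb_class D p" shows "q \<in> D" "fst q = fst p"
proof -
  have "q \<in> connected_component_set (D \<inter> fst -` {fst p}) p" using assms by (simp only: reeb_class_eq)
  then have "q \<in> D \<inter> fst -` {fst p}" using connected_component_subset by (rule rev_subsetD)
  then show "q \<in> D" "fst q = fst p" by auto
qed

lemma reeb_class_sub_fibre: "reeb_class D p \<subseteq> fst -` {fst p}"
  using reeb_class_sub(2) by blast

lemma reeb_class_same:
  assumes "q \<in> reeb_class D p" shows "reeb_class D q = reeb_class D p"
proof -
  have "q \<in> connected_component_set (D \<inter> fst -` {fst p}) p" using assms by (simp only: reeb_class_eq)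
  then show ?thesis unfolding reeb_class_eq[of D q] reeb_class_eq[of D p] reeb_class_sub(2)[OF assms]
    by (rule connected_component_eq)
qed

lemma connected_reeb_class [simp]: "connected (reeb_class D p)"
  by (simp add: reeb_class_eq)

lemma reeb_class_maximal:
  assumes "connected T" "p \<in> T" "T \<subseteq> D" "\<And>q. q \<in> T \<Longrightarrow> fst q = fst p"
  shows "T \<subseteq> reeb_class D p"
  unfolding reeb_class_eq
  by (rule connected_component_maximal[OF assms(2,1)]) (use assms(3,4) in blast)

lemma compact_reeb_class:
  assumes "compact D" shows "compact (reeb_class D p)"
proof -
  have "closed (D \<inter> fst -` {fst p})"
    by (intro closed_Int compact_imp_closed assms closed_vimage_fst closed_singleton)
  then have "closed (reeb_class D p)" unfolding reeb_class_eq by (rule closed_connected_component)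
  moreover have "reeb_class D p = D \<inter> reeb_class D p" using reeb_class_sub(1) by blast
  ultimately show ?thesis using assms compact_Int_closed by metis
qed

lemma reeb_class_cases: "reeb_class D p = reeb_class D q \<or> reeb_class D p \<inter> reeb_class D q = {}"
  using reeb_class_same by (metis disjoint_iff)

lemma open_connected_bounded_real:
  fixes S :: "real set"
  assumes "open S" "connected S" "bounded S" "S \<noteq> {}"
  shows "S = {Inf S<..<Sup S}"
proof
  have bdd: "bdd_below S" "bdd_above S" using assms(3) by (simp_all add: bounded_imp_bdd_below bounded_imp_bdd_above)
  show "S \<subseteq> {Inf S<..<Sup S}"
  proof
    fix x assume x: "x \<in> S"
    then obtain e where e: "e > 0" "ball x e \<subseteq> S" using assms(1) openE by blast
    then have "x - e / 2 \<in> S" "x + e / 2 \<in> S" by (auto simp: dist_real_def subset_iff)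
    then have "Inf S \<le> x - e / 2" "x + e / 2 \<le> Sup S" using bdd by (auto intro: cInf_lower cSup_upper)
    then show "x \<in> {Inf S<..<Sup S}" using e by auto
  qed
  show "{Inf S<..<Sup S} \<subseteq> S"
  proof
    fix x assume "x \<in> {Inf S<..<Sup S}"
    then obtain a b where "a \<in> S" "a < x" "b \<in> S" "x < b"
      using cInf_less_iff[OF assms(4) bdd(1)] less_cSup_iff[OF assms(4) bdd(2)] by auto
    then show "x \<in> S" using connected_contains_Icc[OF assms(2), of a b] by auto
  qed
qed

text \<open>A tube is an unbranched vertical strip of the disk.\<close>

definition is_tube :: "plane set \<Rightarrow> plane set \<Rightarrow> plane set \<Rightarrow> bool" where
  "is_tube D R N \<longleftrightarrow> openin (top_of_set D) N \<and> N \<subseteq> R \<and> connected N \<and>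
     (\<forall>p\<in>N. N \<inter> fst -` {fst p} = reeb_class D p)"

text \<open>The members of \<open>\<N>\<close> are the germs at \<open>u\<close> of the edges that end in \<open>u\<close>.\<close>

definition is_star :: "plane set \<Rightarrow> plane set \<Rightarrow> plane set \<Rightarrow> plane set set \<Rightarrow> bool" where
  "is_star D R u \<N> \<longleftrightarrow> finite \<N> \<and> disjoint \<N> \<and> \<Union>\<N> \<subseteq> R \<and>
     (\<exists>W. open W \<and> u \<subseteq> W \<and> \<Union>\<N> = D \<inter> W - u) \<and>
     (\<forall>N\<in>\<N>. connected N \<and> N \<noteq> {} \<and> closure N \<inter> u \<noteq> {} \<and> (\<forall>p\<in>N. reeb_class D p \<subseteq> N)) \<and>
     (\<forall>N\<in>\<N>. \<forall>N'\<in>\<N>. (\<exists>p\<in>N. \<exists>p'\<in>N'. fst p = fst p') \<or>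
        (\<exists>p\<in>N. \<exists>p'\<in>N'. \<forall>q\<in>u. fst p < fst q \<and> fst q < fst p') \<or>
        (\<exists>p\<in>N. \<exists>p'\<in>N'. \<forall>q\<in>u. fst p' < fst q \<and> fst q < fst p))"

lemma is_starD:
  assumes "is_star D R u \<N>"
  shows "finite \<N>" "disjoint \<N>" "\<Union>\<N> \<subseteq> R" "\<exists>W. open W \<and> u \<subseteq> W \<and> \<Union>\<N> = D \<inter> W - u"
    and "\<And>N N'. N \<in> \<N> \<Longrightarrow> N' \<in> \<N> \<Longrightarrow> (\<exists>p\<in>N. \<exists>p'\<in>N'. fst p = fst p') \<or>
        (\<exists>p\<in>N. \<exists>p'\<in>N'. \<forall>q\<in>u. fst p < fst q \<and> fst q < fst p') \<or>
        (\<exists>p\<in>N. \<exists>p'\<in>N'. \<forall>q\<in>u. fst p' < fst q \<and> fst q < fst p)"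
    and "\<And>N. N \<in> \<N> \<Longrightarrow> connected N" "\<And>N. N \<in> \<N> \<Longrightarrow> N \<noteq> {}"
      "\<And>N. N \<in> \<N> \<Longrightarrow> closure N \<inter> u \<noteq> {}" "\<And>N p. N \<in> \<N> \<Longrightarrow> p \<in> N \<Longrightarrow> reeb_class D p \<subseteq> N"
  using assms unfolding is_star_def by simp_all

text \<open>What the tree argument takes from the analysis. \<open>V_fst\<close> allows at most one
  vertex on each vertical line, \<open>interior_pt\<close> makes \<open>fst\<close> an open map on
  the regular part, and \<open>tube\<close> and \<open>star\<close> are the local models at regular
  classes and at vertices.\<close>

locale reeb_disk =
  fixes D :: "plane set" and V :: "plane set set" and rt :: "plane set"
  assumes compact: "compact D" and connected: "connected D" and unicoherent: "unicoherent D"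
    and finite_V: "finite V" and root: "rt \<in> V"
    and V_class: "\<And>v. v \<in> V \<Longrightarrow> \<exists>p\<in>D. v = reeb_class D p"
    and V_fst: "\<And>u v p q. u \<in> V \<Longrightarrow> v \<in> V \<Longrightarrow> p \<in> u \<Longrightarrow> q \<in> v \<Longrightarrow> fst p = fst q \<Longrightarrow> u = v"
    and interior_pt: "\<And>p U. p \<in> D - \<Union>V \<Longrightarrow> open U \<Longrightarrow> p \<in> U \<Longrightarrow> \<exists>z\<in>U \<inter> interior D. fst z = fst p"
    and tube: "\<And>p U. p \<in> D - \<Union>V \<Longrightarrow> open U \<Longrightarrow> reeb_class D p \<subseteq> U \<Longrightarrow> \<exists>N\<subseteq>U. p \<in> N \<and> is_tube D (D - \<Union>V) N"
    and star: "\<And>u. u \<in> V \<Longrightarrow> \<exists>\<N>. is_star D (D - \<Union>V) u \<N>"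
begin

section \<open>Arcs, the components of the regular part, and their ends\<close>

abbreviation "R \<equiv> D - \<Union>V"
abbreviation "cls \<equiv> reeb_class D"
abbreviation "arcs \<equiv> components R"

lemma compact_V: "v \<in> V \<Longrightarrow> compact v"
  using V_class compact_reeb_class compact by blast

lemma V_sub: "\<Union>V \<subseteq> D"
  using V_class reeb_class_sub by blast

lemma V_eq_class: "v \<in> V \<Longrightarrow> p \<in> v \<Longrightarrow> v = cls p"
  using V_class reeb_class_same by metis

lemma V_connected: "v \<in> V \<Longrightarrow> connected v"
  using V_class connected_reeb_class by metis

lemma V_nonempty: "v \<in> V \<Longrightarrow> v \<noteq> {}"
  using V_class reeb_class_refl by (metis empty_iff)

lemma V_disjoint: "u \<in> V \<Longrightarrow> v \<in> V \<Longrightarrow> u \<inter> v \<noteq> {} \<Longrightarrow> u = v"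
  using V_fst by blast

lemma V_fst_const: "u \<in> V \<Longrightarrow> p \<in> u \<Longrightarrow> q \<in> u \<Longrightarrow> fst p = fst q"
  using V_class reeb_class_sub(2) by metis

lemma class_notin_V: "p \<in> R \<Longrightarrow> cls p \<notin> V"
  using reeb_class_refl[of p D] by auto

text \<open>\<open>D\<close> is not open, but \<open>interior_pt\<close> moves each point vertically
  into the interior of \<open>D\<close>, and \<open>fst\<close> is open on open subsets of the
  plane.\<close>

lemma open_fst:
  assumes "openin (top_of_set D) C" "C \<subseteq> R"
  shows "open (fst ` C)"
proof -
  obtain T where T: "open T" "C = D \<inter> T" using assms(1) unfolding openin_open by blast
  have "fst ` C = fst ` (T \<inter> interior D)"
  proof
    show "fst ` C \<subseteq> fst ` (T \<inter> interior D)"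
    proof
      fix x assume "x \<in> fst ` C"
      then obtain p where p: "p \<in> C" "x = fst p" by auto
      then have "p \<in> R" "p \<in> T" using assms T by auto
      then show "x \<in> fst ` (T \<inter> interior D)" using interior_pt[of p T] T p by (metis image_eqI)
    qed
    show "fst ` (T \<inter> interior D) \<subseteq> fst ` C" using T interior_subset by auto
  qed
  then show ?thesis using T by (simp add: open_image_fst open_Int)
qed

lemma tubeD:
  assumes "is_tube D R N"
  shows "openin (top_of_set D) N" "N \<subseteq> R" "N \<subseteq> D" "connected N" "open (fst ` N)" "connected (fst ` N)"
    "\<And>p. p \<in> N \<Longrightarrow> cls p \<subseteq> N" "\<And>p q. p \<in> N \<Longrightarrow> q \<in> N \<Longrightarrow> fst q = fst p \<Longrightarrow> q \<in> cls p"
proof -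
  show 1: "openin (top_of_set D) N" "N \<subseteq> R" "connected N"
    and slice: "\<And>p. p \<in> N \<Longrightarrow> cls p \<subseteq> N" "\<And>p q. p \<in> N \<Longrightarrow> q \<in> N \<Longrightarrow> fst q = fst p \<Longrightarrow> q \<in> cls p"
    using assms unfolding is_tube_def by blast+
  show "open (fst ` N)" by (rule open_fst[OF 1(1,2)])
  show "connected (fst ` N)" by (intro connected_continuous_image continuous_on_fst continuous_on_id 1)
  show "N \<subseteq> D" using 1 by blast
qed

lemma small_tube:
  assumes "openin (top_of_set D) A" "p \<in> R" "cls p \<subseteq> A" "open U" "cls p \<subseteq> U"
  obtains N where "is_tube D R N" "p \<in> N" "N \<subseteq> A" "N \<subseteq> U"
proof -
  obtain T where T: "open T" "A = D \<inter> T" using assms(1) unfolding openin_open by blast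
  then obtain N where "N \<subseteq> U \<inter> T" "p \<in> N" "is_tube D R N"
    using tube[OF assms(2), of "U \<inter> T"] assms by auto
  moreover from this have "N \<subseteq> A" using T tubeD(3) by blast
  ultimately show thesis using that by blast
qed

text \<open>The common abscissae of two tubes form an interval. Those over which the slices agree
  form an open nonempty subset, those over which they differ form an open subset too, so
  connectedness excludes a difference.\<close>

lemma tube_slices_agree:
  assumes N: "is_tube D R N1" "is_tube D R N2" "N1 \<inter> N2 \<noteq> {}" and p: "p \<in> N1" "q \<in> N2" "fst p = fst q"
  shows "q \<in> cls p"
proof (rule ccontr)
  assume nq: "q \<notin> cls p"
  note N1 = tubeD[OF N(1)] and N2 = tubeD[OF N(2)]
  let ?I = "fst ` N1 \<inter> fst ` N2"
  let ?A = "fst ` (N1 \<inter> N2)"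
  have convI: "connected ?I"
    using N1(6) N2(6) by (simp add: is_interval_connected_1[symmetric] is_interval_Int)
  have openA: "open ?A" using N1 N2 by (intro open_fst openin_Int) auto
  \<comment> \<open>Different slices are disjoint compact classes; small tubes inside separating
    open sets keep the slices over nearby abscissae apart.\<close>
  have "open (?I - ?A)"
  proof (rule Topological_Spaces.openI)
    fix x assume x: "x \<in> ?I - ?A"
    then obtain a b where ab: "a \<in> N1" "b \<in> N2" "fst a = x" "fst b = x" by auto
    have "cls a \<inter> cls b = {}"
    proof (rule ccontr)
      assume "cls a \<inter> cls b \<noteq> {}"
      then have "cls a = cls b" using reeb_class_cases by blast
      then have "b \<in> N1" using N1(7)[OF ab(1)] reeb_class_refl[of b D] N2(3) ab by blast
      then show False using x ab by auto
    qed
    then obtain U1 U2 where U: "open U1" "open U2" "cls a \<subseteq> U1" "cls b \<subseteq> U2" "U1 \<inter> U2 = {}"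
      using separation_normal_compact[OF compact_reeb_class[OF compact] compact_imp_closed[OF compact_reeb_class[OF compact]]]
      by metis
    obtain M1 where M1: "is_tube D R M1" "a \<in> M1" "M1 \<subseteq> N1" "M1 \<subseteq> U1"
      using small_tube[OF N1(1) _ N1(7)[OF ab(1)] U(1,3)] ab N1(2) by blast
    obtain M2 where M2: "is_tube D R M2" "b \<in> M2" "M2 \<subseteq> N2" "M2 \<subseteq> U2"
      using small_tube[OF N2(1) _ N2(7)[OF ab(2)] U(2,4)] ab N2(2) by blast
    have "fst ` M1 \<inter> fst ` M2 \<subseteq> ?I - ?A"
    proof
      fix y assume "y \<in> fst ` M1 \<inter> fst ` M2"
      then obtain m1 m2 where m: "m1 \<in> M1" "m2 \<in> M2" "fst m1 = y" "fst m2 = y" by auto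
      have "y \<notin> ?A"
      proof
        assume "y \<in> ?A"
        then obtain z where z: "z \<in> N1" "z \<in> N2" "fst z = y" by auto
        have "z \<in> cls m1" using N1(8)[of m1 z] m z M1 by auto
        then have "z \<in> U1" using tubeD(7)[OF M1(1) m(1)] M1 by blast
        moreover have "z \<in> cls m2" using N2(8)[of m2 z] m z M2 by auto
        then have "z \<in> U2" using tubeD(7)[OF M2(1) m(2)] M2 by blast
        ultimately show False using U by blast
      qed
      moreover have "y \<in> ?I" using m M1(3) M2(3) by (metis IntI image_eqI subsetD)
      ultimately show "y \<in> ?I - ?A" by blast
    qed
    moreover have "x \<in> fst ` M1 \<inter> fst ` M2" using M1(2) M2(2) ab by (metis IntI image_eqI)
    ultimately show "\<exists>T. open T \<and> x \<in> T \<and> T \<subseteq> ?I - ?A"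
      using tubeD(5)[OF M1(1)] tubeD(5)[OF M2(1)]
      by (intro exI[of _ "fst ` M1 \<inter> fst ` M2"]) (simp add: open_Int)
  qed
  moreover have "fst p \<in> ?I - ?A"
  proof -
    have "fst p \<notin> ?A"
    proof
      assume "fst p \<in> ?A"
      then obtain z where z: "z \<in> N1" "z \<in> N2" "fst z = fst p" by auto
      then have "z \<in> cls p" "z \<in> cls q" using N1(8)[of p z] N2(8)[of q z] p by auto
      then have "cls p = cls q" using reeb_class_cases[of D p q] by blast
      then show False using nq reeb_class_refl[of q D] p N2(3) by blast
    qed
    moreover have "fst p \<in> ?I" using p by (metis IntI image_eqI)
    ultimately show ?thesis by blast
  qed
  moreover have "?A \<noteq> {}" "?A \<subseteq> ?I" using N(3) by auto
  ultimately show False using convI openA connectedD[OF convI openA, of "?I - ?A"] by blast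
qed

lemma tube_Un:
  assumes N: "is_tube D R N1" "is_tube D R N2" "N1 \<inter> N2 \<noteq> {}"
  shows "is_tube D R (N1 \<union> N2)"
proof -
  note N1 = tubeD[OF N(1)] and N2 = tubeD[OF N(2)]
  have "(N1 \<union> N2) \<inter> fst -` {fst p} = cls p" if p: "p \<in> N1 \<union> N2" for p
  proof
    show "(N1 \<union> N2) \<inter> fst -` {fst p} \<subseteq> cls p"
    proof
      fix q assume q: "q \<in> (N1 \<union> N2) \<inter> fst -` {fst p}"
      have "q \<in> cls p \<or> p \<in> cls q"
        using p q N1(8)[of p q] N2(8)[of p q] tube_slices_agree[OF N, of p q] tube_slices_agree[OF N, of q p] by auto
      then show "q \<in> cls p"
        using reeb_class_same[of p D q] reeb_class_refl[of q D] q N1(3) N2(3) by auto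
    qed
    show "cls p \<subseteq> (N1 \<union> N2) \<inter> fst -` {fst p}"
      using p N1(7)[of p] N2(7)[of p] reeb_class_sub_fibre[of D p] by blast
  qed
  moreover have "connected (N1 \<union> N2)" using N N1 N2 by (intro connected_Un) auto
  ultimately show ?thesis using N1 N2 by (auto simp: is_tube_def openin_Un)
qed

text \<open>The union \<open>A\<close> of all tubes through \<open>p\<close> is a tube, because any
  two of them unite to a tube. It is open and closed in the connected set \<open>E\<close>, hence
  all of it.\<close>

lemma arc_tube:
  assumes E: "E \<in> arcs"
  shows "is_tube D R E"
proof -
  obtain p where p: "p \<in> E" using E in_components_nonempty by blast
  have ER: "E \<subseteq> R" and connE: "connected E" using E by (auto dest: in_components_subset in_components_connected)
  define A where "A = \<Union>{N. is_tube D R N \<and> p \<in> N}"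
  have "cls p \<subseteq> UNIV" by simp
  then obtain N0 where N0: "is_tube D R N0" "p \<in> N0" using tube[of p UNIV] p ER by auto
  have both: "is_tube D R (N \<union> N')" if "is_tube D R N" "p \<in> N" "is_tube D R N'" "p \<in> N'" for N N'
    using tube_Un that by blast
  have tubeA: "is_tube D R A" unfolding is_tube_def
  proof (intro conjI ballI)
    show "openin (top_of_set D) A" unfolding A_def by (intro openin_Union) (auto dest: tubeD)
    show "A \<subseteq> R" unfolding A_def using tubeD(2) by blast
    show "connected A" unfolding A_def by (rule connected_Union) (use tubeD(4) in auto)
    fix q assume "q \<in> A"
    then obtain N where N: "is_tube D R N" "p \<in> N" "q \<in> N" by (auto simp: A_def)
    show "A \<inter> fst -` {fst q} = cls q"
    proof
      show "A \<inter> fst -` {fst q} \<subseteq> cls q"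
      proof
        fix z assume z: "z \<in> A \<inter> fst -` {fst q}"
        then obtain N' where N': "is_tube D R N'" "p \<in> N'" "z \<in> N'" by (auto simp: A_def)
        then show "z \<in> cls q" using tubeD(8)[OF both[OF N(1,2) N'(1,2)], of q z] N z by auto
      qed
      show "cls q \<subseteq> A \<inter> fst -` {fst q}"
        using tubeD(7)[OF N(1,3)] reeb_class_sub_fibre[of D q] N by (auto simp: A_def)
    qed
  qed
  have AE: "A \<subseteq> E" using components_maximal[OF E tubeD(4)[OF tubeA] tubeD(2)[OF tubeA]] p N0 by (auto simp: A_def)
  \<comment> \<open>A tube around a limit point of \<open>A\<close> in \<open>R\<close> meets
    \<open>A\<close>, so joining it to \<open>A\<close> gives a tube through \<open>p\<close>, which
    \<open>A\<close> already contains.\<close>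
  have step: "q \<in> A" if q: "q \<in> R" "q \<in> closure A" for q
  proof -
    obtain N where N: "is_tube D R N" "q \<in> N" using tube[of q UNIV] q by auto
    obtain T where T: "open T" "N = D \<inter> T" using tubeD(1)[OF N(1)] unfolding openin_open by blast
    then have "T \<inter> A \<noteq> {}" using q N open_Int_closure_eq_empty[OF T(1), of A] by blast
    then have "A \<inter> N \<noteq> {}" using T tubeD(3)[OF tubeA] by blast
    then have "is_tube D R (A \<union> N)" using tube_Un tubeA N by blast
    moreover have "p \<in> A" using N0 by (auto simp: A_def)
    ultimately show "q \<in> A" using N by (auto simp: A_def)
  qed
  have "closedin (top_of_set E) A"
  proof -
    have "A = E \<inter> closure A" using step AE ER closure_subset by blast
    then show ?thesis by (metis closed_closure closedin_closed_Int)
  qed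
  moreover have "openin (top_of_set E) A"
    using tubeD(1)[OF tubeA] AE ER by (meson Diff_subset openin_subset_trans subset_trans)
  moreover have "A \<noteq> {}" using N0 by (auto simp: A_def)
  ultimately have "A = E" using connE connected_clopen by blast
  then show ?thesis using tubeA by simp
qed

lemma arc_sub: "E \<in> arcs \<Longrightarrow> E \<subseteq> R" "E \<in> arcs \<Longrightarrow> E \<subseteq> D" "E \<in> arcs \<Longrightarrow> E \<noteq> {}"
  using in_components_subset in_components_nonempty by blast+

lemma arc_contains:
  assumes "E \<in> arcs" "connected N" "N \<subseteq> R" "N \<inter> E \<noteq> {}"
  shows "N \<subseteq> E"
  using components_maximal assms by blast

definition lo :: "plane set \<Rightarrow> real" where "lo E = Inf (fst ` E)"
definition hi :: "plane set \<Rightarrow> real" where "hi E = Sup (fst ` E)"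

lemma bounded_fst: "E \<subseteq> D \<Longrightarrow> bounded (fst ` E)"
  using compact compact_imp_bounded bounded_subset bounded_fst by metis

lemma fst_arc: "E \<in> arcs \<Longrightarrow> fst ` E = {lo E<..<hi E}"
  unfolding lo_def hi_def
  by (intro open_connected_bounded_real tubeD[OF arc_tube] bounded_fst arc_sub) (use arc_sub(3) in blast)+

lemma lo_less_hi: "E \<in> arcs \<Longrightarrow> lo E < hi E"
  using fst_arc arc_sub(3) by (metis greaterThanLessThan_empty_iff image_is_empty not_le)

lemma closure_arc_sub: "E \<in> arcs \<Longrightarrow> closure E \<subseteq> D"
  using arc_sub(2) compact compact_imp_closed closure_minimal by metis

lemma fst_closure_arc: "E \<in> arcs \<Longrightarrow> fst ` closure E = {lo E..hi E}"
proof -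
  assume E: "E \<in> arcs"
  have "compact (closure E)" using compact_closure bounded_subset[OF compact_imp_bounded[OF compact] arc_sub(2)[OF E]] by blast
  then have "closure (fst ` E) = fst ` closure E"
  proof (intro subset_antisym closure_minimal)
    show "fst ` E \<subseteq> fst ` closure E" using closure_subset by blast
    show "closed (fst ` closure E)"
      using \<open>compact (closure E)\<close> by (intro compact_imp_closed compact_continuous_image continuous_on_fst continuous_on_id)
    show "fst ` closure E \<subseteq> closure (fst ` E)"
      by (rule closure_bounded_linear_image_subset[OF bounded_linear_fst])
  qed
  then show ?thesis using fst_arc[OF E] lo_less_hi[OF E] by simp
qed

text \<open>A limit point in \<open>R\<close> has a tube that meets \<open>E\<close> and so lies in
  it. A limit point over an abscissa strictly inside is compared with the slice of \<open>E\<close>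
  there: that slice is compact, and the slices over nearby abscissae stay close to it.\<close>

lemma closure_arc:
  assumes E: "E \<in> arcs" and z: "z \<in> closure E"
  shows "z \<in> E \<or> (z \<in> \<Union>V \<and> (fst z = lo E \<or> fst z = hi E))"
proof (rule disjCI)
  note T = tubeD[OF arc_tube[OF E]]
  assume "\<not> (z \<in> \<Union>V \<and> (fst z = lo E \<or> fst z = hi E))"
  moreover have zD: "z \<in> D" using z closure_arc_sub[OF E] by blast
  moreover have "lo E \<le> fst z" "fst z \<le> hi E" using fst_closure_arc[OF E] z by auto
  ultimately consider "z \<in> R" | "fst z \<in> {lo E<..<hi E}" by force
  then show "z \<in> E"
  proof cases
    case 1
    obtain N where N: "is_tube D R N" "z \<in> N" using tube[of z UNIV] 1 by auto
    obtain U where U: "open U" "N = D \<inter> U" using tubeD(1)[OF N(1)] unfolding openin_open by blast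
    have "U \<inter> E \<noteq> {}" using z N U open_Int_closure_eq_empty[OF U(1), of E] by blast
    then have "N \<inter> E \<noteq> {}" using U T(3) by blast
    then show ?thesis using arc_contains[OF E tubeD(4,2)[OF N(1)]] N by blast
  next
    case 2
    then obtain q where q: "q \<in> E" "fst q = fst z" using fst_arc[OF E] by (metis imageE)
    show ?thesis
    proof (rule ccontr)
      assume "z \<notin> E"
      then have "cls q \<inter> {z} = {}" using T(7)[OF q(1)] by blast
      then obtain U U' where U: "open U" "open U'" "cls q \<subseteq> U" "z \<in> U'" "U \<inter> U' = {}"
        using separation_normal_compact[OF compact_reeb_class[OF compact] closed_singleton] by (metis insert_subset)
      obtain M where M: "is_tube D R M" "q \<in> M" "M \<subseteq> E" "M \<subseteq> U"
        using small_tube[OF T(1) _ T(7)[OF q(1)] U(1,3)] q T(2) by blast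
      have "open (U' \<inter> fst -` (fst ` M))" using tubeD(5)[OF M(1)] U(2) by (intro open_Int open_vimage_fst)
      moreover have "z \<in> U' \<inter> fst -` (fst ` M)" using U q M(2) by (metis IntI image_eqI vimageI2)
      ultimately have "U' \<inter> fst -` (fst ` M) \<inter> E \<noteq> {}" using z open_Int_closure_eq_empty by blast
      then obtain y m where y: "y \<in> U'" "y \<in> E" "m \<in> M" "fst y = fst m" by auto
      then have "y \<in> cls m" using T(8)[of m y] M by blast
      then have "y \<in> U" using tubeD(7)[OF M(1) y(3)] M by blast
      then show False using U y by blast
    qed
  qed
qed

lemma arc_V_disjoint: "E \<in> arcs \<Longrightarrow> v \<in> V \<Longrightarrow> E \<inter> v = {}"
  using arc_sub(1) by blast

definition ends :: "plane set \<Rightarrow> plane set set" where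
  "ends E = {u \<in> V. u \<inter> closure E \<noteq> {}}"

lemma closure_arc_ends: "E \<in> arcs \<Longrightarrow> closure E \<subseteq> E \<union> \<Union>(ends E)"
  using closure_arc unfolding ends_def by blast

text \<open>The closure of \<open>E\<close> has points over both bounds of its open interval of
  abscissae. They lie in vertices, and \<open>V_fst\<close> leaves only one vertex on each of these
  two vertical lines.\<close>

lemma arc_ends:
  assumes E: "E \<in> arcs"
  obtains u v where "u \<in> V" "v \<in> V" "ends E = {u, v}" "u \<noteq> v"
    "\<exists>p\<in>u \<inter> closure E. fst p = lo E" "\<exists>p\<in>v \<inter> closure E. fst p = hi E"
proof -
  have "lo E \<in> fst ` closure E" "hi E \<in> fst ` closure E" using fst_closure_arc[OF E] lo_less_hi[OF E] by auto
  then obtain p q where pq: "p \<in> closure E" "fst p = lo E" "q \<in> closure E" "fst q = hi E" by force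
  have "p \<notin> E" "q \<notin> E" using pq fst_arc[OF E] by (metis greaterThanLessThan_iff image_eqI less_irrefl)+
  then obtain u v where uv: "u \<in> V" "p \<in> u" "v \<in> V" "q \<in> v" using closure_arc[OF E] pq by blast
  have "u \<noteq> v" using V_fst_const[OF uv(1,2), of q] uv pq lo_less_hi[OF E] by auto
  moreover have "ends E = {u, v}"
  proof
    show "{u, v} \<subseteq> ends E" using uv pq by (auto simp: ends_def)
    show "ends E \<subseteq> {u, v}"
    proof
      fix w assume "w \<in> ends E"
      then obtain z where z: "w \<in> V" "z \<in> w" "z \<in> closure E" by (auto simp: ends_def)
      then have "z \<notin> E" using arc_V_disjoint[OF E] by blast
      then have "fst z = fst p \<or> fst z = fst q" using closure_arc[OF E z(3)] pq by simp
      then show "w \<in> {u, v}" using V_fst z uv by blast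
    qed
  qed
  ultimately show thesis using that uv pq by blast
qed

lemma ends_V: "ends E \<subseteq> V" by (auto simp: ends_def)

lemma disjoint_arcs: "E \<in> arcs \<Longrightarrow> E' \<in> arcs \<Longrightarrow> E \<inter> E' \<noteq> {} \<Longrightarrow> E = E'"
  using components_eq by blast

text \<open>Each germ lies in one arc, and each arc ending in \<open>u\<close> meets
  \<open>W\<close> and hence contains a germ. Two germs in the same arc coincide: if they share an
  abscissa, they share a slice of the tube; if they lie on opposite sides of \<open>u\<close>, the
  arc would pass over the abscissa of \<open>u\<close>, and \<open>closure_arc\<close> would put a
  point of \<open>u\<close> into the arc. The last clause of \<open>is_star\<close> provides this
  dichotomy.\<close>

lemma card_arcs_at:
  assumes u: "u \<in> V" and st: "is_star D R u \<N>"
  shows "finite {E \<in> arcs. u \<in> ends E}" "card {E \<in> arcs. u \<in> ends E} = card \<N>"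
proof -
  obtain W where W: "open W" "u \<subseteq> W" "\<Union>\<N> = D \<inter> W - u" using is_starD(4)[OF st] by metis
  note fin = is_starD(1)[OF st] and disj = is_starD(2)[OF st] and NR = is_starD(3)[OF st]
  note N = is_starD(6-9)[OF st]
  note pair = is_starD(5)[OF st]
  have "\<exists>E\<in>arcs. N \<subseteq> E" if "N \<in> \<N>" for N
  proof -
    have "N \<subseteq> R" using that NR by blast
    moreover from this have "R \<noteq> {}" using N(2)[OF that] by blast
    ultimately show ?thesis using exists_component_superset[OF _ _ N(1)[OF that]] by metis
  qed
  then obtain \<phi> where \<phi>: "\<And>N. N \<in> \<N> \<Longrightarrow> \<phi> N \<in> arcs" "\<And>N. N \<in> \<N> \<Longrightarrow> N \<subseteq> \<phi> N" by metis
  have inj: "inj_on \<phi> \<N>"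
  proof (rule inj_onI)
    fix N N' assume NN: "N \<in> \<N>" "N' \<in> \<N>" "\<phi> N = \<phi> N'"
    let ?E = "\<phi> N"
    have E: "?E \<in> arcs" "N \<subseteq> ?E" "N' \<subseteq> ?E" using \<phi> NN by auto
    note T = tubeD[OF arc_tube[OF E(1)]]
    have no: False if ab: "a \<in> ?E" "b \<in> ?E" and q: "\<forall>q\<in>u. fst a < fst q \<and> fst q < fst b" for a b
    proof -
      obtain q where q': "q \<in> closure N" "q \<in> u" using N(3)[OF NN(1)] by blast
      then have "q \<in> closure ?E" using closure_mono[OF E(2)] by blast
      moreover have "fst a \<in> fst ` ?E" "fst b \<in> fst ` ?E" using ab by auto
      then have "fst q \<noteq> lo ?E" "fst q \<noteq> hi ?E" using q q' fst_arc[OF E(1)] by auto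
      ultimately have "q \<in> ?E" using closure_arc[OF E(1)] by blast
      then show False using arc_V_disjoint[OF E(1) u] q' by blast
    qed
    from pair[OF NN(1,2)] consider p p' where "p \<in> N" "p' \<in> N'" "fst p = fst p'"
      | p p' where "p \<in> N" "p' \<in> N'" "\<forall>q\<in>u. fst p < fst q \<and> fst q < fst p'"
      | p p' where "p \<in> N" "p' \<in> N'" "\<forall>q\<in>u. fst p' < fst q \<and> fst q < fst p" by blast
    then show "N = N'"
    proof cases
      case 1
      then have "p' \<in> cls p" using T(8)[of p p'] E by auto
      then have "p' \<in> N" using N(4)[OF NN(1)] 1 by blast
      then show ?thesis using disj NN 1 unfolding disjoint_def by blast
    next
      case 2 then show ?thesis using no[of p p'] E by blast
    next
      case 3 then show ?thesis using no[of p' p] E by blast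
    qed
  qed
  have im: "\<phi> ` \<N> = {E \<in> arcs. u \<in> ends E}"
  proof
    show "\<phi> ` \<N> \<subseteq> {E \<in> arcs. u \<in> ends E}"
    proof clarify
      fix N assume n: "N \<in> \<N>"
      have "closure N \<subseteq> closure (\<phi> N)" using closure_mono \<phi>(2)[OF n] by blast
      then show "\<phi> N \<in> arcs \<and> u \<in> ends (\<phi> N)" using \<phi>(1)[OF n] N(3)[OF n] u by (auto simp: ends_def)
    qed
    show "{E \<in> arcs. u \<in> ends E} \<subseteq> \<phi> ` \<N>"
    proof clarify
      fix E assume E: "E \<in> arcs" "u \<in> ends E"
      then have "W \<inter> E \<noteq> {}" using W open_Int_closure_eq_empty[OF W(1), of E] by (auto simp: ends_def)
      then obtain z where "z \<in> W" "z \<in> E" by blast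
      then have "z \<in> \<Union>\<N>" using W(3) arc_V_disjoint[OF E(1) u] arc_sub(2)[OF E(1)] by blast
      then obtain N where n: "N \<in> \<N>" "z \<in> N" by blast
      then have "\<phi> N = E" using disjoint_arcs[OF \<phi>(1)[OF n(1)] E(1)] \<phi>(2)[OF n(1)] \<open>z \<in> E\<close> by blast
      then show "E \<in> \<phi> ` \<N>" using n by blast
    qed
  qed
  show "finite {E \<in> arcs. u \<in> ends E}" using im fin by (metis finite_imageI)
  show "card {E \<in> arcs. u \<in> ends E} = card \<N>" using card_image[OF inj] im by simp
qed

lemma finite_arcs: "finite arcs"
proof -
  have "arcs \<subseteq> (\<Union>u\<in>V. {E \<in> arcs. u \<in> ends E})"
  proof
    fix E assume E: "E \<in> arcs"
    obtain u v where "u \<in> V" "ends E = {u, v}" using arc_ends[OF E] by metis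
    then show "E \<in> (\<Union>u\<in>V. {E \<in> arcs. u \<in> ends E})" using E by blast
  qed
  moreover have "finite {E \<in> arcs. u \<in> ends E}" if "u \<in> V" for u using card_arcs_at(1)[OF that] star[OF that] by blast
  ultimately show ?thesis using finite_V finite_subset by (metis (no_types, lifting) finite_UN)
qed

section \<open>The graph of arcs: connectedness and bridges\<close>

definition arc_adj :: "plane set set \<Rightarrow> plane set rel" where
  "arc_adj \<E> = {(u, v). \<exists>E\<in>\<E>. ends E = {u, v}}"

lemma sym_arc_adj: "sym (arc_adj \<E>)"
  by (auto simp: sym_def arc_adj_def insert_commute)

lemma arc_adj_V: "arc_adj \<E> \<subseteq> V \<times> V"
  using ends_V unfolding arc_adj_def by blast

text \<open>The two ends of an arc are both reachable from the root or both not. Reachable vertices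
  with their arcs, and the other vertices with theirs, are thus two disjoint closed sets covering
  the connected set \<open>D\<close>.\<close>

lemma arc_graph_connected:
  assumes "v \<in> V" shows "(rt, v) \<in> (arc_adj arcs)\<^sup>*"
proof -
  define U where "U = (arc_adj arcs)\<^sup>* `` {rt}"
  have UV: "U \<subseteq> V"
  proof
    fix w assume "w \<in> U"
    then have "(rt, w) \<in> (arc_adj arcs)\<^sup>*" by (auto simp: U_def)
    then show "w \<in> V" using root arc_adj_V by (cases rule: rtranclE) auto
  qed
  have both: "ends E \<inter> U = {} \<or> ends E \<subseteq> U" if E: "E \<in> arcs" for E
  proof -
    obtain a b where ab: "ends E = {a, b}" using arc_ends[OF E] by metis
    then have "(a, b) \<in> arc_adj arcs" "(b, a) \<in> arc_adj arcs" using E by (auto simp: arc_adj_def)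
    then have "a \<in> U \<longleftrightarrow> b \<in> U" unfolding U_def by (auto intro: rtrancl_into_rtrancl)
    then show ?thesis using ab by auto
  qed
  define P where "P X = \<Union>X \<union> \<Union>(closure ` {E \<in> arcs. ends E \<subseteq> X})" for X
  have closedP: "closed (P X)" if "X \<subseteq> V" for X
    unfolding P_def using that finite_V finite_arcs finite_subset compact_imp_closed[OF compact_V]
    by (intro closed_Un closed_Union) auto
  have PD: "P X \<subseteq> D" if "X \<subseteq> V" for X
    using that V_sub closure_arc_sub unfolding P_def by blast
  have cov: "D \<subseteq> P U \<union> P (V - U)"
  proof
    fix z assume z: "z \<in> D"
    show "z \<in> P U \<union> P (V - U)"
    proof (cases "z \<in> \<Union>V")
      case True then show ?thesis by (auto simp: P_def)
    next
      case False
      then obtain E where E: "E \<in> arcs" "z \<in> E" using z Union_components[of R] by blast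
      then have "z \<in> closure E" using closure_subset by blast
      moreover have "ends E \<subseteq> U \<or> ends E \<subseteq> V - U" using both[OF E(1)] ends_V by blast
      ultimately show ?thesis using E by (auto simp: P_def)
    qed
  qed
  have disj: "P U \<inter> P (V - U) = {}"
  proof -
    have sub: "P X \<subseteq> \<Union>X \<union> \<Union>{E \<in> arcs. ends E \<subseteq> X}" for X
      unfolding P_def using closure_arc_ends by blast
    have 1: "\<Union>U \<inter> \<Union>(V - U) = {}" using V_disjoint UV by blast
    have 2: "\<Union>X \<inter> \<Union>{E \<in> arcs. ends E \<subseteq> Y} = {}" if "X \<subseteq> V" for X Y
      using arc_V_disjoint that by blast
    have 3: "\<Union>{E \<in> arcs. ends E \<subseteq> U} \<inter> \<Union>{E \<in> arcs. ends E \<subseteq> V - U} = {}"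
    proof -
      have "\<not> (ends E \<subseteq> U \<and> ends E \<subseteq> V - U)" if "E \<in> arcs" for E
        using arc_ends[OF that] by (metis Diff_iff insert_subset)
      then show ?thesis using disjoint_arcs by blast
    qed
    have "(\<Union>U \<union> \<Union>{E \<in> arcs. ends E \<subseteq> U}) \<inter> (\<Union>(V - U) \<union> \<Union>{E \<in> arcs. ends E \<subseteq> V - U}) = {}"
      using 1 2[OF UV, of "V - U"] 2[of "V - U" U] 3
      by (simp add: Int_Un_distrib Int_Un_distrib2 Int_commute del: Union_iff)
    then show ?thesis using sub[of U] sub[of "V - U"] by (metis (no_types, lifting) Int_mono subset_empty)
  qed
  have "rt \<in> U" by (auto simp: U_def)
  then have "P U \<inter> D \<noteq> {}" using V_nonempty[OF root] V_sub root unfolding P_def by blast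
  then have "P (V - U) \<inter> D = {}"
    using connected[unfolded connected_closed, rule_format] closedP[OF UV] closedP[of "V - U"] cov disj by blast
  then have "V - U = {}" using V_nonempty V_sub unfolding P_def by blast
  then show ?thesis using assms unfolding U_def by blast
qed

text \<open>On an arc \<open>fst\<close> is an open map with connected fibres, the classes, so
  preimages of connected sets are connected.\<close>

lemma connected_arc_part:
  assumes E: "E \<in> arcs" and J: "connected J" "J \<subseteq> {lo E<..<hi E}"
  shows "connected (E \<inter> fst -` J)"
proof (rule connected_open_monotone_preimage[OF _ _ _ _ J(1)])
  note T = tubeD[OF arc_tube[OF E]]
  show "continuous_on E fst" by (intro continuous_on_fst continuous_on_id)
  show "fst ` E = {lo E<..<hi E}" by (rule fst_arc[OF E])
  show "J \<subseteq> {lo E<..<hi E}" by fact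
  show "openin (top_of_set {lo E<..<hi E}) (fst ` C)" if "openin (top_of_set E) C" for C
  proof (rule open_subset)
    have "openin (top_of_set D) C" using that T(1) openin_trans by blast
    moreover have "C \<subseteq> E" using openin_imp_subset that by blast
    ultimately show "open (fst ` C)" using T(2) by (intro open_fst) auto
    show "fst ` C \<subseteq> {lo E<..<hi E}" using fst_arc[OF E] \<open>C \<subseteq> E\<close> by blast
  qed
  show "connected (E \<inter> fst -` {y})" if y: "y \<in> {lo E<..<hi E}" for y
  proof -
    obtain q where q: "q \<in> E" "fst q = y" using y fst_arc[OF E] by (metis imageE)
    have "E \<inter> fst -` {fst q} = cls q" using arc_tube[OF E] q(1) unfolding is_tube_def by simp
    then have "E \<inter> fst -` {y} = cls q" by (simp only: q(2))
    then show ?thesis by simp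
  qed
qed

text \<open>Cutting \<open>D\<close> along the part of \<open>E\<close> between two slices disconnects it, by unicoherence.\<close>

lemma arc_bridge:
  assumes E: "E \<in> arcs" and uv: "ends E = {u, v}"
  shows "(u, v) \<notin> (arc_adj (arcs - {E}))\<^sup>*"
proof
  assume path: "(u, v) \<in> (arc_adj (arcs - {E}))\<^sup>*"
  note T = tubeD[OF arc_tube[OF E]]
  obtain s t where st: "lo E < s" "s < t" "t < hi E" using lo_less_hi[OF E] dense by meson
  \<comment> \<open>\<open>X\<close> omits the open middle part of \<open>E\<close> and
    \<open>Y\<close> is the closed middle part, so they share exactly the slices over
    \<open>s\<close> and \<open>t\<close>. The assumed path keeps \<open>X\<close> connected;
    unicoherence would then make the union of these two slices connected.\<close>
  define X where "X = D - (E \<inter> fst -` {s<..<t})"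
  define Y where "Y = E \<inter> fst -` {s..t}"
  have "closedin (top_of_set D) X"
  proof -
    obtain U where "open U" "E = D \<inter> U" using T(1) unfolding openin_open by blast
    then have "X = D \<inter> - (U \<inter> fst -` {s<..<t})" by (auto simp: X_def)
    moreover have "closed (- (U \<inter> fst -` {s<..<t}))" using \<open>open U\<close>
      by (simp only: closed_Compl open_Int open_vimage_fst open_greaterThanLessThan)
    ultimately show ?thesis by (metis closedin_closed_Int)
  qed
  moreover have "closedin (top_of_set D) Y"
  proof -
    have "closure E \<inter> fst -` {s..t} = Y" unfolding Y_def using closure_arc[OF E] closure_subset st by fastforce
    moreover have "closed (closure E \<inter> fst -` {s..t})" by (intro closed_Int closed_closure closed_vimage_fst closed_atLeastAtMost)
    ultimately show ?thesis using T(3) by (metis Int_lower1 Y_def closed_subset subset_trans)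
  qed
  moreover have "connected Y" unfolding Y_def using st by (intro connected_arc_part[OF E]) auto
  moreover have "D = X \<union> Y" using T(3) by (auto simp: X_def Y_def)
  moreover have "connected X"
  proof -
    have VX: "w \<subseteq> X" if "w \<in> V" for w using that V_sub arc_V_disjoint[OF E that] by (auto simp: X_def)
    \<comment> \<open>\<open>S w z\<close> says that the classes \<open>w\<close> and
      \<open>z\<close> lie in one component of \<open>X\<close>. The path around \<open>E\<close>
      gives \<open>S u v\<close>, which replaces \<open>E\<close> in every walk from the
      root.\<close>
    define S where "S w z \<longleftrightarrow> (\<forall>p\<in>w. \<forall>q\<in>z. connected_component X p q)" for w z
    have S_refl: "S w w" if "w \<in> V" for w
      unfolding S_def connected_component_def using V_connected[OF that] VX[OF that] by blast
    have S_trans: "S w y" if "S w z" "S z y" "z \<in> V" for w z y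
      using that V_nonempty[OF that(3)] unfolding S_def by (meson connected_component_trans ex_in_conv)
    have S_sym: "S w z \<Longrightarrow> S z w" for w z unfolding S_def using connected_component_sym by blast
    have clX: "closure E' \<subseteq> X" if "E' \<in> arcs" "E' \<noteq> E" for E'
    proof -
      have "E' \<inter> E = {}" using disjoint_arcs[OF that(1) E] that(2) by blast
      then have "E' \<subseteq> X" using arc_sub(2)[OF that(1)] by (auto simp: X_def)
      moreover have "\<Union>(ends E') \<subseteq> X" using VX ends_V by blast
      ultimately show ?thesis using closure_arc_ends[OF that(1)] by blast
    qed
    have link: "connected_component X p q" if "connected C" "C \<subseteq> X" "p \<in> C" "w \<in> V" "w \<inter> C \<noteq> {}" "q \<in> w" for p q C w
    proof -
      have "connected (C \<union> w)" using that V_connected connected_Un by (metis Int_commute)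
      then show ?thesis unfolding connected_component_def using that VX by (intro exI[of _ "C \<union> w"]) auto
    qed
    have S_adj: "S w z" if wz: "(w, z) \<in> arc_adj (arcs - {E})" for w z
    proof -
      obtain E' where E': "E' \<in> arcs" "E' \<noteq> E" "ends E' = {w, z}" using wz by (auto simp: arc_adj_def)
      have conn: "connected (closure E')" using in_components_connected[OF E'(1)] by (rule connected_imp_connected_closure)
      have w: "w \<in> V" "w \<inter> closure E' \<noteq> {}" "z \<in> V" "z \<inter> closure E' \<noteq> {}" using E'(3) unfolding ends_def by blast+
      then obtain c where c: "c \<in> closure E'" by blast
      have "connected_component X c p" if "p \<in> w \<union> z" for p
        using link[OF conn clX[OF E'(1,2)] c] w that by blast
      then show ?thesis unfolding S_def by (meson UnI1 UnI2 connected_component_sym connected_component_trans)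
    qed
    have S_path: "w \<in> V \<Longrightarrow> S w z" if "(w, z) \<in> (arc_adj (arcs - {E}))\<^sup>*" for w z
      using that
    proof (induction rule: rtrancl_induct)
      case (step y z)
      then have "y \<in> V" using arc_adj_V by blast
      then show ?case using step S_adj S_trans by blast
    qed (rule S_refl)
    have uvV: "u \<in> V" "v \<in> V" using uv ends_V by blast+
    have Suv: "S u v" using S_path[OF path] uvV by blast
    have S_all: "S rt w" if "(rt, w) \<in> (arc_adj arcs)\<^sup>*" for w
      using that
    proof (induction rule: rtrancl_induct)
      case (step y z)
      have yV: "y \<in> V" "z \<in> V" using step(2) arc_adj_V by blast+
      obtain E' where E': "E' \<in> arcs" "ends E' = {y, z}" using step(2) by (auto simp: arc_adj_def)
      have "S y z"
      proof (cases "E' = E")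
        case True
        then have "{y, z} = {u, v}" using E' uv by simp
        then show ?thesis using Suv S_sym by (metis doubleton_eq_iff)
      next
        case False
        then show ?thesis using E' by (intro S_adj) (auto simp: arc_adj_def)
      qed
      then show ?case using step.IH S_trans yV by blast
    qed (rule S_refl[OF root])
    have toV: "\<exists>w\<in>V. \<exists>q\<in>w. connected_component X p q" if p: "p \<in> X" for p
    proof (cases "p \<in> \<Union>V")
      case True
      then show ?thesis using p connected_component_refl by blast
    next
      case False
      then obtain E' where E': "E' \<in> arcs" "p \<in> E'" using p Union_components[of R] unfolding X_def by blast
      obtain a b where ab: "a \<in> V" "b \<in> V" "\<exists>p\<in>a \<inter> closure E'. fst p = lo E'" "\<exists>p\<in>b \<inter> closure E'. fst p = hi E'"
        using arc_ends[OF E'(1)] by metis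
      show ?thesis
      proof (cases "E' = E")
        case False
        have "connected (closure E')" using in_components_connected[OF E'(1)] by (rule connected_imp_connected_closure)
        moreover have "p \<in> closure E'" using E' closure_subset by blast
        moreover obtain q where "q \<in> a" "q \<in> closure E'" using ab by blast
        ultimately show ?thesis using link[OF _ clX[OF E'(1) False], of p a q] ab by blast
      next
        case True
        \<comment> \<open>For a point in one of the two remaining parts of \<open>E\<close>: the
          closure of that part stays in \<open>X\<close> and reaches the vertex at the outer end,
          because near the abscissa of this end, namely over \<open>J'\<close>, it contains all of
          \<open>E\<close>.\<close>
        have half: ?thesis if J: "connected J" "J \<subseteq> {lo E<..<hi E}" "J \<inter> {s<..<t} = {}" "fst p \<in> J"
          and J': "open J'" "J' \<inter> {lo E<..<hi E} \<subseteq> J"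
          and w: "w \<in> V" "q \<in> w" "q \<in> closure E" "fst q \<in> J'" for J J' w q
        proof -
          let ?H = "E \<inter> fst -` J"
          have "connected (closure ?H)" using connected_arc_part[OF E J(1,2)] by (rule connected_imp_connected_closure)
          moreover have "closure ?H \<subseteq> X"
          proof -
            have "fst z \<notin> {s<..<t}" if "z \<in> closure ?H" for z
            proof
              assume "fst z \<in> {s<..<t}"
              moreover have "open (fst -` {s<..<t} :: plane set)" by (intro open_vimage_fst open_greaterThanLessThan)
              ultimately have "fst -` {s<..<t} \<inter> ?H \<noteq> {}"
                using that open_Int_closure_eq_empty[of "fst -` {s<..<t}" ?H] by blast
              then show False using J(3) by blast
            qed
            moreover have "closure ?H \<subseteq> D" using closure_mono[of ?H E] closure_arc_sub[OF E] by blast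
            ultimately show ?thesis by (auto simp: X_def)
          qed
          moreover have "q \<in> closure ?H"
          proof -
            have "open (fst -` J' :: plane set)" using J'(1) by (rule open_vimage_fst)
            then have "fst -` J' \<inter> closure E \<subseteq> closure (fst -` J' \<inter> E)" by (rule open_Int_closure_subset)
            moreover have "fst -` J' \<inter> E \<subseteq> ?H" using J'(2) fst_arc[OF E] by blast
            ultimately show ?thesis using w closure_mono[of "fst -` J' \<inter> E" ?H] by blast
          qed
          moreover have "p \<in> ?H" using J(4) E'(2) True by simp
          then have "p \<in> closure ?H" by (rule closure_subset[THEN subsetD])
          ultimately have "connected_component X p q" using link[of "closure ?H" p w q] w by blast
          then show ?thesis using w by blast
        qed
        have fp: "fst p \<in> {lo E<..<hi E}" unfolding fst_arc[OF E, symmetric] using E' True by simp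
        have "fst p \<le> s \<or> t \<le> fst p" using p E' True by (auto simp: X_def)
        then show ?thesis
        proof
          assume "fst p \<le> s"
          moreover obtain q where "q \<in> a" "q \<in> closure E" "fst q = lo E" using ab True by blast
          ultimately show ?thesis using ab(1) st fp by (intro half[of "{lo E<..s}" "{..<s}" a q]) auto
        next
          assume "t \<le> fst p"
          moreover obtain q where "q \<in> b" "q \<in> closure E" "fst q = hi E" using ab True by blast
          ultimately show ?thesis using ab(2) st fp by (intro half[of "{t..<hi E}" "{t<..}" b q]) auto
        qed
      qed
    qed
    show ?thesis
      unfolding connected_iff_connected_component
    proof (intro ballI)
      fix p q assume "p \<in> X" "q \<in> X"
      then obtain w z p' q' where w: "w \<in> V" "p' \<in> w" "connected_component X p p'" "z \<in> V" "q' \<in> z" "connected_component X q q'"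
        using toV by metis
      have "S w z" using S_all arc_graph_connected S_trans S_sym root w by metis
      then have "connected_component X p' q'" using w by (auto simp: S_def)
      then show "connected_component X p q" using w connected_component_trans connected_component_sym by metis
    qed
  qed
  ultimately have conn: "connected (X \<inter> Y)" using unicoherentD[OF unicoherent] by blast
  have "X \<inter> Y = E \<inter> fst -` {s, t}" using T(3) st by (auto simp: X_def Y_def)
  moreover have "s \<in> fst ` E" "t \<in> fst ` E" unfolding fst_arc[OF E] using st by auto
  ultimately have "fst ` (X \<inter> Y) = {s, t}" by force
  moreover have "connected (fst ` (X \<inter> Y))" by (intro connected_continuous_image continuous_on_fst continuous_on_id conn)
  ultimately show False using st connected_finite_iff_sing[of "{s, t}"] by auto
qed

section \<open>Arcs as open edges of the quotient space\<close>

abbreviation "Q \<equiv> reeb_quotient D"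
abbreviation "qarcs \<equiv> connected_components_of (subtopology Q (topspace Q - V))"

lemma topspace_Q: "topspace Q = cls ` D"
  by (simp add: reeb_quotient_def)

lemma openin_Q: "openin Q A \<longleftrightarrow> A \<subseteq> cls ` D \<and> openin (top_of_set D) {x \<in> D. cls x \<in> A}"
  by (simp add: reeb_quotient_def openin_quotient_topology)

lemma continuous_cls: "continuous_map (top_of_set D) Q cls"
  unfolding reeb_quotient_def by (rule quotient_imp_continuous_map[OF quotient_map_quotient_topology])

lemma topspace_Q_diff: "topspace Q - V = cls ` R"
proof
  show "topspace Q - V \<subseteq> cls ` R" unfolding topspace_Q using V_eq_class by fastforce
  show "cls ` R \<subseteq> topspace Q - V" unfolding topspace_Q using class_notin_V by blast
qed

lemma cls_preimage_arc:
  assumes "E \<in> arcs" shows "{x \<in> D. cls x \<in> cls ` E} = E"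
proof -
  note T = tubeD[OF arc_tube[OF assms]]
  have "x \<in> E" if "x \<in> D" "cls x = cls y" "y \<in> E" for x y
    using that T(7)[of y] reeb_class_refl[of x D] by blast
  then show ?thesis using T(3) by blast
qed

lemma openin_Q_arc: "E \<in> arcs \<Longrightarrow> openin Q (cls ` E)"
  unfolding openin_Q using cls_preimage_arc tubeD(1)[OF arc_tube] arc_sub(2) by auto

text \<open>Arcs are unions of classes and relatively open, so their images are open, connected and
  pairwise disjoint. The complement of one image is the union of the others, hence each image is
  also closed and is a full component.\<close>

lemma qarcs_eq: "qarcs = (\<lambda>E. cls ` E) ` arcs"
proof -
  let ?X = "subtopology Q (topspace Q - V)"
  have top: "topspace ?X = cls ` R" using topspace_Q_diff by auto
  have sub: "cls ` E \<subseteq> cls ` R" if "E \<in> arcs" for E using arc_sub(1)[OF that] by blast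
  have op: "openin ?X (cls ` E)" if "E \<in> arcs" for E
    using openin_Q_arc[OF that] sub[OF that] topspace_Q_diff by (simp add: openin_subset_topspace_eq openin_subtopology_Int2 subset_openin_subtopology)
  have conn: "connectedin ?X (cls ` E)" if "E \<in> arcs" for E
  proof -
    have "connectedin (top_of_set D) E"
      using in_components_connected[OF that] arc_sub(2)[OF that] by (simp add: connectedin_subtopology)
    then have "connectedin Q (cls ` E)" using connectedin_continuous_map_image continuous_cls by blast
    then show ?thesis using sub[OF that] topspace_Q_diff by (simp add: connectedin_subtopology)
  qed
  have disj: "E = E'" if "E \<in> arcs" "E' \<in> arcs" and meet: "cls ` E \<inter> cls ` E' \<noteq> {}" for E E'
  proof -
    obtain x y where "x \<in> E" "y \<in> E'" "cls x = cls y" using meet by blast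
    then have "x \<in> E'" using cls_preimage_arc[OF that(2)] arc_sub(2)[OF that(1)] by blast
    then show ?thesis using disjoint_arcs that \<open>x \<in> E\<close> by blast
  qed
  have cl: "closedin ?X (cls ` E)" if "E \<in> arcs" for E
  proof -
    have "topspace ?X - cls ` E = \<Union>((\<lambda>E. cls ` E) ` (arcs - {E}))"
    proof
      show "topspace ?X - cls ` E \<subseteq> \<Union>((\<lambda>E. cls ` E) ` (arcs - {E}))"
      proof
        fix w assume "w \<in> topspace ?X - cls ` E"
        then obtain p where p: "p \<in> R" "w = cls p" "w \<notin> cls ` E" unfolding top by blast
        then obtain E' where "E' \<in> arcs" "p \<in> E'" using Union_components[of R] by blast
        then show "w \<in> \<Union>((\<lambda>E. cls ` E) ` (arcs - {E}))" using p(2,3) by blast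
      qed
      show "\<Union>((\<lambda>E. cls ` E) ` (arcs - {E})) \<subseteq> topspace ?X - cls ` E"
      proof
        fix w assume "w \<in> \<Union>((\<lambda>E. cls ` E) ` (arcs - {E}))"
        then obtain E' where E': "E' \<in> arcs" "E' \<noteq> E" "w \<in> cls ` E'" by blast
        then have "w \<notin> cls ` E" using disj[OF E'(1) that] by blast
        then show "w \<in> topspace ?X - cls ` E" unfolding top using sub[OF E'(1)] E'(3) by blast
      qed
    qed
    moreover have "openin ?X (\<Union>((\<lambda>E. cls ` E) ` (arcs - {E})))" using op by (intro openin_Union) auto
    ultimately show ?thesis using sub[OF that] unfolding closedin_def top by simp
  qed
  have comp: "connected_component_of_set ?X x = cls ` E" if "E \<in> arcs" "x \<in> cls ` E" for x E
  proof
    show "cls ` E \<subseteq> connected_component_of_set ?X x" by (rule connected_component_of_maximal[OF conn[OF that(1)] that(2)])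
    have "x \<in> connected_component_of_set ?X x" using that sub top connected_component_of_refl[of ?X x] by blast
    then show "connected_component_of_set ?X x \<subseteq> cls ` E"
      using connectedin_clopen_cases[OF connectedin_connected_component_of cl[OF that(1)] op[OF that(1)]] that
      unfolding disjnt_def by blast
  qed
  show ?thesis
  proof
    show "qarcs \<subseteq> (\<lambda>E. cls ` E) ` arcs"
    proof
      fix C assume "C \<in> qarcs"
      then obtain x where x: "x \<in> cls ` R" "C = connected_component_of_set ?X x"
        unfolding connected_components_of_def top by blast
      then obtain p where "p \<in> R" "x = cls p" by blast
      then obtain E where "E \<in> arcs" "p \<in> E" using Union_components[of R] by blast
      then show "C \<in> (\<lambda>E. cls ` E) ` arcs" using comp[of E x] x \<open>x = cls p\<close> by blast
    qed
    show "(\<lambda>E. cls ` E) ` arcs \<subseteq> qarcs"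
    proof clarify
      fix E assume E: "E \<in> arcs"
      then obtain p where p: "p \<in> E" using arc_sub(3) by blast
      then have "cls ` E = connected_component_of_set ?X (cls p)" using comp[OF E] by blast
      moreover have "cls p \<in> topspace ?X" unfolding top using p arc_sub(1)[OF E] by blast
      ultimately show "cls ` E \<in> qarcs" unfolding connected_components_of_def by blast
    qed
  qed
qed

text \<open>An arc with its ends is a closed union of classes, which bounds the closure in
  \<open>Q\<close> from above. Conversely, an open set around an end pulls back to a relatively open
  set around a point of \<open>closure E\<close>, so it meets \<open>E\<close>.\<close>

lemma closure_of_arc:
  assumes E: "E \<in> arcs"
  shows "V \<inter> Q closure_of (cls ` E) = ends E"
proof
  let ?K = "E \<union> \<Union>(ends E)"
  have "cls x \<in> cls ` E \<union> ends E \<longleftrightarrow> x \<in> ?K" if x: "x \<in> D" for x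
  proof -
    have "cls x \<in> cls ` E \<longleftrightarrow> x \<in> E" using cls_preimage_arc[OF E] x by blast
    moreover have "cls x \<in> ends E \<longleftrightarrow> x \<in> \<Union>(ends E)"
    proof
      assume "cls x \<in> ends E" then show "x \<in> \<Union>(ends E)" using x reeb_class_refl[of x D] by blast
    next
      assume "x \<in> \<Union>(ends E)"
      then obtain w where "w \<in> ends E" "x \<in> w" by blast
      moreover from this have "w = cls x" using ends_V V_eq_class by blast
      ultimately show "cls x \<in> ends E" by simp
    qed
    ultimately show ?thesis by blast
  qed
  then have pre: "{x \<in> D. cls x \<in> topspace Q - (cls ` E \<union> ends E)} = D - ?K"
    unfolding topspace_Q by blast
  have "?K = closure E \<union> \<Union>(ends E)" using closure_arc_ends[OF E] closure_subset by blast
  moreover have "finite (ends E)" using ends_V finite_V finite_subset by blast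
  moreover have "\<forall>T\<in>ends E. closed T" using ends_V compact_imp_closed[OF compact_V] by blast
  ultimately have "closed ?K" by (simp add: closed_Un closed_Union)
  then have "openin (top_of_set D) (D - ?K)" unfolding Diff_eq by (intro openin_open_Int open_Compl)
  then have "openin Q (topspace Q - (cls ` E \<union> ends E))"
    unfolding openin_Q using pre topspace_Q by auto
  moreover have "cls ` E \<union> ends E \<subseteq> topspace Q"
    unfolding topspace_Q using arc_sub(2)[OF E] ends_V V_class by blast
  ultimately have "closedin Q (cls ` E \<union> ends E)" by (simp add: closedin_def)
  then have "Q closure_of (cls ` E) \<subseteq> cls ` E \<union> ends E" by (intro closure_of_minimal) auto
  moreover have "V \<inter> cls ` E = {}" using class_notin_V arc_sub(1)[OF E] by blast
  ultimately show "V \<inter> Q closure_of (cls ` E) \<subseteq> ends E" by blast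
  show "ends E \<subseteq> V \<inter> Q closure_of (cls ` E)"
  proof
    fix u assume u: "u \<in> ends E"
    then obtain z where z: "u \<in> V" "z \<in> u" "z \<in> closure E" by (auto simp: ends_def)
    then have uz: "u = cls z" "z \<in> D" using V_eq_class V_sub by blast+
    have meet: "\<exists>y. y \<in> cls ` E \<and> y \<in> A" if A: "u \<in> A" "openin Q A" for A
    proof -
      have "openin (top_of_set D) {x \<in> D. cls x \<in> A}" using A(2) unfolding openin_Q by (elim conjE)
      then obtain U where U: "open U" "{x \<in> D. cls x \<in> A} = D \<inter> U" unfolding openin_open by blast
      have "z \<in> {x \<in> D. cls x \<in> A}" using uz A(1) by simp
      then have "z \<in> U" unfolding U(2) by simp
      then have "U \<inter> E \<noteq> {}" using z(3) open_Int_closure_eq_empty[OF U(1), of E] by blast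
      then obtain y where "y \<in> U" "y \<in> E" by blast
      moreover from this have "y \<in> {x \<in> D. cls x \<in> A}" unfolding U(2) using arc_sub(2)[OF E] by blast
      ultimately show ?thesis by blast
    qed
    have "u \<in> topspace Q" unfolding topspace_Q using uz by simp
    then have "u \<in> Q closure_of (cls ` E)" unfolding in_closure_of by (intro conjI allI impI meet) simp_all
    then show "u \<in> V \<inter> Q closure_of (cls ` E)" using z(1) by simp
  qed
qed

text \<open>The record of \<open>poincare_reeb_tree\<close> for an abstract disk and vertex set;
  \<open>tree_eq\<close> identifies the two.\<close>

definition tree :: "plane set rooted_graph" where
  "tree = \<lparr> vertices = V, root = rt,
        adj = {(u, v). u \<noteq> v \<and> (\<exists>e\<in>qarcs. V \<inter> Q closure_of e = {u, v})},
        vle = {(u, v). u \<in> V \<and> v \<in> V \<and> (\<exists>p\<in>u. \<exists>q\<in>v. fst p \<le> fst q)} \<rparr>"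

lemma adj_tree: "adj tree = arc_adj arcs"
proof -
  have "u \<noteq> v" if "E \<in> arcs" "ends E = {u, v}" for E u v
    using arc_ends[OF that(1)] that(2) by (metis doubleton_eq_iff)
  note ne = this
  have "(u, v) \<in> adj tree \<longleftrightarrow> (u, v) \<in> arc_adj arcs" for u v
  proof -
    have "(u, v) \<in> adj tree \<longleftrightarrow> u \<noteq> v \<and> (\<exists>E\<in>arcs. V \<inter> Q closure_of (cls ` E) = {u, v})"
      by (simp add: tree_def qarcs_eq)
    also have "\<dots> \<longleftrightarrow> u \<noteq> v \<and> (\<exists>E\<in>arcs. ends E = {u, v})" using closure_of_arc by simp
    also have "\<dots> \<longleftrightarrow> (u, v) \<in> arc_adj arcs" unfolding arc_adj_def using ne by blast
    finally show ?thesis .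
  qed
  then show ?thesis by (intro set_eqI) (metis surj_pair)
qed

lemma tree_simps [simp]: "vertices tree = V" "root tree = rt"
  by (simp_all add: tree_def)

sublocale bridge_graph tree
proof
  show "(u, v) \<notin> (adj tree - {(u, v), (v, u)})\<^sup>*" if "(u, v) \<in> adj tree" for u v
  proof -
    obtain E where E: "E \<in> arcs" "ends E = {u, v}" using \<open>(u, v) \<in> adj tree\<close> unfolding adj_tree arc_adj_def by blast
    \<comment> \<open>Deleting the adjacency would delete every arc between \<open>u\<close> and
      \<open>v\<close>, whereas \<open>arc_bridge\<close> removes only \<open>E\<close> and is
      therefore at least as strong.\<close>
    have "adj tree - {(u, v), (v, u)} \<subseteq> arc_adj (arcs - {E})"
      unfolding adj_tree arc_adj_def using E(2) by (auto simp: doubleton_eq_iff)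
    then show ?thesis using arc_bridge[OF E] rtrancl_mono by blast
  qed
  show "irrefl (adj tree)" unfolding tree_def by (auto simp: irrefl_def)
  show "(root tree, v) \<in> (adj tree)\<^sup>*" if "v \<in> vertices tree" for v
    using arc_graph_connected that unfolding adj_tree by simp
qed (simp_all add: adj_tree arc_adj_V sym_arc_adj finite_V root)

text \<open>Two arcs with the same ends would be counted as one neighbour; the second would bypass
  the first, against \<open>arc_bridge\<close>.\<close>

lemma card_neighbours:
  assumes u: "u \<in> V" and st: "is_star D R u \<N>"
  shows "card (adj tree `` {u}) = card \<N>"
proof -
  let ?A = "{E \<in> arcs. u \<in> ends E}"
  have "\<exists>v. ends E = {u, v}" if "E \<in> ?A" for E
  proof -
    have E: "E \<in> arcs" "u \<in> ends E" using that by simp_all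
    obtain a b where ab: "ends E = {a, b}" using arc_ends[OF E(1)] by metis
    moreover have "u = a \<or> u = b" using E(2) unfolding ab by simp
    ultimately show ?thesis by (metis insert_commute)
  qed
  then have "\<forall>E\<in>?A. \<exists>v. ends E = {u, v}" by (rule ballI)
  then have "\<exists>g. \<forall>E\<in>?A. ends E = {u, g E}" by (rule bchoice)
  then obtain g where "\<forall>E\<in>?A. ends E = {u, g E}" ..
  then have g: "ends E = {u, g E}" if "E \<in> ?A" for E using that by (rule bspec)
  have inj: "inj_on g ?A"
  proof (rule inj_onI)
    fix E E' assume EE: "E \<in> ?A" "E' \<in> ?A" "g E = g E'"
    show "E = E'"
    proof (rule ccontr)
      assume "E \<noteq> E'"
      then have "(u, g E) \<in> arc_adj (arcs - {E})" using EE g[of E'] by (auto simp: arc_adj_def)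
      then show False using arc_bridge[of E u "g E"] g[of E] EE by blast
    qed
  qed
  have im: "g ` ?A = adj tree `` {u}"
  proof
    show "g ` ?A \<subseteq> adj tree `` {u}" unfolding adj_tree arc_adj_def using g by blast
    show "adj tree `` {u} \<subseteq> g ` ?A"
    proof
      fix v assume "v \<in> adj tree `` {u}"
      then obtain E where E: "E \<in> arcs" "ends E = {u, v}" unfolding adj_tree arc_adj_def by blast
      then have EA: "E \<in> ?A" by blast
      moreover have "v = g E" using g[OF EA] E by (metis doubleton_eq_iff)
      ultimately show "v \<in> g ` ?A" by blast
    qed
  qed
  show ?thesis unfolding im[symmetric] card_image[OF inj] by (rule card_arcs_at(2)[OF u st])
qed

text \<open>\<open>fst\<close> is constant on each vertex, so comparing representatives gives a
  total preorder; antisymmetry is \<open>V_fst\<close>.\<close>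

lemma linear_order: "linear_order_on V (vle tree)"
proof -
  have vle: "(u, v) \<in> vle tree \<longleftrightarrow> u \<in> V \<and> v \<in> V \<and> (\<exists>p\<in>u. \<exists>q\<in>v. fst p \<le> fst q)" for u v
    by (simp add: tree_def)
  have all: "fst p \<le> fst q" if "(u, v) \<in> vle tree" "p \<in> u" "q \<in> v" for u v p q
    using that V_fst_const[of u p] V_fst_const[of v q] unfolding vle by fastforce
  have "(x, x) \<in> vle tree" if x: "x \<in> V" for x
  proof -
    obtain p where "p \<in> x" using V_nonempty[OF x] by blast
    then show ?thesis using x order_refl[of "fst p"] unfolding vle by blast
  qed
  then have "refl_on V (vle tree)" unfolding refl_on_def by blast
  moreover have "vle tree \<subseteq> V \<times> V" by (auto simp: vle)
  moreover have "trans (vle tree)"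
  proof (rule transI)
    fix x y z assume xy: "(x, y) \<in> vle tree" "(y, z) \<in> vle tree"
    then obtain p q w where "p \<in> x" "q \<in> y" "w \<in> z" using V_nonempty unfolding vle by blast
    then show "(x, z) \<in> vle tree" using all[OF xy(1), of p q] all[OF xy(2), of q w] xy unfolding vle by (meson order_trans)
  qed
  moreover have "antisym (vle tree)"
  proof (rule antisymI)
    fix x y assume xy: "(x, y) \<in> vle tree" "(y, x) \<in> vle tree"
    then obtain p q where "p \<in> x" "q \<in> y" using V_nonempty unfolding vle by blast
    moreover from this have "fst p = fst q" using all[OF xy(1), of p q] all[OF xy(2), of q p] by simp
    ultimately show "x = y" using V_fst xy unfolding vle by blast
  qed
  moreover have "total_on V (vle tree)"
  proof -
    have "(x, y) \<in> vle tree \<or> (y, x) \<in> vle tree" if xy: "x \<in> V" "y \<in> V" for x y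
    proof -
      obtain p q where "p \<in> x" "q \<in> y" using V_nonempty[OF xy(1)] V_nonempty[OF xy(2)] by blast
      then show ?thesis using xy linear[of "fst p" "fst q"] unfolding vle by blast
    qed
    then show ?thesis by (simp add: total_on_def)
  qed
  ultimately show ?thesis by (simp add: linear_order_on_def partial_order_on_def preorder_on_def)
qed

lemma binary:
  assumes "is_star D R rt \<N>" "card \<N> = 2"
    and "\<And>u. u \<in> V \<Longrightarrow> u \<noteq> rt \<Longrightarrow> \<exists>\<N>. is_star D R u \<N> \<and> card \<N> \<in> {1, 3}"
  shows "complete_binary_tree tree"
proof (rule complete_binary_treeI)
  show "card (adj tree `` {root tree}) = 2" using card_neighbours[OF root assms(1)] assms(2) by simp
  show "card (adj tree `` {v}) \<in> {1, 3}" if "v \<in> vertices tree" "v \<noteq> root tree" for v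
    using that assms(3)[of v] card_neighbours[of v] by force
qed

end

section \<open>Level sets near a strict local minimum\<close>

text \<open>The connected complement makes a compact set in the complex plane Borsukian and thereby
  unicoherent; the linear isomorphism \<open>h\<close> carries this to pairs of reals.\<close>

lemma unicoherent_compact_plane:
  fixes D :: "plane set"
  assumes "compact D" "connected (- D)"
  shows "unicoherent D"
proof -
  define h :: "plane \<Rightarrow> complex" where "h p = Complex (fst p) (snd p)" for p
  have lin: "linear h" by (rule linearI) (auto simp: h_def complex_eq_iff)
  have inj: "inj h" by (auto simp: h_def inj_def prod_eq_iff)
  have "surj h" by (rule surjI[of _ "\<lambda>z. (Re z, Im z)"]) (simp add: h_def)
  then have "- h ` D = h ` (- D)" using inj bij_image_Compl_eq[of h D] by (simp add: bij_def)
  moreover have cont: "continuous_on S h" for S using lin linear_continuous_on linear_conv_bounded_linear by blast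
  ultimately have "connected (- h ` D)" using assms(2) connected_continuous_image by metis
  moreover have "compact (h ` D)" using compact_continuous_image[OF cont assms(1)] .
  ultimately have "unicoherent (h ` D)" by (simp add: Borsukian_imp_unicoherent Borsukian_separation_compact)
  then show ?thesis using unicoherent_injective_linear_image[OF lin inj] by simp
qed

text \<open>The square of half-width \<open>r\<close> is fixed before \<epsilon>. By
  \<open>border\<close> the level disk cannot reach its boundary, so the signs and the absence of
  critical points known in the square hold on all of the disk.\<close>

locale small_level =
  fixes F :: "real poly poly" and r \<epsilon> :: real
  assumes r: "r > 0" and eps: "\<epsilon> > 0" and F0: "poly2 F (0, 0) = 0"
    and pos: "\<And>x y. \<bar>x\<bar> \<le> r \<Longrightarrow> \<bar>y\<bar> \<le> r \<Longrightarrow> (x, y) \<noteq> (0, 0) \<Longrightarrow> poly2 F (x, y) > 0"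
    and y0: "\<And>y. \<bar>y\<bar> \<le> r \<Longrightarrow> y \<noteq> 0 \<Longrightarrow> poly2 (pderiv F) (0, y) \<noteq> 0"
    and crit: "\<And>x y. \<bar>x\<bar> \<le> r \<Longrightarrow> \<bar>y\<bar> \<le> r \<Longrightarrow> (x, y) \<noteq> (0, 0) \<Longrightarrow> poly2 (poly2_dx F) (x, y) \<noteq> 0 \<or> poly2 (pderiv F) (x, y) \<noteq> 0"
    and border: "\<And>x y. \<bar>x\<bar> \<le> r \<Longrightarrow> \<bar>y\<bar> \<le> r \<Longrightarrow> \<bar>x\<bar> = r \<or> \<bar>y\<bar> = r \<Longrightarrow> poly2 F (x, y) > \<epsilon>"
    and generic: "generic_direction (poly2 F) \<epsilon> (0, 1)"
begin

abbreviation "f \<equiv> poly2 F"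
abbreviation "fx \<equiv> poly2 (poly2_dx F)"
abbreviation "fy \<equiv> poly2 (pderiv F)"
abbreviation "fyy \<equiv> poly2 (pderiv (pderiv F))"
abbreviation "D \<equiv> level_disk f \<epsilon>"
abbreviation "cls \<equiv> reeb_class D"

section \<open>The level disk and its complement\<close>

definition B :: "plane set" where "B = {-r<..<r} \<times> {-r<..<r}"

lemma open_B: "open B" by (simp add: B_def open_Times)

lemma B_abs: "(x, y) \<in> B \<longleftrightarrow> \<bar>x\<bar> < r \<and> \<bar>y\<bar> < r" by (auto simp: B_def)

lemma f_nonneg: "p \<in> B \<Longrightarrow> 0 \<le> f p"
  using pos[of "fst p" "snd p"] F0 by (cases "p = (0, 0)"; cases p) (auto simp: B_abs intro: less_imp_le)

lemma crit_B: "p \<in> B \<Longrightarrow> p \<noteq> (0, 0) \<Longrightarrow> fx p \<noteq> 0 \<or> fy p \<noteq> 0"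
  using crit[of "fst p" "snd p"] by (cases p) (auto simp: B_abs)

lemma zero_D: "(0, 0) \<in> D"
  unfolding level_disk_def using F0 eps by simp

lemma D_range: "p \<in> D \<Longrightarrow> 0 \<le> f p" "p \<in> D \<Longrightarrow> f p \<le> \<epsilon>"
  using connected_component_subset[of "f -` {0..\<epsilon>}" "(0, 0)"] unfolding level_disk_def by auto

lemma connected_D: "connected D"
  by (simp add: level_disk_def)

lemma closed_D: "closed D"
  unfolding level_disk_def
  by (intro closed_connected_component closed_vimage closed_atLeastAtMost continuous_intros)

text \<open>\<open>D\<close> misses the boundary of the square, so its part in the open square is
  open and closed in \<open>D\<close>; it contains the origin.\<close>

lemma D_sub_B: "D \<subseteq> B"
proof -
  have "D \<inter> B = D \<inter> ({-r..r} \<times> {-r..r})"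
  proof
    show "D \<inter> ({-r..r} \<times> {-r..r}) \<subseteq> D \<inter> B"
    proof
      fix p assume "p \<in> D \<inter> ({-r..r} \<times> {-r..r})"
      then obtain x y where p: "p = (x, y)" and xy: "(x, y) \<in> D" "x \<in> {-r..r}" "y \<in> {-r..r}" by blast
      then have le: "\<bar>x\<bar> \<le> r" "\<bar>y\<bar> \<le> r" by auto
      moreover have "\<bar>x\<bar> \<noteq> r" "\<bar>y\<bar> \<noteq> r" using border[OF le] D_range(2)[OF xy(1)] by auto
      ultimately show "p \<in> D \<inter> B" using xy(1) by (simp add: B_abs p)
    qed
  qed (auto simp: B_def)
  then have "closedin (top_of_set D) (D \<inter> B)"
    by (metis closedin_closed_Int closed_Times closed_atLeastAtMost)
  moreover have "openin (top_of_set D) (D \<inter> B)" using open_B by (rule openin_open_Int)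
  moreover have "D \<inter> B \<noteq> {}" using zero_D r by (auto simp: B_def)
  ultimately have "D \<inter> B = D" using connected_D connected_clopen by blast
  then show ?thesis by blast
qed

lemma compact_D: "compact D"
proof -
  have "bounded B" by (simp add: B_def bounded_Times)
  then show ?thesis using closed_D D_sub_B bounded_subset compact_eq_bounded_closed by blast
qed

text \<open>\<open>D\<close> is a component of the set \<open>0 \<le> f \<le> \<epsilon>\<close>,
  and in \<open>B\<close> the lower bound holds everywhere. All later proofs of membership in
  \<open>D\<close> start from a known point and use this.\<close>

lemma grow:
  assumes "connected N" "N \<subseteq> B" "z \<in> N" "z \<in> D" "\<And>p. p \<in> N \<Longrightarrow> f p \<le> \<epsilon>"
  shows "N \<subseteq> D"
proof -
  have "N \<subseteq> f -` {0..\<epsilon>}" using assms f_nonneg by auto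
  then have "N \<subseteq> connected_component_set (f -` {0..\<epsilon>}) z" by (rule connected_component_maximal[OF assms(3,1)])
  also have "\<dots> = D" using assms(4) unfolding level_disk_def by (rule connected_component_eq)
  finally show ?thesis .
qed

lemma interior_D:
  assumes "z \<in> D" "f z < \<epsilon>" shows "z \<in> interior D"
proof -
  have "open (B \<inter> {z. f z < \<epsilon>})" using open_B open_poly2_less(2) by (rule open_Int)
  moreover have "z \<in> B \<inter> {z. f z < \<epsilon>}" using assms D_sub_B by blast
  ultimately obtain e where e: "e > 0" "ball z e \<subseteq> B \<inter> {z. f z < \<epsilon>}" using openE by blast
  have "ball z e \<subseteq> D" by (rule grow[of _ z]) (use e assms in \<open>auto intro: less_imp_le\<close>)
  then show ?thesis using e centre_in_ball interior_maximal open_ball by blast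
qed

lemma no_local_extremum:
  assumes "open T" "z \<in> T" "z \<in> B" "z \<noteq> (0, 0)" "(\<forall>w\<in>T. f w \<le> f z) \<or> (\<forall>w\<in>T. f z \<le> f w)"
  shows False
proof -
  have "(\<lambda>h. fx z * fst h + fy z * snd h) = (\<lambda>h. 0)"
    by (rule differential_zero_maxmin[OF assms(2,1) poly2_has_derivative assms(5)])
  from fun_cong[OF this, of "(1, 0)"] fun_cong[OF this, of "(0, 1)"] show False
    using crit_B[OF assms(3,4)] by simp
qed

text \<open>A point of value \<epsilon> inside the interior of \<open>D\<close> would be a local
  maximum of \<open>f\<close>, hence a critical point other than the origin.\<close>

lemma level_curve_eq: "level_curve f \<epsilon> = {z \<in> D. f z = \<epsilon>}"
proof -
  have "z \<notin> interior D" if "z \<in> D" "f z = \<epsilon>" for z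
  proof
    assume "z \<in> interior D"
    moreover have "z \<noteq> (0, 0)" using that F0 eps by auto
    moreover have "\<forall>w\<in>interior D. f w \<le> f z" using that D_range(2) interior_subset by blast
    ultimately show False using no_local_extremum[of "interior D" z] that D_sub_B by blast
  qed
  then show ?thesis unfolding level_curve_def using interior_D D_range(2) by (force simp: not_less)
qed

text \<open>A bounded component \<open>C\<close> of the complement lies in \<open>B\<close> and has
  \<open>f = \<epsilon>\<close> on its frontier. Without critical points in \<open>C\<close>,
  maximum and minimum over its closure are taken on the frontier, so \<open>f\<close> is constant on
  \<open>C\<close>, which makes every point of \<open>C\<close> an extremum.\<close>

lemma connected_compl_D: "connected (- D)"
proof (rule ccontr)
  assume "\<not> connected (- D)"
  moreover have "bounded (- (- D))" using compact_D compact_imp_bounded by simp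
  ultimately obtain C where C: "C \<in> components (- D)" "bounded C"
    using cobounded_has_bounded_component[of "- D"] by auto
  have openC: "open C" using C(1) closed_D open_components by blast
  have CD: "C \<inter> D = {}" and Cne: "C \<noteq> {}" using C(1) in_components_subset in_components_nonempty by blast+
  have CB: "C \<subseteq> B"
  proof (rule ccontr)
    assume "\<not> C \<subseteq> B"
    have "bounded B" by (simp add: B_def bounded_Times)
    moreover have "convex B" by (simp add: B_def convex_Times)
    ultimately have "connected (- B)" by (intro connected_complement_bounded_convex) auto
    moreover have "- B \<subseteq> - D" using D_sub_B by blast
    ultimately have "- B \<subseteq> C" using components_maximal[OF C(1), of "- B"] \<open>\<not> C \<subseteq> B\<close> by blast
    then have "bounded (- B)" using C(2) bounded_subset by blast
    then have "bounded (B \<union> - B)" using \<open>bounded B\<close> by (simp only: bounded_Un)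
    then show False using not_bounded_UNIV by simp
  qed
  have fr: "f z = \<epsilon>" if "z \<in> closure C" "z \<notin> C" for z
  proof -
    have "z \<in> frontier C" using that openC by (simp add: frontier_def interior_open)
    then have "z \<in> frontier D" using frontier_of_components_subset[OF C(1)] by (auto simp: frontier_complement)
    then have "z \<in> D" "z \<notin> interior D" using closed_D by (auto simp: frontier_def)
    then show ?thesis using interior_D[of z] D_range(2)[of z] by linarith
  qed
  have ext: False if "z \<in> C" "(\<forall>w\<in>C. f w \<le> f z) \<or> (\<forall>w\<in>C. f z \<le> f w)" for z
    using no_local_extremum[OF openC that(1) _ _ that(2)] CB CD that(1) zero_D by blast
  have "compact (closure C)" "closure C \<noteq> {}" using C(2) Cne by auto
  then have "\<exists>z\<in>closure C. \<forall>w\<in>closure C. f w \<le> f z" "\<exists>z\<in>closure C. \<forall>w\<in>closure C. f z \<le> f w"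
    by (auto intro: continuous_attains_sup continuous_attains_inf continuous_on_poly2)
  then have "\<forall>w\<in>C. f w \<le> \<epsilon>" "\<forall>w\<in>C. \<epsilon> \<le> f w"
    using fr ext closure_subset[of C] by (metis subsetD)+
  then have "\<forall>w\<in>C. f w = \<epsilon>" by force
  then show False using ext Cne by (metis ex_in_conv order_refl)
qed

lemma unicoherent_D: "unicoherent D"
  by (rule unicoherent_compact_plane[OF compact_D connected_compl_D])

section \<open>Vertical tangencies and what genericity says about them\<close>

definition P :: "plane set" where "P = {p \<in> D. f p = \<epsilon> \<and> fy p = 0}"

lemma P_nonzero: "p \<in> P \<Longrightarrow> p \<noteq> (0, 0)"
  using F0 eps by (auto simp: P_def)

lemma P_fx: "p \<in> P \<Longrightarrow> fx p \<noteq> 0"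
  using crit_B[of p] P_nonzero[of p] D_sub_B by (auto simp: P_def)

lemma frechet_f: "frechet_derivative f (at p) = (\<lambda>h. fx p * fst h + fy p * snd h)"
  by (rule frechet_derivative_at[symmetric]) (rule poly2_has_derivative)

lemma tangent_line_P:
  assumes "p \<in> P" shows "tangent_line f p = {q. fst q = fst p}"
  using P_fx[OF assms] assms by (auto simp: tangent_line_def frechet_f P_def)

lemma vertical_line_direction: "has_direction {q. fst q = a} (0, 1)"
proof -
  have "{q :: plane. fst q = a} = {(a, 0) + t *\<^sub>R (0, 1) |t. True}"
    by (auto simp: prod_eq_iff real_scaleR_def)
  then show ?thesis unfolding has_direction_def by (intro conjI exI[of _ "(a, 0)"]) (simp_all add: zero_prod_def)
qed

lemma P_eq: "{p \<in> level_curve f \<epsilon>. has_direction (tangent_line f p) (0, 1)} = P"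
proof
  show "P \<subseteq> {p \<in> level_curve f \<epsilon>. has_direction (tangent_line f p) (0, 1)}"
    using tangent_line_P vertical_line_direction by (auto simp: level_curve_eq P_def)
  show "{p \<in> level_curve f \<epsilon>. has_direction (tangent_line f p) (0, 1)} \<subseteq> P"
  proof clarify
    fix a b assume p: "(a, b) \<in> level_curve f \<epsilon>" "has_direction (tangent_line f (a, b)) (0, 1)"
    then obtain p0 where p0: "tangent_line f (a, b) = {p0 + t *\<^sub>R (0, 1) |t. True}" unfolding has_direction_def by blast
    have "(a, b) \<in> tangent_line f (a, b)" by (simp add: tangent_line_def frechet_f)
    then obtain t where "(a, b) = p0 + t *\<^sub>R (0, 1)" using p0 by blast
    then have "(a, b + 1) = p0 + (t + 1) *\<^sub>R (0, 1)" by (auto simp: prod_eq_iff real_scaleR_def)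
    then have "(a, b + 1) \<in> tangent_line f (a, b)" using p0 by blast
    then show "(a, b) \<in> P" using p(1) by (simp add: tangent_line_def frechet_f P_def level_curve_eq)
  qed
qed

text \<open>The tangent line at a point of \<open>P\<close> is the full vertical line through it, so
  two such points on one vertical line would make it a bitangent in the generic direction.\<close>

lemma P_fst_inj:
  assumes "p \<in> P" "q \<in> P" "fst p = fst q" shows "p = q"
proof (rule ccontr)
  assume "p \<noteq> q"
  moreover have "p \<in> level_curve f \<epsilon>" "q \<in> level_curve f \<epsilon>" using assms P_eq by blast+
  moreover have "tangent_line f q = tangent_line f p" using tangent_line_P assms by simp
  moreover have "has_direction (tangent_line f p) (0, 1)" using tangent_line_P[OF assms(1)] vertical_line_direction by simp
  ultimately have "bitangent f \<epsilon> (tangent_line f p)" unfolding bitangent_def by blast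
  then show False using generic \<open>has_direction (tangent_line f p) (0, 1)\<close> unfolding generic_direction_def by blast
qed

text \<open>With the tangent vector \<open>(0, 1)\<close> the second derivative in
  \<open>inflection_point\<close> is \<open>fyy\<close>.\<close>

lemma P_fyy:
  assumes "p \<in> P" shows "fyy p \<noteq> 0"
proof
  assume 0: "fyy p = 0"
  obtain a b where p: "p = (a, b)" by force
  have d1: "deriv (\<lambda>t. poly2 G (a, t + b)) = (\<lambda>t. poly2 (pderiv G) (a, t + b))" for G
  proof (intro ext DERIV_imp_deriv)
    show "((\<lambda>t. poly2 G (a, t + b)) has_real_derivative poly2 (pderiv G) (a, t + b)) (at t)" for t
      using poly2_DERIV_y[of G a "t + b" UNIV] by (simp only: DERIV_shift)
  qed
  have "(deriv ^^ 2) (\<lambda>t. f (p + t *\<^sub>R (0, 1))) 0 = deriv (deriv (\<lambda>t. f (a, t + b))) 0"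
    by (simp add: eval_nat_numeral p add.commute)
  also have "\<dots> = fyy p" by (simp add: d1 p)
  finally have "(deriv ^^ 2) (\<lambda>t. f (p + t *\<^sub>R (0, 1))) 0 = 0" using 0 by simp
  moreover have "p \<in> level_curve f \<epsilon>" "has_direction (tangent_line f p) (0, 1)" using assms P_eq by blast+
  ultimately show False using generic unfolding generic_direction_def inflection_point_def by blast
qed

end

section \<open>Local structure of the level disk\<close>

lemma convex_on_vertical:
  assumes "\<And>t. s \<le> t \<Longrightarrow> t \<le> w \<Longrightarrow> poly2 (pderiv (pderiv G)) (x, t) > 0" "s < t" "t < w"
  shows "poly2 G (x, t) < max (poly2 G (x, s)) (poly2 G (x, w))"
proof (rule ccontr)
  assume "\<not> ?thesis"
  then have le: "poly2 G (x, s) \<le> poly2 G (x, t)" "poly2 G (x, w) \<le> poly2 G (x, t)" by auto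
  obtain z1 where z1: "s < z1" "z1 < t" "poly2 G (x, t) - poly2 G (x, s) = (t - s) * poly2 (pderiv G) (x, z1)"
    using MVT2[OF assms(2) poly2_DERIV_y] by blast
  obtain z2 where z2: "t < z2" "z2 < w" "poly2 G (x, w) - poly2 G (x, t) = (w - t) * poly2 (pderiv G) (x, z2)"
    using MVT2[OF assms(3) poly2_DERIV_y] by blast
  have "poly2 (pderiv G) (x, z1) \<ge> 0" using z1(3) le(1) assms(2) by (smt (verit) mult_pos_neg)
  moreover have "poly2 (pderiv G) (x, z2) \<le> 0" using z2(3) le(2) assms(3) by (smt (verit) mult_pos_pos)
  moreover obtain z3 where z3: "z1 < z3" "z3 < z2" "poly2 (pderiv G) (x, z2) - poly2 (pderiv G) (x, z1) = (z2 - z1) * poly2 (pderiv (pderiv G)) (x, z3)"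
    using MVT2[OF _ poly2_DERIV_y, of z1 z2 "pderiv G" x] z1 z2 by auto
  moreover have "poly2 (pderiv (pderiv G)) (x, z3) > 0" using assms(1) z1 z2 z3 by simp
  ultimately show False using z1(2) z2(1) by (smt (verit) mult_pos_pos)
qed

lemma strict_min_on_vertical:
  assumes pos: "\<And>z. z \<in> closed_segment s t \<Longrightarrow> poly2 (pderiv (pderiv G)) (x, z) > 0"
    and "poly2 (pderiv G) (x, s) = 0" "t \<noteq> s"
  shows "poly2 G (x, s) < poly2 G (x, t)"
proof (cases "s < t")
  case True
  obtain z1 where z1: "s < z1" "z1 < t" "poly2 G (x, t) - poly2 G (x, s) = (t - s) * poly2 (pderiv G) (x, z1)"
    using MVT2[OF True poly2_DERIV_y] by blast
  obtain z3 where z3: "s < z3" "z3 < z1" "poly2 (pderiv G) (x, z1) - poly2 (pderiv G) (x, s) = (z1 - s) * poly2 (pderiv (pderiv G)) (x, z3)"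
    using MVT2[OF z1(1) poly2_DERIV_y] by blast
  have "poly2 (pderiv (pderiv G)) (x, z3) > 0" using pos[of z3] z1 z3 by (simp add: closed_segment_eq_real_ivl)
  then have "poly2 (pderiv G) (x, z1) > 0" using z3 z1 assms(2) by simp
  then show ?thesis using z1(3) True by (smt (verit) mult_pos_pos)
next
  case False
  then have ts: "t < s" using assms(3) by simp
  obtain z1 where z1: "t < z1" "z1 < s" "poly2 G (x, s) - poly2 G (x, t) = (s - t) * poly2 (pderiv G) (x, z1)"
    using MVT2[OF ts poly2_DERIV_y] by blast
  obtain z3 where z3: "z1 < z3" "z3 < s" "poly2 (pderiv G) (x, s) - poly2 (pderiv G) (x, z1) = (s - z1) * poly2 (pderiv (pderiv G)) (x, z3)"
    using MVT2[OF z1(2) poly2_DERIV_y] by blast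
  have "poly2 (pderiv (pderiv G)) (x, z3) > 0" using pos[of z3] z1 z3 by (simp add: closed_segment_eq_real_ivl)
  then have "(s - z1) * poly2 (pderiv (pderiv G)) (x, z3) > 0" using z1 by simp
  then have "poly2 (pderiv G) (x, z1) < 0" using z3 assms(2) by simp
  then show ?thesis using z1(3) ts by (smt (verit) mult_pos_neg)
qed

lemma horizontal_mono:
  assumes pos: "\<And>x'. x' \<in> closed_segment x1 x2 \<Longrightarrow> \<sigma> * poly2 (poly2_dx G) (x', y) > 0" and \<sigma>: "\<sigma> = 1 \<or> \<sigma> = -1"
    and less: "\<sigma> * (x2 - x1) > 0"
  shows "poly2 G (x1, y) < poly2 G (x2, y)"
proof (cases "x1 < x2")
  case True
  obtain z where z: "x1 < z" "z < x2" "poly2 G (x2, y) - poly2 G (x1, y) = (x2 - x1) * poly2 (poly2_dx G) (z, y)"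
    using MVT2[OF True poly2_DERIV_x] by blast
  have "\<sigma> = 1" using \<sigma> less True by auto
  then have "poly2 (poly2_dx G) (z, y) > 0" using pos[of z] z by (simp add: closed_segment_eq_real_ivl)
  then show ?thesis using z(3) True by (smt (verit) mult_pos_pos)
next
  case False
  then have x: "x2 < x1" using \<sigma> less by (cases "x1 = x2") auto
  obtain z where z: "x2 < z" "z < x1" "poly2 G (x1, y) - poly2 G (x2, y) = (x1 - x2) * poly2 (poly2_dx G) (z, y)"
    using MVT2[OF x poly2_DERIV_x] by blast
  have "\<sigma> = -1" using \<sigma> less x by auto
  then have "poly2 (poly2_dx G) (z, y) < 0" using pos[of z] z by (simp add: closed_segment_eq_real_ivl)
  then show ?thesis using z(3) x by (smt (verit) mult_pos_neg)
qed

lemma vertical_DERIV: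
  "((\<lambda>s. poly2 G (x, m + \<kappa> * s)) has_real_derivative \<kappa> * poly2 (pderiv G) (x, m + \<kappa> * s)) (at s)"
proof -
  have "((\<lambda>s. m + \<kappa> * s) has_real_derivative \<kappa>) (at s)" by (auto intro!: derivative_eq_intros)
  from DERIV_chain2[of "\<lambda>y. poly2 G (x, y)" _ "\<lambda>s. m + \<kappa> * s", OF poly2_DERIV_y this]
  show ?thesis by (simp add: mult.commute)
qed

lemma vertical_mono:
  assumes "\<And>z. s \<le> z \<Longrightarrow> z \<le> t \<Longrightarrow> \<kappa> * poly2 (pderiv G) (x, m + \<kappa> * z) > 0" "s < t"
  shows "poly2 G (x, m + \<kappa> * s) < poly2 G (x, m + \<kappa> * t)"
  by (rule DERIV_pos_imp_increasing[OF assms(2)]) (use vertical_DERIV assms(1) in blast)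

lemma near_vertical:
  fixes W :: "plane set"
  assumes "open W" "compact K" "\<And>y. y \<in> K \<Longrightarrow> (x0, y) \<in> W"
  obtains \<delta> where "\<delta> > 0" "\<And>x y. \<bar>x - x0\<bar> \<le> \<delta> \<Longrightarrow> y \<in> K \<Longrightarrow> (x, y) \<in> W"
proof -
  obtain X where X: "x0 \<in> X" "open X" "X \<times> K \<subseteq> W"
    using Elementary_Topology.tube_lemma[OF assms(2,1), of x0] assms(3) by blast
  obtain e where e: "e > 0" "cball x0 e \<subseteq> X" using X open_contains_cball by blast
  show thesis by (rule that[OF e(1)]) (use X e in \<open>auto simp: dist_real_def abs_minus_commute subset_iff\<close>)
qed

text \<open>For \<open>x\<close> near \<open>x0\<close>, the sublevel set on the vertical ray from \<open>(x, m)\<close> in direction \<open>\<kappa>\<close>,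
  which is \<open>1\<close> or \<open>-1\<close>, is up to distance \<open>S\<close> a segment with a transversal end.\<close>

definition is_arm :: "real poly poly \<Rightarrow> real \<Rightarrow> plane set \<Rightarrow> real \<Rightarrow> real \<Rightarrow> real \<Rightarrow> real \<Rightarrow> real \<Rightarrow> bool" where
  "is_arm G \<epsilon> U x0 m \<kappa> S \<delta> \<longleftrightarrow> 0 < S \<and> 0 < \<delta> \<and> (\<forall>x. \<bar>x - x0\<bar> \<le> \<delta> \<longrightarrow>
     poly2 G (x, m + \<kappa> * S) > \<epsilon> \<and> poly2 G (x, m) < \<epsilon> \<and>
     (\<forall>s. 0 \<le> s \<longrightarrow> s \<le> S \<longrightarrow> (x, m + \<kappa> * s) \<in> U \<and>
        (poly2 G (x, m + \<kappa> * s) = \<epsilon> \<longrightarrow> poly2 (pderiv G) (x, m + \<kappa> * s) \<noteq> 0) \<and>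
        (\<forall>s'. 0 \<le> s' \<longrightarrow> s' \<le> s \<longrightarrow> poly2 G (x, m + \<kappa> * s) \<le> \<epsilon> \<longrightarrow> poly2 G (x, m + \<kappa> * s') \<le> \<epsilon>)))"

lemma is_armD:
  assumes "is_arm G \<epsilon> U x0 m \<kappa> S \<delta>"
  shows "0 < S" "0 < \<delta>" and "\<bar>x - x0\<bar> \<le> \<delta> \<Longrightarrow> poly2 G (x, m + \<kappa> * S) > \<epsilon>"
    and "\<bar>x - x0\<bar> \<le> \<delta> \<Longrightarrow> poly2 G (x, m) < \<epsilon>"
    and "\<bar>x - x0\<bar> \<le> \<delta> \<Longrightarrow> 0 \<le> s \<Longrightarrow> s \<le> S \<Longrightarrow> (x, m + \<kappa> * s) \<in> U"
    and "\<bar>x - x0\<bar> \<le> \<delta> \<Longrightarrow> 0 \<le> s \<Longrightarrow> s \<le> S \<Longrightarrow> poly2 G (x, m + \<kappa> * s) = \<epsilon> \<Longrightarrow>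
      poly2 (pderiv G) (x, m + \<kappa> * s) \<noteq> 0"
    and "\<bar>x - x0\<bar> \<le> \<delta> \<Longrightarrow> 0 \<le> s' \<Longrightarrow> s' \<le> s \<Longrightarrow> s \<le> S \<Longrightarrow> poly2 G (x, m + \<kappa> * s) \<le> \<epsilon> \<Longrightarrow>
      poly2 G (x, m + \<kappa> * s') \<le> \<epsilon>"
  using assms unfolding is_arm_def by (simp_all only: order_trans[of 0 s' s] simp_thms) (blast intro: order_trans)+

text \<open>Within distance \<rho> of the end, the sign of the derivative makes \<open>G\<close>
  strictly increasing along the ray, uniformly for nearby \<open>x\<close>. On the rest of the ray
  \<open>G < \<epsilon>\<close> persists for nearby \<open>x\<close> by compactness.
  \<open>S\<close> is \<open>L + \<rho>\<close>, just beyond the end, where \<open>G\<close> exceeds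
  \<epsilon>.\<close>

lemma arm:
  assumes \<kappa>: "\<kappa> = 1 \<or> \<kappa> = -1" and L: "L > 0" and f: "poly2 G (x0, m + \<kappa> * L) = \<epsilon>" "\<kappa> * poly2 (pderiv G) (x0, m + \<kappa> * L) > 0"
    and less: "\<And>s. 0 \<le> s \<Longrightarrow> s < L \<Longrightarrow> poly2 G (x0, m + \<kappa> * s) < \<epsilon>"
    and U: "open U" "\<And>s. 0 \<le> s \<Longrightarrow> s \<le> L \<Longrightarrow> (x0, m + \<kappa> * s) \<in> U"
  shows "\<exists>S \<delta>. is_arm G \<epsilon> U x0 m \<kappa> S \<delta>"
proof -
  have "open {z. \<kappa> * poly2 (pderiv G) z > 0}" by (intro open_Collect_less continuous_intros)
  then have "open (U \<inter> {z. \<kappa> * poly2 (pderiv G) z > 0})" using U(1) by (intro open_Int)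
  then obtain \<eta> where \<eta>: "\<eta> > 0" "\<And>x y. \<bar>x - x0\<bar> \<le> \<eta> \<Longrightarrow> \<bar>y - (m + \<kappa> * L)\<bar> \<le> \<eta> \<Longrightarrow> (x, y) \<in> U \<inter> {z. \<kappa> * poly2 (pderiv G) z > 0}"
    using open_contains_box[of _ x0 "m + \<kappa> * L"] f(2) U(2)[of L] L by (metis (no_types, lifting) IntI less_eq_real_def mem_Collect_eq order_refl)
  define \<rho> where "\<rho> = min \<eta> (L / 2)"
  have \<rho>: "\<rho> > 0" "\<rho> \<le> \<eta>" "\<rho> < L" using \<eta>(1) L by (auto simp: \<rho>_def)
  have abs\<kappa>: "\<bar>(m + \<kappa> * s) - (m + \<kappa> * L)\<bar> = \<bar>s - L\<bar>" for s using \<kappa> by auto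
  have zone: "(x, m + \<kappa> * s) \<in> U" "\<kappa> * poly2 (pderiv G) (x, m + \<kappa> * s) > 0" if "\<bar>x - x0\<bar> \<le> \<eta>" "\<bar>s - L\<bar> \<le> \<rho>" for x s
    using \<eta>(2)[OF that(1), of "m + \<kappa> * s"] that(2) \<rho>(2) abs\<kappa>[of s] by auto
  have mono: "poly2 G (x, m + \<kappa> * s') < poly2 G (x, m + \<kappa> * s)"
    if "\<bar>x - x0\<bar> \<le> \<eta>" "L - \<rho> \<le> s'" "s' < s" "s \<le> L + \<rho>" for x s s'
    by (rule vertical_mono) (use zone(2)[OF that(1)] that in auto)
  have top: "poly2 G (x0, m + \<kappa> * (L + \<rho>)) > \<epsilon>" using mono[of x0 L "L + \<rho>"] \<rho> \<eta>(1) f(1) by simp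
  obtain \<delta>1 where \<delta>1: "\<delta>1 > 0" "\<And>x y. \<bar>x - x0\<bar> \<le> \<delta>1 \<Longrightarrow> \<bar>y - (m + \<kappa> * (L + \<rho>))\<bar> \<le> \<delta>1 \<Longrightarrow> (x, y) \<in> {z. \<epsilon> < poly2 G z}"
    using open_contains_box[OF open_poly2_less(1)[of \<epsilon> G], of x0 "m + \<kappa> * (L + \<rho>)"] top by blast
  let ?K = "(\<lambda>s. m + \<kappa> * s) ` {0..L - \<rho>}"
  have "compact ?K" by (intro compact_continuous_image continuous_intros compact_Icc)
  moreover have "(x0, y) \<in> U \<inter> {z. poly2 G z < \<epsilon>}" if "y \<in> ?K" for y
    using that less U(2) \<rho> by auto
  moreover have "open (U \<inter> {z. poly2 G z < \<epsilon>})" using U(1) open_poly2_less(2) by (rule open_Int)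
  ultimately obtain \<delta>2 where \<delta>2: "\<delta>2 > 0" "\<And>x y. \<bar>x - x0\<bar> \<le> \<delta>2 \<Longrightarrow> y \<in> ?K \<Longrightarrow> (x, y) \<in> U \<inter> {z. poly2 G z < \<epsilon>}"
    using near_vertical[of "U \<inter> {z. poly2 G z < \<epsilon>}" ?K x0] by blast
  have inner: "(x, m + \<kappa> * s) \<in> U" "poly2 G (x, m + \<kappa> * s) < \<epsilon>" if "\<bar>x - x0\<bar> \<le> \<delta>2" "0 \<le> s" "s \<le> L - \<rho>" for x s
  proof -
    have "m + \<kappa> * s \<in> ?K" using that by (intro imageI) simp
    from \<delta>2(2)[OF that(1) this] show "(x, m + \<kappa> * s) \<in> U" "poly2 G (x, m + \<kappa> * s) < \<epsilon>" by simp_all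
  qed
  define \<delta> where "\<delta> = min \<eta> (min \<delta>1 \<delta>2)"
  have \<delta>: "\<delta> > 0" "\<delta> \<le> \<eta>" "\<delta> \<le> \<delta>1" "\<delta> \<le> \<delta>2" using \<eta> \<delta>1 \<delta>2 by (auto simp: \<delta>_def)
  show ?thesis
    unfolding is_arm_def
  proof (rule exI[of _ "L + \<rho>"], rule exI[of _ \<delta>], intro conjI allI impI)
    fix x assume x: "\<bar>x - x0\<bar> \<le> \<delta>"
    show "poly2 G (x, m + \<kappa> * (L + \<rho>)) > \<epsilon>" using \<delta>1 \<delta> x by auto
    show "poly2 G (x, m) < \<epsilon>" using inner(2)[of x 0] \<delta> x \<rho> by auto
    fix s assume s: "0 \<le> s" "s \<le> L + \<rho>"
    consider "s \<le> L - \<rho>" | "\<bar>s - L\<bar> \<le> \<rho>" using s by linarith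
    note zones = this
    show "(x, m + \<kappa> * s) \<in> U"
      by (cases rule: zones) (use inner(1)[of x s] zone(1)[of x s] s x \<delta> in auto)
    show "poly2 (pderiv G) (x, m + \<kappa> * s) \<noteq> 0" if "poly2 G (x, m + \<kappa> * s) = \<epsilon>"
      by (cases rule: zones) (use inner(2)[of x s] zone(2)[of x s] that s x \<delta> in auto)
    fix s' assume s': "0 \<le> s'" "s' \<le> s" "poly2 G (x, m + \<kappa> * s) \<le> \<epsilon>"
    show "poly2 G (x, m + \<kappa> * s') \<le> \<epsilon>"
    proof (cases "s' \<le> L - \<rho>")
      case True then show ?thesis using inner(2)[of x s'] s' x \<delta> by auto
    next
      case False
      then have "s' = s \<or> poly2 G (x, m + \<kappa> * s') < poly2 G (x, m + \<kappa> * s)"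
        using mono[of x s' s] s s' x \<delta> by (cases "s' = s") auto
      then show ?thesis using s'(3) by auto
    qed
  qed (use \<rho> \<delta> L in auto)
qed

text \<open>\<open>N\<close> is a comb: vertical segments join its points to the connected spine at
  height \<open>c\<close>.\<close>

lemma star_strip_connected:
  fixes N :: "plane set"
  assumes J: "connected J" and N: "\<And>x. x \<in> J \<Longrightarrow> (x, c) \<in> N"
    and star: "\<And>x y t. (x, y) \<in> N \<Longrightarrow> x \<in> J \<and> (t \<in> closed_segment c y \<longrightarrow> (x, t) \<in> N)"
  shows "connected N"
  unfolding connected_iff_connected_component
proof (intro ballI)
  fix p q assume "p \<in> N" "q \<in> N"
  have 1: "connected_component N (x, y) (x, c)" if "(x, y) \<in> N" for x y
    unfolding connected_component_def
    by (intro exI[of _ "{x} \<times> closed_segment c y"]) (use star[OF that] in \<open>auto intro!: connected_Times\<close>)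
  have 2: "connected_component N (x, c) (x', c)" if "x \<in> J" "x' \<in> J" for x x'
    unfolding connected_component_def
    by (intro exI[of _ "J \<times> {c}"]) (use N J that in \<open>auto intro!: connected_Times\<close>)
  obtain a b a' b' where pq: "p = (a, b)" "q = (a', b')" by force
  then have "a \<in> J" "a' \<in> J" using star \<open>p \<in> N\<close> \<open>q \<in> N\<close> by blast+
  then show "connected_component N p q"
    using 1[of a b] 1[of a' b'] 2[of a a'] pq \<open>p \<in> N\<close> \<open>q \<in> N\<close>
    by (meson connected_component_sym connected_component_trans)
qed

context small_level
begin

section \<open>Vertical slices of the disk and comb-shaped pieces around them\<close>

definition V :: "plane set set" where "V = insert (cls (0, 0)) (cls ` P)"

lemma V_eq: "V = reeb_vertices f \<epsilon>"
  by (simp add: V_def reeb_vertices_def P_eq)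

lemma P_sub: "P \<subseteq> D" by (auto simp: P_def)

lemma in_R:
  assumes "p \<in> D" "cls p \<inter> P = {}" "(0, 0) \<notin> cls p"
  shows "p \<in> D - \<Union>V"
proof -
  have "z \<in> cls p" if "p \<in> cls z" "z \<in> D" for z
    using reeb_class_same[OF that(1)] reeb_class_refl[of z D] that(2) by simp
  then have "p \<notin> cls (0, 0)" "\<And>z. z \<in> P \<Longrightarrow> p \<notin> cls z" using assms zero_D P_sub by blast+
  then show ?thesis using assms(1) by (auto simp: V_def)
qed

lemma R_class:
  assumes "p \<in> D - \<Union>V" shows "cls p \<inter> P = {}" "(0, 0) \<notin> cls p"
proof -
  have "p \<in> cls z" if "z \<in> cls p" for z
    using reeb_class_same[OF that] reeb_class_refl[of p D] assms by simp
  then show "cls p \<inter> P = {}" "(0, 0) \<notin> cls p" using assms by (auto simp: V_def)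
qed

text \<open>A piece of the sublevel set in a product region, defined without reference to
  \<open>D\<close>; that it lies in \<open>D\<close> comes from \<open>strip_piece\<close>.\<close>

definition pc :: "real set \<Rightarrow> real set \<Rightarrow> plane set" where
  "pc J K = {p. fst p \<in> J \<and> snd p \<in> K \<and> f p \<le> \<epsilon>}"

lemma pc_iff [simp]: "(x, y) \<in> pc J K \<longleftrightarrow> x \<in> J \<and> y \<in> K \<and> f (x, y) \<le> \<epsilon>"
  by (simp add: pc_def)

text \<open>The sublevel set over \<open>J\<close> is a comb with spine at height \<open>c\<close>,
  and the anchor \<open>(x0, c)\<close> in \<open>D\<close> lets \<open>grow\<close> place the comb
  in \<open>D\<close>.\<close>

definition strip :: "real set \<Rightarrow> real \<Rightarrow> real \<Rightarrow> real \<Rightarrow> real \<Rightarrow> bool" where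
  "strip J x0 c \<alpha> \<beta> \<longleftrightarrow> connected J \<and> x0 \<in> J \<and> (x0, c) \<in> D \<and> \<alpha> < c \<and> c < \<beta> \<and>
     (\<forall>x\<in>J. f (x, c) \<le> \<epsilon> \<and> (\<forall>y. \<alpha> < y \<longrightarrow> y < \<beta> \<longrightarrow> (x, y) \<in> B \<and>
        (f (x, y) \<le> \<epsilon> \<longrightarrow> (\<forall>t\<in>closed_segment c y. f (x, t) \<le> \<epsilon>))))"

text \<open>No slice of \<open>D\<close> can cross a height at which \<open>f > \<epsilon>\<close>,
  so a capped piece contains whole classes. This is kept apart from \<open>strip\<close> because at
  a saddle the height \<open>y0\<close> is a cap only off the line \<open>x = x0\<close>.\<close>

definition capped :: "real set \<Rightarrow> real \<Rightarrow> real \<Rightarrow> bool" where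
  "capped J \<alpha> \<beta> \<longleftrightarrow> (\<forall>x\<in>J. f (x, \<alpha>) > \<epsilon> \<and> f (x, \<beta>) > \<epsilon>)"

lemma capped_subset: "capped J0 \<alpha> \<beta> \<Longrightarrow> J \<subseteq> J0 \<Longrightarrow> capped J \<alpha> \<beta>"
  unfolding capped_def by (simp add: subset_iff)

text \<open>The comb over \<open>J0\<close> is connected and contains the anchor, so it lies in
  \<open>D\<close>; the caps over the smaller \<open>J\<close> then confine each class to the
  comb.\<close>

lemma strip_piece:
  assumes S: "strip J0 x0 c \<alpha> \<beta>" and J: "connected J" "J \<subseteq> J0" and C: "capped J \<alpha> \<beta>"
  shows "pc J {\<alpha><..<\<beta>} \<subseteq> D" "connected (pc J {\<alpha><..<\<beta>})"
    "\<And>p. p \<in> pc J {\<alpha><..<\<beta>} \<Longrightarrow> pc J {\<alpha><..<\<beta>} \<inter> fst -` {fst p} = cls p"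
    "J \<times> {c} \<subseteq> pc J {\<alpha><..<\<beta>}"
proof -
  have J0: "connected J0" "x0 \<in> J0" and c: "(x0, c) \<in> D" "\<alpha> < c" "c < \<beta>"
    and JB: "\<And>x y. x \<in> J0 \<Longrightarrow> \<alpha> < y \<Longrightarrow> y < \<beta> \<Longrightarrow> (x, y) \<in> B"
    and fc: "\<And>x. x \<in> J0 \<Longrightarrow> f (x, c) \<le> \<epsilon>"
    and star: "\<And>x y t. x \<in> J0 \<Longrightarrow> \<alpha> < y \<Longrightarrow> y < \<beta> \<Longrightarrow> f (x, y) \<le> \<epsilon> \<Longrightarrow> t \<in> closed_segment c y \<Longrightarrow> f (x, t) \<le> \<epsilon>"
    using S unfolding strip_def by blast+
  have top: "\<And>x. x \<in> J \<Longrightarrow> f (x, \<alpha>) > \<epsilon>" "\<And>x. x \<in> J \<Longrightarrow> f (x, \<beta>) > \<epsilon>" using C unfolding capped_def by blast+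
  show "J \<times> {c} \<subseteq> pc J {\<alpha><..<\<beta>}" using c fc J(2) by auto
  have seg: "t \<in> {\<alpha><..<\<beta>}" if "t \<in> closed_segment c y" "y \<in> {\<alpha><..<\<beta>}" for t y
    using that c by (auto simp: closed_segment_eq_real_ivl split: if_splits)
  have conn: "connected (pc J' {\<alpha><..<\<beta>})" if J': "connected J'" "J' \<subseteq> J0" for J'
  proof (rule star_strip_connected[OF J'(1), of c])
    show "(x, c) \<in> pc J' {\<alpha><..<\<beta>}" if "x \<in> J'" for x
      using that c(2,3) fc[of x] J'(2) by auto
    show "x \<in> J' \<and> (t \<in> closed_segment c y \<longrightarrow> (x, t) \<in> pc J' {\<alpha><..<\<beta>})" if "(x, y) \<in> pc J' {\<alpha><..<\<beta>}" for x y t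
    proof -
      have x: "x \<in> J'" "x \<in> J0" "y \<in> {\<alpha><..<\<beta>}" "f (x, y) \<le> \<epsilon>" using that J'(2) by auto
      then show ?thesis using star[of x y t] seg[of t y] by simp
    qed
  qed
  show "connected (pc J {\<alpha><..<\<beta>})" using conn J by blast
  have "pc J0 {\<alpha><..<\<beta>} \<subseteq> D"
  proof (rule grow[OF conn[OF J0(1) order_refl] _ _ c(1)])
    show "(x0, c) \<in> pc J0 {\<alpha><..<\<beta>}" using J0 c fc by simp
    show "pc J0 {\<alpha><..<\<beta>} \<subseteq> B" using JB by (auto simp: pc_def)
  qed (simp add: pc_def)
  then show sub: "pc J {\<alpha><..<\<beta>} \<subseteq> D" using J(2) by (auto simp: pc_def)
  fix p assume p: "p \<in> pc J {\<alpha><..<\<beta>}"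
  obtain x y where xy: "p = (x, y)" by force
  have x: "x \<in> J" "y \<in> {\<alpha><..<\<beta>}" using p xy by auto
  show "pc J {\<alpha><..<\<beta>} \<inter> fst -` {fst p} = cls p"
  proof
    have "pc J {\<alpha><..<\<beta>} \<inter> fst -` {fst p} = pc {x} {\<alpha><..<\<beta>}" using x by (auto simp: xy pc_def)
    then have "connected (pc J {\<alpha><..<\<beta>} \<inter> fst -` {fst p})" using conn[of "{x}"] x J(2) by auto
    then show "pc J {\<alpha><..<\<beta>} \<inter> fst -` {fst p} \<subseteq> cls p"
      by (rule reeb_class_maximal) (use p sub in auto)
    show "cls p \<subseteq> pc J {\<alpha><..<\<beta>} \<inter> fst -` {fst p}"
    proof
      fix q assume q: "q \<in> cls p"
      have fq: "fst q = x" "q \<in> D" using reeb_class_sub[OF q] xy by auto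
      have "p \<in> cls p" using p sub by auto
      have cs: "connected (snd ` cls p)" by (intro connected_continuous_image continuous_on_snd continuous_on_id connected_reeb_class)
      have no: "t \<notin> snd ` cls p" if "f (x, t) > \<epsilon>" for t
      proof
        assume "t \<in> snd ` cls p"
        then obtain w where w: "w \<in> cls p" "snd w = t" by auto
        then have "w = (x, t)" using reeb_class_sub(2)[OF w(1)] xy by (simp add: prod_eq_iff)
        then show False using D_range(2)[OF reeb_class_sub(1)[OF w(1)]] that by simp
      qed
      have yq: "y \<in> snd ` cls p" "snd q \<in> snd ` cls p"
        using imageI[OF \<open>p \<in> cls p\<close>, of snd] imageI[OF q, of snd] xy by simp_all
      have "snd q \<in> {\<alpha><..<\<beta>}"
      proof (rule ccontr)
        assume "snd q \<notin> {\<alpha><..<\<beta>}"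
        then have "\<alpha> \<in> {snd q..y} \<or> \<beta> \<in> {y..snd q}" using x(2) by auto
        then have "\<alpha> \<in> snd ` cls p \<or> \<beta> \<in> snd ` cls p" using connected_contains_Icc[OF cs] yq by blast
        then show False using no top x(1) by blast
      qed
      then show "q \<in> pc J {\<alpha><..<\<beta>} \<inter> fst -` {fst p}"
        using fq x(1) D_range(2)[OF fq(2)] xy by (auto simp: pc_def)
    qed
  qed
qed

text \<open>The direction - \<kappa> decreases \<open>f\<close> to first order. The resulting
  vertical segment prolongs a slice whose end has the wrong sign of \<open>fy\<close>, and it also
  leads from a regular boundary point into the interior of \<open>D\<close>.\<close>

lemma below_end:
  assumes "(x, y) \<in> D" "f (x, y) = \<epsilon>" "\<kappa> = 1 \<or> \<kappa> = -1" "\<kappa> * fy (x, y) > 0"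
  obtains h where "h > 0" "\<And>s. 0 \<le> s \<Longrightarrow> s \<le> h \<Longrightarrow> (x, y + (- \<kappa>) * s) \<in> D"
    "\<And>s. 0 < s \<Longrightarrow> s \<le> h \<Longrightarrow> f (x, y + (- \<kappa>) * s) < \<epsilon>"
proof -
  have "((\<lambda>s. f (x, y + (- \<kappa>) * s)) has_real_derivative (- \<kappa>) * fy (x, y + (- \<kappa>) * 0)) (at 0)" by (rule vertical_DERIV)
  then have "\<exists>d>0. \<forall>h>0. h < d \<longrightarrow> f (x, y + (- \<kappa>) * 0) > f (x, y + (- \<kappa>) * (0 + h))"
    by (rule DERIV_neg_dec_right) (use assms(4) in simp)
  then obtain d where d: "d > 0" "\<And>s. 0 < s \<Longrightarrow> s < d \<Longrightarrow> f (x, y + (- \<kappa>) * s) < \<epsilon>" using assms(2) by auto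
  obtain e where e: "e > 0" "\<And>x' y'. \<bar>x' - x\<bar> \<le> e \<Longrightarrow> \<bar>y' - y\<bar> \<le> e \<Longrightarrow> (x', y') \<in> B"
    using open_contains_box[OF open_B, of x y] assms(1) D_sub_B by blast
  define h where "h = min (d / 2) e"
  have h: "h > 0" "h < d" "h \<le> e" using d e by (auto simp: h_def)
  let ?N = "(\<lambda>s. (x, y + (- \<kappa>) * s)) ` {0..h}"
  have "?N \<subseteq> D"
  proof (rule grow[OF _ _ _ assms(1)])
    show "connected ?N" by (intro connected_continuous_image continuous_intros connected_Icc)
    have "\<bar>(y + (- \<kappa>) * s) - y\<bar> \<le> e" if "s \<in> {0..h}" for s using that h assms(3) by auto
    then show "?N \<subseteq> B" using e by auto
    show "(x, y) \<in> ?N" using h by (auto intro!: image_eqI[of _ _ 0])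
    show "f p \<le> \<epsilon>" if p: "p \<in> ?N" for p
    proof -
      obtain s where s: "p = (x, y + (- \<kappa>) * s)" "s \<in> {0..h}" using p by blast
      then show ?thesis using d(2)[of s] h assms(2) by (cases "s = 0") auto
    qed
  qed
  then show thesis using that[of h] h d by fastforce
qed

text \<open>A value below \<epsilon> at an end would put the end into the interior of
  \<open>D\<close>, and the slice could be prolonged.\<close>

lemma class_interval:
  assumes p: "(x, y) \<in> D"
  obtains a b where "a \<le> y" "y \<le> b" "cls (x, y) = {x} \<times> {a..b}" "f (x, a) = \<epsilon>" "f (x, b) = \<epsilon>"
proof -
  let ?C = "cls (x, y)"
  have "compact (snd ` ?C)" "connected (snd ` ?C)"
    by (intro compact_continuous_image connected_continuous_image continuous_on_snd continuous_on_id connected_reeb_class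
        compact_reeb_class compact_D)+
  then have "\<exists>a b. snd ` ?C = {a..b}" unfolding connected_compact_interval_1[symmetric] by (intro conjI)
  then obtain a b where ab: "snd ` ?C = {a..b}" by (elim exE)
  have "?C = {x} \<times> (snd ` ?C)" using reeb_class_sub(2)[of _ D "(x, y)"] by force
  then have C: "?C = {x} \<times> {a..b}" using ab by simp
  have y: "a \<le> y" "y \<le> b" using reeb_class_refl[of "(x, y)" D] p C by auto
  have CD: "(x, t) \<in> D" if "t \<in> {a..b}" for t using reeb_class_sub(1)[of "(x, t)" D "(x, y)"] C that by auto
  have no: False if meet: "{s..t} \<inter> {a..b} \<noteq> {}" and ns: "\<not> {s..t} \<subseteq> {a..b}" and sub: "\<And>z. z \<in> {s..t} \<Longrightarrow> (x, z) \<in> D" for s t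
  proof -
    obtain z where z: "z \<in> {s..t}" "z \<in> {a..b}" using meet by blast
    have "{x} \<times> {s..t} \<subseteq> cls (x, z)" by (rule reeb_class_maximal) (use z sub in \<open>auto intro!: connected_Times\<close>)
    moreover have "cls (x, z) = ?C" using reeb_class_same[of "(x, z)" D "(x, y)"] C z by auto
    ultimately have "{x} \<times> {s..t} \<subseteq> {x} \<times> {a..b}" using C by simp
    then have "{s..t} \<subseteq> {a..b}" by blast
    then show False using ns by (rule notE[rotated])
  qed
  have ends: "f (x, t) = \<epsilon>" if t: "t = a \<or> t = b" for t
  proof (rule ccontr)
    assume "f (x, t) \<noteq> \<epsilon>"
    moreover have tD: "(x, t) \<in> D" using CD t y by auto
    ultimately have "(x, t) \<in> interior D" using interior_D[OF tD] D_range(2)[OF tD] by simp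
    then obtain e where e: "e > 0" "\<And>x' y'. \<bar>x' - x\<bar> \<le> e \<Longrightarrow> \<bar>y' - t\<bar> \<le> e \<Longrightarrow> (x', y') \<in> interior D"
      using open_contains_box[OF open_interior, of x t] by blast
    have "(x, z) \<in> D" if "z \<in> {t - e..t + e}" for z using e(2)[of x z] e(1) that interior_subset[of D] by auto
    then show False using no[of "t - e" "t + e"] e(1) t y by force
  qed
  show thesis using that[OF y C] ends by blast
qed

text \<open>With the opposite sign of \<open>fy\<close>, \<open>below_end\<close> would prolong the
  slice beyond its end; the value zero would make the end a tangency.\<close>

lemma class_ends:
  assumes C: "cls (x, y) = {x} \<times> {a..b}" "(x, y) \<in> D" "f (x, a) = \<epsilon>" "f (x, b) = \<epsilon>" "a \<le> b"
    and P: "(x, a) \<notin> P" "(x, b) \<notin> P"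
  shows "fy (x, a) < 0" "fy (x, b) > 0" "a < b"
proof -
  have CD: "(x, t) \<in> D" "cls (x, t) = {x} \<times> {a..b}" if "t \<in> {a..b}" for t
    using reeb_class_sub(1)[of "(x, t)" D "(x, y)"] reeb_class_same[of "(x, t)" D "(x, y)"] C that by auto
  have ext: False if k: "\<kappa> = 1 \<or> \<kappa> = -1" "\<kappa> * fy (x, t) > 0" and tk: "t = a \<and> \<kappa> = 1 \<or> t = b \<and> \<kappa> = -1" for \<kappa> t
  proof -
    have t: "t \<in> {a..b}" "f (x, t) = \<epsilon>" using tk C by auto
    obtain h where h: "h > 0" "\<And>s. 0 \<le> s \<Longrightarrow> s \<le> h \<Longrightarrow> (x, t + (- \<kappa>) * s) \<in> D"
      using below_end[OF CD(1)[OF t(1)] t(2) k] by metis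
    let ?N = "(\<lambda>s. (x, t + (- \<kappa>) * s)) ` {0..h}"
    have "?N \<subseteq> cls (x, t)"
    proof (rule reeb_class_maximal)
      show "connected ?N" by (intro connected_continuous_image continuous_intros connected_Icc)
      show "(x, t) \<in> ?N" using h by (auto intro!: image_eqI[of _ _ 0])
    qed (use h in auto)
    moreover have "(x, t + (- \<kappa>) * h) \<in> ?N" using h by auto
    ultimately show False using CD(2)[OF t(1)] tk h(1) by auto
  qed
  have ne: "fy (x, a) \<noteq> 0" "fy (x, b) \<noteq> 0" using P C CD(1)[of a] CD(1)[of b] by (auto simp: P_def)
  show a: "fy (x, a) < 0" using ext[of 1 a] ne by force
  show b: "fy (x, b) > 0" using ext[of "-1" b] ne by force
  show "a < b" using a b C(5) by (cases "a = b") auto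
qed

text \<open>An inner point of value \<epsilon> is a local maximum of \<open>f\<close> along the
  vertical line, so \<open>fy\<close> vanishes there and the point lies in \<open>P\<close>.\<close>

lemma class_inside:
  assumes "(x, t) \<in> D" "cls (x, t) = {x} \<times> {a..b}" "a < t" "t < b" "(x, t) \<notin> P"
  shows "f (x, t) < \<epsilon>"
proof (rule ccontr)
  assume "\<not> f (x, t) < \<epsilon>"
  then have ft: "f (x, t) = \<epsilon>" using D_range(2)[OF assms(1)] by simp
  have "fy (x, t) = 0"
  proof (rule DERIV_local_max[OF poly2_DERIV_y])
    show "0 < min (t - a) (b - t)" using assms by simp
    show "\<forall>y. \<bar>t - y\<bar> < min (t - a) (b - t) \<longrightarrow> f (x, y) \<le> f (x, t)"
    proof clarify
      fix y assume "\<bar>t - y\<bar> < min (t - a) (b - t)"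
      then have "(x, y) \<in> cls (x, t)" using assms(2) by auto
      then show "f (x, y) \<le> f (x, t)" using D_range(2) reeb_class_sub(1) ft by metis
    qed
  qed
  then show False using assms ft by (simp add: P_def)
qed

end

text \<open>A one-sided punctured neighbourhood of \<open>x0\<close>; the sign \<sigma> lets left
  and right share one proof.\<close>

definition side :: "real \<Rightarrow> real \<Rightarrow> real \<Rightarrow> real set" where
  "side x0 \<sigma> \<delta> = {x. \<bar>x - x0\<bar> < \<delta> \<and> \<sigma> * (x - x0) > 0}"

lemma side_cases:
  assumes "\<sigma> = 1 \<or> \<sigma> = -1"
  shows "side x0 \<sigma> \<delta> = (if \<sigma> = 1 then {x0<..<x0 + \<delta>} else {x0 - \<delta><..<x0})"
  using assms by (auto simp: side_def)

lemma side_props: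
  assumes "\<sigma> = 1 \<or> \<sigma> = -1" "\<delta> > 0"
  shows "connected (side x0 \<sigma> \<delta>)" "connected (insert x0 (side x0 \<sigma> \<delta>))" "x0 \<in> closure (side x0 \<sigma> \<delta>)"
    "side x0 \<sigma> \<delta> \<noteq> {}"
proof -
  have "insert x0 (side x0 \<sigma> \<delta>) = (if \<sigma> = 1 then {x0..<x0 + \<delta>} else {x0 - \<delta><..x0})"
    using assms by (auto simp: side_cases)
  then show "connected (insert x0 (side x0 \<sigma> \<delta>))" by simp
  show "connected (side x0 \<sigma> \<delta>)" "x0 \<in> closure (side x0 \<sigma> \<delta>)" "side x0 \<sigma> \<delta> \<noteq> {}"
    using assms by (auto simp: side_cases)
qed

lemma side_exhaust:
  assumes "\<sigma> = 1 \<or> \<sigma> = -1" "\<bar>x - x0\<bar> < \<delta>"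
  shows "x = x0 \<or> x \<in> side x0 \<sigma> \<delta> \<or> x \<in> side x0 (- \<sigma>) \<delta>"
  using assms by (cases x x0 rule: linorder_cases) (auto simp: side_def)

context small_level
begin

section \<open>Germs, stars and tubes from capped strips\<close>

lemma class_strip:
  assumes S: "strip J0 x0 c \<alpha> \<beta>" and C: "capped {x0} \<alpha> \<beta>"
  shows "cls (x0, c) = pc {x0} {\<alpha><..<\<beta>}"
proof -
  have x0: "{x0} \<subseteq> J0" using S by (simp add: strip_def)
  note P = strip_piece[OF S connected_sing x0 C]
  have "pc {x0} {\<alpha><..<\<beta>} \<inter> fst -` {fst (x0, c)} = cls (x0, c)" using P(4) by (intro P(3)) blast
  then show ?thesis by (auto simp: pc_def)
qed

text \<open>Caps make the piece a union of classes, so once it contains neither tangencies nor the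
  origin it avoids all vertices. Its spine accumulates at \<open>(x0, c)\<close>.\<close>

lemma germ:
  assumes S: "strip J0 x0 c \<alpha> \<beta>" and J: "connected J" "J \<subseteq> J0" and C: "capped J \<alpha> \<beta>"
    and noP: "J \<times> {\<alpha><..<\<beta>} \<inter> P = {}"
    and no0: "(0, 0) \<notin> pc J {\<alpha><..<\<beta>}"
  shows "pc J {\<alpha><..<\<beta>} \<subseteq> D - \<Union>V" "\<And>p. p \<in> pc J {\<alpha><..<\<beta>} \<Longrightarrow> cls p \<subseteq> pc J {\<alpha><..<\<beta>}"
    "x0 \<in> closure J \<Longrightarrow> (x0, c) \<in> closure (pc J {\<alpha><..<\<beta>})"
proof -
  let ?N = "pc J {\<alpha><..<\<beta>}"
  note pcs = strip_piece[OF S J C]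
  show sat: "cls p \<subseteq> ?N" if "p \<in> ?N" for p using pcs(3)[OF that] by blast
  show "?N \<subseteq> D - \<Union>V"
  proof
    fix p assume p: "p \<in> ?N"
    have "?N \<subseteq> J \<times> {\<alpha><..<\<beta>}" by (auto simp: pc_def)
    then have "?N \<inter> P = {}" using noP by blast
    then show "p \<in> D - \<Union>V" using sat[OF p] no0 pcs(1) p by (intro in_R) auto
  qed
  assume "x0 \<in> closure J"
  then have "(x0, c) \<in> closure (J \<times> {c})" by (simp add: closure_Times)
  then show "(x0, c) \<in> closure ?N" using closure_mono[OF pcs(4)] by blast
qed

lemma fst_piece:
  assumes "strip J0 x0 c \<alpha> \<beta>" "connected J" "J \<subseteq> J0" "capped J \<alpha> \<beta>"
  shows "J \<subseteq> fst ` pc J {\<alpha><..<\<beta>}"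
proof
  fix x assume "x \<in> J"
  then have "(x, c) \<in> pc J {\<alpha><..<\<beta>}" using strip_piece(4)[OF assms] by blast
  then show "x \<in> fst ` pc J {\<alpha><..<\<beta>}" by (rule image_eqI[rotated]) simp
qed

text \<open>Each germ covers a full one-sided neighbourhood of \<open>fst z\<close>, hence one of
  the abscissae at distance \<open>\<delta> / 2\<close>. Two germs on the same side share this
  abscissa, and two on opposite sides have \<open>cls z\<close> between them.\<close>

lemma is_starI:
  assumes z: "z \<in> D" and fin: "finite \<N>" "disjoint \<N>" and W: "open W" "cls z \<subseteq> W" "\<Union>\<N> = D \<inter> W - cls z"
    and \<delta>: "\<delta> > 0"
    and N: "\<And>N. N \<in> \<N> \<Longrightarrow> N \<subseteq> D - \<Union>V" "\<And>N. N \<in> \<N> \<Longrightarrow> connected N"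
      "\<And>N p. N \<in> \<N> \<Longrightarrow> p \<in> N \<Longrightarrow> cls p \<subseteq> N" "\<And>N. N \<in> \<N> \<Longrightarrow> closure N \<inter> cls z \<noteq> {}"
      "\<And>N. N \<in> \<N> \<Longrightarrow> side (fst z) 1 \<delta> \<subseteq> fst ` N \<or> side (fst z) (-1) \<delta> \<subseteq> fst ` N"
  shows "is_star D (D - \<Union>V) (cls z) \<N>"
  unfolding is_star_def
proof (intro conjI ballI)
  have pts: "fst z + \<delta> / 2 \<in> side (fst z) 1 \<delta>" "fst z - \<delta> / 2 \<in> side (fst z) (-1) \<delta>"
    using \<delta> by (auto simp: side_def)
  have side: "fst z + \<delta> / 2 \<in> fst ` N \<or> fst z - \<delta> / 2 \<in> fst ` N" if "N \<in> \<N>" for N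
    using N(5)[OF that] pts by blast
  show "\<exists>W. open W \<and> cls z \<subseteq> W \<and> \<Union>\<N> = D \<inter> W - cls z" using W by blast
  show "finite \<N>" "disjoint \<N>" by fact+
  show "\<Union>\<N> \<subseteq> D - \<Union>V" using N(1) by (rule Union_least)
  fix N assume n: "N \<in> \<N>"
  show "connected N" "closure N \<inter> cls z \<noteq> {}" using N n by blast+
  show "N \<noteq> {}" using side[OF n] by blast
  show "cls p \<subseteq> N" if "p \<in> N" for p using N(3)[OF n that] .
  fix N' assume n': "N' \<in> \<N>"
  have q: "fst q = fst z" if "q \<in> cls z" for q using reeb_class_sub(2)[OF that] .
  have ord: "\<exists>p\<in>M. \<exists>p'\<in>M'. \<forall>q\<in>cls z. fst p < fst q \<and> fst q < fst p'"
    if MM: "fst z - \<delta> / 2 \<in> fst ` M" "fst z + \<delta> / 2 \<in> fst ` M'" for M M'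
  proof -
    obtain p p' where "p \<in> M" "p' \<in> M'" "fst p = fst z - \<delta> / 2" "fst p' = fst z + \<delta> / 2" using MM by force
    then show ?thesis using q \<delta> by (intro bexI[of _ p] bexI[of _ p']) auto
  qed
  have same: "\<exists>p\<in>N. \<exists>p'\<in>N'. fst p = fst p'" if xx: "x \<in> fst ` N" "x \<in> fst ` N'" for x
  proof -
    obtain p p' where "p \<in> N" "p' \<in> N'" "fst p = x" "fst p' = x" using xx by force
    then show ?thesis by (intro bexI[of _ p] bexI[of _ p']) simp_all
  qed
  show "(\<exists>p\<in>N. \<exists>p'\<in>N'. fst p = fst p') \<or>
        (\<exists>p\<in>N. \<exists>p'\<in>N'. \<forall>q\<in>cls z. fst p < fst q \<and> fst q < fst p') \<or>
        (\<exists>p\<in>N. \<exists>p'\<in>N'. \<forall>q\<in>cls z. fst p' < fst q \<and> fst q < fst p)"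
    using side[OF n] side[OF n']
  proof (elim disjE)
    assume "fst z + \<delta> / 2 \<in> fst ` N" "fst z - \<delta> / 2 \<in> fst ` N'"
    from ord[OF this(2,1)] show ?thesis by (intro disjI2) blast
  next
    assume "fst z - \<delta> / 2 \<in> fst ` N" "fst z + \<delta> / 2 \<in> fst ` N'"
    from ord[OF this] show ?thesis by (intro disjI2 disjI1)
  qed (auto intro!: disjI1 same)
qed

text \<open>A class without tangencies is a segment with \<open>f < \<epsilon>\<close> inside and
  transversal ends. One arm upwards and one downwards from its midpoint \<open>c\<close> make up the
  strip, and the values beyond the ends are its caps.\<close>

lemma good_box:
  assumes p: "p \<in> D" "cls p \<inter> P = {}" and U: "open U" "cls p \<subseteq> U"
  obtains \<delta> c \<alpha> \<beta> where "\<delta> > 0" "(fst p, c) \<in> cls p"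
    "strip {fst p - \<delta>..fst p + \<delta>} (fst p) c \<alpha> \<beta>" "capped {fst p - \<delta>..fst p + \<delta>} \<alpha> \<beta>"
    "\<And>x y. x \<in> {fst p - \<delta>..fst p + \<delta>} \<Longrightarrow> \<alpha> < y \<Longrightarrow> y < \<beta> \<Longrightarrow> (x, y) \<in> U \<and> (x, y) \<notin> P"
proof -
  obtain x0 y where xy: "p = (x0, y)" by force
  obtain a b where ab: "a \<le> y" "y \<le> b" "cls p = {x0} \<times> {a..b}" "f (x0, a) = \<epsilon>" "f (x0, b) = \<epsilon>"
    using class_interval[of x0 y] p(1) xy by metis
  have mem: "(x0, t) \<in> cls p" if "t \<in> {a..b}" for t using ab(3) that by simp
  have noP: "(x0, t) \<notin> P" if "t \<in> {a..b}" for t using mem[OF that] p(2) by blast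
  note ends = class_ends[of x0 y a b, folded xy, OF ab(3) p(1) ab(4,5) _ noP noP]
  have "a \<le> b" using ab by simp
  then have e: "fy (x0, a) < 0" "fy (x0, b) > 0" "a < b" using ends by simp_all
  have inside: "f (x0, t) < \<epsilon>" if "a < t" "t < b" for t
    by (rule class_inside[of x0 t a b]) (use that mem[of t] noP[of t] reeb_class_sub(1)[of "(x0, t)" D p] reeb_class_same[of "(x0, t)" D p] ab(3) in auto)
  define c L where "c = (a + b) / 2" and "L = (b - a) / 2"
  have cL: "c + 1 * L = b" "c + (- 1) * L = a" "L > 0" using e(3) by (auto simp: c_def L_def field_simps)
  have UB: "open (U \<inter> B)" using U open_B by blast
  have clsU: "(x0, t) \<in> U \<inter> B" if "t \<in> {a..b}" for t
    using mem[OF that] U(2) reeb_class_sub(1)[of "(x0, t)" D p] D_sub_B by blast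
  have armf: "f (x0, c + 1 * L) = \<epsilon>" "1 * fy (x0, c + 1 * L) > 0" "f (x0, c + (-1) * L) = \<epsilon>" "(-1) * fy (x0, c + (-1) * L) > 0"
    unfolding cL(1,2) using ab(4,5) e by simp_all
  have armi: "f (x0, c + 1 * s) < \<epsilon>" "f (x0, c + (-1) * s) < \<epsilon>" if "0 \<le> s" "s < L" for s
    using that cL by (auto intro!: inside)
  have armU: "(x0, c + 1 * s) \<in> U \<inter> B" "(x0, c + (-1) * s) \<in> U \<inter> B" if "0 \<le> s" "s \<le> L" for s
  proof -
    have "c + 1 * s \<in> {a..b}" "c + (-1) * s \<in> {a..b}" using that cL by auto
    from clsU[OF this(1)] clsU[OF this(2)]
    show "(x0, c + 1 * s) \<in> U \<inter> B" "(x0, c + (-1) * s) \<in> U \<inter> B" .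
  qed
  obtain S1 \<delta>1 where "is_arm F \<epsilon> (U \<inter> B) x0 c 1 S1 \<delta>1"
    using arm[of 1 L F x0 c \<epsilon> "U \<inter> B", OF disjI1[OF refl] cL(3) armf(1,2) armi(1) UB armU(1)] by blast
  note up = is_armD[OF this]
  obtain S2 \<delta>2 where "is_arm F \<epsilon> (U \<inter> B) x0 c (-1) S2 \<delta>2"
    using arm[of "-1" L F x0 c \<epsilon> "U \<inter> B", OF disjI2[OF refl] cL(3) armf(3,4) armi(2) UB armU(2)] by blast
  note dn = is_armD[OF this]
  define \<delta> where "\<delta> = min \<delta>1 \<delta>2"
  let ?J = "{fst p - \<delta>..fst p + \<delta>}"
  have near: "\<bar>x - x0\<bar> \<le> \<delta>1" "\<bar>x - x0\<bar> \<le> \<delta>2" if "x \<in> ?J" for x using that by (auto simp: xy \<delta>_def)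
  have star: "f (x, t) \<le> \<epsilon>"
    if x: "x \<in> ?J" and y: "c - S2 < y" "y < c + S1" "f (x, y) \<le> \<epsilon>" and t: "t \<in> closed_segment c y" for x y t
  proof (cases "c \<le> y")
    case True
    then show ?thesis using up(7)[OF near(1)[OF x], of "t - c" "y - c"] y t by (auto simp: closed_segment_eq_real_ivl)
  next
    case False
    then show ?thesis using dn(7)[OF near(2)[OF x], of "c - t" "c - y"] y t by (auto simp: closed_segment_eq_real_ivl)
  qed
  have UBP: "(x, y) \<in> U \<inter> B" "(x, y) \<notin> P" if x: "x \<in> ?J" and y: "c - S2 < y" "y < c + S1" for x y
    using up(5,6)[OF near(1)[OF x], of "y - c"] dn(5,6)[OF near(2)[OF x], of "c - y"] y
    by (cases "c \<le> y"; simp add: P_def)+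
  have cmem: "(fst p, c) \<in> cls p" using mem[of c] e(3) xy by (simp add: c_def)
  show thesis
  proof (rule that[of \<delta> c "c - S2" "c + S1"])
    show "\<delta> > 0" using up(2) dn(2) by (simp add: \<delta>_def)
    then show "strip ?J (fst p) c (c - S2) (c + S1)"
      unfolding strip_def using reeb_class_sub(1)[OF cmem] cL(3) up(1) dn(1) star UBP(1) up(4)[OF near(1)]
      by (auto intro: less_imp_le)
    show "capped ?J (c - S2) (c + S1)" unfolding capped_def using up(3)[OF near(1)] dn(3)[OF near(2)] by simp
  qed (use cmem UBP in auto)
qed

lemma P_fst_nonzero: "z \<in> P \<Longrightarrow> fst z \<noteq> 0"
proof
  assume z: "z \<in> P" "fst z = 0"
  then obtain y where y: "z = (0, y)" by (cases z) auto
  have "z \<in> B" using z(1) P_sub D_sub_B by blast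
  then show False using y0[of y] z P_nonzero[OF z(1)] y by (auto simp: B_abs P_def)
qed

text \<open>Over \<open>x = 0\<close> the derivative \<open>fy\<close> vanishes at most at the
  origin, which is not on the level curve. The root class thus has a good box, which the class cuts
  into a left and a right germ.\<close>

lemma root_star: "\<exists>\<N>. is_star D (D - \<Union>V) (cls (0, 0)) \<N> \<and> card \<N> = 2"
proof -
  have noP: "cls (0, 0) \<inter> P = {}" using P_fst_nonzero reeb_class_sub(2)[of _ D "(0, 0)"] by fastforce
  obtain \<delta> c \<alpha> \<beta> where box0: "\<delta> > 0" "(0, c) \<in> cls (0, 0)"
    "strip {0 - \<delta>..0 + \<delta>} 0 c \<alpha> \<beta>" "capped {0 - \<delta>..0 + \<delta>} \<alpha> \<beta>"
    "\<And>x y. x \<in> {0 - \<delta>..0 + \<delta>} \<Longrightarrow> \<alpha> < y \<Longrightarrow> y < \<beta> \<Longrightarrow> (x, y) \<in> UNIV \<and> (x, y) \<notin> P"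
    by (fact good_box[OF zero_D noP open_UNIV subset_UNIV, unfolded fst_conv])
  note box = box0(1-4)[unfolded diff_0 add_0] box0(5)[unfolded diff_0 add_0, THEN conjunct2]
  let ?K = "{\<alpha><..<\<beta>}"
  let ?N = "\<lambda>\<sigma>. pc (side 0 \<sigma> \<delta>) ?K"
  have sub: "side 0 \<sigma> \<delta> \<subseteq> {-\<delta>..\<delta>}" for \<sigma> by (auto simp: side_def)
  have g: "?N \<sigma> \<subseteq> D - \<Union>V" "connected (?N \<sigma>)" "\<And>p. p \<in> ?N \<sigma> \<Longrightarrow> cls p \<subseteq> ?N \<sigma>"
    "side 0 \<sigma> \<delta> \<subseteq> fst ` ?N \<sigma>" "(0, c) \<in> closure (?N \<sigma>)" if \<sigma>: "\<sigma> = 1 \<or> \<sigma> = -1" for \<sigma>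
  proof -
    have C: "capped (side 0 \<sigma> \<delta>) \<alpha> \<beta>" using box(4) sub by (rule capped_subset)
    note S = box(3) side_props(1)[OF \<sigma> box(1)] sub C
    have no0: "(0, 0) \<notin> ?N \<sigma>" by (simp add: side_def)
    have np: "side 0 \<sigma> \<delta> \<times> ?K \<inter> P = {}" using box(5) sub[of \<sigma>] by fastforce
    show "?N \<sigma> \<subseteq> D - \<Union>V" "\<And>p. p \<in> ?N \<sigma> \<Longrightarrow> cls p \<subseteq> ?N \<sigma>" "(0, c) \<in> closure (?N \<sigma>)"
      using germ[OF S np no0] side_props(3)[OF \<sigma> box(1)] by blast+
    show "connected (?N \<sigma>)" by (rule strip_piece(2)[OF S])
    show "side 0 \<sigma> \<delta> \<subseteq> fst ` ?N \<sigma>" by (rule fst_piece[OF S])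
  qed
  have "capped {0} \<alpha> \<beta>" using box(1,4) by (auto intro: capped_subset)
  from class_strip[OF box(3) this] have u: "cls (0, 0) = pc {0} ?K"
    using reeb_class_same[OF box(2)] by simp
  have ne: "?N 1 \<noteq> ?N (-1)" "?N 1 \<inter> ?N (-1) = {}"
  proof -
    show 1: "?N 1 \<inter> ?N (-1) = {}" by (auto simp: pc_def side_def)
    have "?N 1 \<noteq> {}" using g(4)[of 1] side_props(4)[of 1 \<delta> 0] box(1) by auto
    then show "?N 1 \<noteq> ?N (-1)" using 1 by auto
  qed
  have "is_star D (D - \<Union>V) (cls (0, 0)) {?N 1, ?N (-1)}"
  proof (rule is_starI[OF zero_D, of _ "{- \<delta><..<\<delta>} \<times> ?K" \<delta>])
    show "disjoint {?N 1, ?N (-1)}" using ne by (auto simp: disjoint_def)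
    show "open ({- \<delta><..<\<delta>} \<times> ?K)" by (simp add: open_Times)
    show "cls (0, 0) \<subseteq> {- \<delta><..<\<delta>} \<times> ?K" unfolding u using box(1) by (auto simp: pc_def)
    show "\<Union>{?N 1, ?N (-1)} = D \<inter> ({- \<delta><..<\<delta>} \<times> ?K) - cls (0, 0)"
    proof
      show "\<Union>{?N 1, ?N (-1)} \<subseteq> D \<inter> ({- \<delta><..<\<delta>} \<times> ?K) - cls (0, 0)"
        using g(1)[of 1] g(1)[of "-1"] unfolding u by (auto simp: pc_def side_def)
      show "D \<inter> ({- \<delta><..<\<delta>} \<times> ?K) - cls (0, 0) \<subseteq> \<Union>{?N 1, ?N (-1)}"
        unfolding u using D_range(2) by (auto simp: side_def)
    qed
    fix N assume "N \<in> {?N 1, ?N (-1)}"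
    then obtain \<sigma> where \<sigma>: "\<sigma> = 1 \<or> \<sigma> = -1" "N = ?N \<sigma>" by blast
    show "N \<subseteq> D - \<Union>V" "connected N" "\<And>p. p \<in> N \<Longrightarrow> cls p \<subseteq> N" "closure N \<inter> cls (0, 0) \<noteq> {}"
      using g[OF \<sigma>(1)] box(2) unfolding \<sigma>(2) by blast+
    show "side (fst (0, 0)) 1 \<delta> \<subseteq> fst ` N \<or> side (fst (0, 0)) (- 1) \<delta> \<subseteq> fst ` N"
      using g(4)[OF \<sigma>(1)] \<sigma> by auto
  qed (use box(1) in simp_all)
  moreover have "card {?N 1, ?N (-1)} = 2" using ne by simp
  ultimately show ?thesis by blast
qed

lemma regular_tube:
  assumes p: "p \<in> D - \<Union>V" and U: "open U" "cls p \<subseteq> U"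
  shows "\<exists>N\<subseteq>U. p \<in> N \<and> is_tube D (D - \<Union>V) N"
proof -
  \<comment> \<open>Removing the root class keeps the origin out of the tube; tangencies are kept
    out by \<open>good_box\<close>.\<close>
  let ?U = "U - cls (0, 0)"
  have "cls p \<inter> cls (0, 0) = {}" using p reeb_class_cases[of D p "(0, 0)"] reeb_class_refl[of p D] by (auto simp: V_def)
  then have U': "open ?U" "cls p \<subseteq> ?U" using U compact_imp_closed[OF compact_reeb_class[OF compact_D]] by (auto intro: open_Diff)
  have pD: "p \<in> D" using p by blast
  obtain \<delta> c \<alpha> \<beta> where box: "\<delta> > 0" "(fst p, c) \<in> cls p"
    "strip {fst p - \<delta>..fst p + \<delta>} (fst p) c \<alpha> \<beta>" "capped {fst p - \<delta>..fst p + \<delta>} \<alpha> \<beta>"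
    "\<And>x y. x \<in> {fst p - \<delta>..fst p + \<delta>} \<Longrightarrow> \<alpha> < y \<Longrightarrow> y < \<beta> \<Longrightarrow> (x, y) \<in> ?U \<and> (x, y) \<notin> P"
    by (fact good_box[OF pD R_class(1)[OF p] U'])
  let ?J = "{fst p - \<delta><..<fst p + \<delta>}"
  let ?N = "pc ?J {\<alpha><..<\<beta>}"
  have sub: "?J \<subseteq> {fst p - \<delta>..fst p + \<delta>}" by auto
  have x0: "fst p \<in> ?J" using box(1) by simp
  have NU: "?N \<subseteq> ?U" using box(5) sub by (auto simp: pc_def)
  then have no0: "(0, 0) \<notin> ?N" using reeb_class_refl[of "(0, 0)" D] zero_D by blast
  have cJ: "connected ?J" by simp
  note S = box(3) cJ sub capped_subset[OF box(4) sub]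
  have np: "?J \<times> {\<alpha><..<\<beta>} \<inter> P = {}" using box(5) sub by fastforce
  note G = germ[OF S np no0]
  note pcs = strip_piece[OF S]
  have "?N = D \<inter> (?J \<times> {\<alpha><..<\<beta>})" using pcs(1) D_range(2) by (auto simp: pc_def)
  moreover have "openin (top_of_set D) (D \<inter> (?J \<times> {\<alpha><..<\<beta>}))"
    by (intro openin_open_Int open_Times open_greaterThanLessThan)
  ultimately have "openin (top_of_set D) ?N" by (simp only:)
  then have "is_tube D (D - \<Union>V) ?N" unfolding is_tube_def using G(1) pcs(2,3) by blast
  moreover have "p \<in> ?N"
  proof -
    have "(fst p, c) \<in> ?N" using x0 pcs(4) by blast
    then have "cls (fst p, c) \<subseteq> ?N" by (rule G(2))
    then show ?thesis using reeb_class_same[OF box(2)] reeb_class_refl[of p D] pD by blast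
  qed
  ultimately show ?thesis using NU by blast
qed

lemma interior_point_nearby:
  assumes p: "p \<in> D - \<Union>V" and U: "open U" "p \<in> U"
  shows "\<exists>z\<in>U \<inter> interior D. fst z = fst p"
proof (cases "f p = \<epsilon>")
  case False
  then have "p \<in> interior D" using interior_D[of p] D_range(2)[of p] p by auto
  then show ?thesis using U by blast
next
  case True
  obtain x y where xy: "p = (x, y)" by force
  have "p \<notin> P" using R_class(1)[OF p] reeb_class_refl[of p D] p by blast
  then have ne: "fy (x, y) \<noteq> 0" using True p xy by (simp add: P_def)
  define \<kappa> :: real where "\<kappa> = (if fy (x, y) > 0 then 1 else -1)"
  have \<kappa>: "\<kappa> = 1 \<or> \<kappa> = -1" "\<kappa> * fy (x, y) > 0" using ne by (auto simp: \<kappa>_def)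
  obtain h where h: "h > 0" "\<And>s. 0 \<le> s \<Longrightarrow> s \<le> h \<Longrightarrow> (x, y + (- \<kappa>) * s) \<in> D"
    "\<And>s. 0 < s \<Longrightarrow> s \<le> h \<Longrightarrow> f (x, y + (- \<kappa>) * s) < \<epsilon>"
    using below_end[of x y \<kappa>] p True xy \<kappa> by blast
  obtain e where e: "e > 0" "\<And>x' y'. \<bar>x' - x\<bar> \<le> e \<Longrightarrow> \<bar>y' - y\<bar> \<le> e \<Longrightarrow> (x', y') \<in> U"
    using open_contains_box[OF U(1), of x y] U(2) xy by blast
  define s where "s = min h e"
  have s: "s > 0" "s \<le> h" "s \<le> e" using h e by (auto simp: s_def)
  let ?z = "(x, y + (- \<kappa>) * s)"
  have "?z \<in> interior D" using s h by (intro interior_D) auto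
  moreover have "?z \<in> U" using s \<kappa>(1) by (intro e(2)) auto
  ultimately show ?thesis using xy by (intro bexI[of _ ?z]) auto
qed

text \<open>\<sigma> is the sign of \<open>fx\<close>, the horizontal direction in which
  \<open>f\<close> grows. Passing to \<open>G\<close>, which is \<open>F\<close> multiplied by the
  sign \<tau> of \<open>fyy\<close>, covers vertical minima and vertical maxima at once.\<close>

lemma tangency_box:
  assumes z: "(x0, y0) \<in> P" and \<tau>: "\<tau> = 1 \<or> \<tau> = -1" "\<tau> * fyy (x0, y0) > 0"
  obtains \<sigma> \<rho> where "\<sigma> = 1 \<or> \<sigma> = -1" "- \<sigma> = 1 \<or> - \<sigma> = -1" "\<rho> > 0"
    "\<And>x y. \<bar>x - x0\<bar> \<le> \<rho> \<Longrightarrow> \<bar>y - y0\<bar> \<le> \<rho> \<Longrightarrow> (x, y) \<in> B \<and> x \<noteq> 0"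
    "\<And>x1 x2 y. \<bar>x1 - x0\<bar> \<le> \<rho> \<Longrightarrow> \<bar>x2 - x0\<bar> \<le> \<rho> \<Longrightarrow> \<bar>y - y0\<bar> \<le> \<rho> \<Longrightarrow> \<sigma> * (x2 - x1) > 0 \<Longrightarrow>
      f (x1, y) < f (x2, y)"
    "\<And>x s t. \<bar>x - x0\<bar> \<le> \<rho> \<Longrightarrow> \<bar>s - y0\<bar> \<le> \<rho> \<Longrightarrow> \<bar>t - y0\<bar> \<le> \<rho> \<Longrightarrow> fy (x, s) = 0 \<Longrightarrow> t \<noteq> s \<Longrightarrow>
      \<tau> * f (x, s) < \<tau> * f (x, t)"
    "\<And>x s t w. \<bar>x - x0\<bar> \<le> \<rho> \<Longrightarrow> \<bar>s - y0\<bar> \<le> \<rho> \<Longrightarrow> \<bar>w - y0\<bar> \<le> \<rho> \<Longrightarrow> s < t \<Longrightarrow> t < w \<Longrightarrow>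
      \<tau> * f (x, t) < max (\<tau> * f (x, s)) (\<tau> * f (x, w))"
proof -
  define \<sigma> :: real where "\<sigma> = sgn (fx (x0, y0))"
  have \<sigma>: "\<sigma> = 1 \<or> \<sigma> = -1" "- \<sigma> = 1 \<or> - \<sigma> = -1" "\<sigma> * fx (x0, y0) > 0" using P_fx[OF z] by (auto simp: \<sigma>_def sgn_if)
  define G where "G = (if \<tau> = 1 then F else - F)"
  have G: "poly2 G p = \<tau> * f p" "poly2 (pderiv G) p = \<tau> * fy p" "poly2 (pderiv (pderiv G)) p = \<tau> * fyy p" for p
    using \<tau>(1) by (auto simp: G_def pderiv_minus)
  let ?T = "B \<inter> {p. fst p \<noteq> 0} \<inter> {p. \<sigma> * fx p > 0} \<inter> {p. \<tau> * fyy p > 0}"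
  have "open ?T"
    by (intro open_Int open_B open_Collect_less open_Collect_neq continuous_intros continuous_on_fst continuous_on_id)
  moreover have "(x0, y0) \<in> ?T" using z \<sigma>(3) \<tau>(2) P_fst_nonzero[OF z] P_sub D_sub_B by auto
  ultimately obtain \<rho> where \<rho>: "\<rho> > 0" "\<And>x y. \<bar>x - x0\<bar> \<le> \<rho> \<Longrightarrow> \<bar>y - y0\<bar> \<le> \<rho> \<Longrightarrow> (x, y) \<in> ?T"
    using open_contains_box by blast
  have seg: "\<bar>w - a\<bar> \<le> \<rho>" if "w \<in> closed_segment y t" "\<bar>y - a\<bar> \<le> \<rho>" "\<bar>t - a\<bar> \<le> \<rho>" for w y t a
    using that by (auto simp: closed_segment_eq_real_ivl split: if_splits)
  show thesis
  proof (rule that[OF \<sigma>(1,2) \<rho>(1)])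
    show "(x, y) \<in> B \<and> x \<noteq> 0" if "\<bar>x - x0\<bar> \<le> \<rho>" "\<bar>y - y0\<bar> \<le> \<rho>" for x y using \<rho>(2)[OF that] by simp
    show "f (x1, y) < f (x2, y)" if "\<bar>x1 - x0\<bar> \<le> \<rho>" "\<bar>x2 - x0\<bar> \<le> \<rho>" "\<bar>y - y0\<bar> \<le> \<rho>" "\<sigma> * (x2 - x1) > 0" for x1 x2 y
      by (rule horizontal_mono[OF _ \<sigma>(1) that(4)]) (use that \<rho>(2)[of _ y] seg[of _ x1 x2 x0] in simp)
    show "\<tau> * f (x, s) < \<tau> * f (x, t)"
      if "\<bar>x - x0\<bar> \<le> \<rho>" "\<bar>s - y0\<bar> \<le> \<rho>" "\<bar>t - y0\<bar> \<le> \<rho>" "fy (x, s) = 0" "t \<noteq> s" for x s t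
      unfolding G(1)[symmetric] by (rule strict_min_on_vertical[OF _ _ that(5)]) (use that \<rho>(2)[of x] seg[of _ s t y0] in \<open>simp_all add: G\<close>)
    show "\<tau> * f (x, t) < max (\<tau> * f (x, s)) (\<tau> * f (x, w))"
      if "\<bar>x - x0\<bar> \<le> \<rho>" "\<bar>s - y0\<bar> \<le> \<rho>" "\<bar>w - y0\<bar> \<le> \<rho>" "s < t" "t < w" for x s t w
      unfolding G(1)[symmetric] by (rule convex_on_vertical[OF _ that(4,5)]) (use that \<rho>(2)[of x] in \<open>simp add: G\<close>)
  qed
qed

lemma near_greater:
  assumes "f (x0, y) > \<epsilon>"
  obtains \<delta> where "\<delta> > 0" "\<And>x. \<bar>x - x0\<bar> \<le> \<delta> \<Longrightarrow> f (x, y) > \<epsilon>"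
proof -
  obtain \<delta> where "\<delta> > 0" "\<And>x y'. \<bar>x - x0\<bar> \<le> \<delta> \<Longrightarrow> \<bar>y' - y\<bar> \<le> \<delta> \<Longrightarrow> (x, y') \<in> {z. \<epsilon> < f z}"
    using open_contains_box[OF open_poly2_less(1)[of \<epsilon> F], of x0 y] assms by blast
  then show thesis using that[of \<delta>] by auto
qed

text \<open>Along \<open>x = x0\<close> the function has a strict local minimum of value \<epsilon>
  at \<open>y0\<close>, so the class is a single point. Towards \<sigma> the values exceed
  \<epsilon>, and towards - \<sigma> they allow one interval around \<open>y0\<close>: there is one
  germ.\<close>

lemma leaf_star:
  assumes z: "(x0, y0) \<in> P" and fyy: "fyy (x0, y0) > 0"
  shows "\<exists>\<N>. is_star D (D - \<Union>V) (cls (x0, y0)) \<N> \<and> card \<N> = 1" "\<exists>W. open W \<and> (x0, y0) \<in> W \<and> W \<inter> P \<subseteq> {(x0, y0)}"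
proof -
  have zP: "(x0, y0) \<in> D" "f (x0, y0) = \<epsilon>" "fy (x0, y0) = 0" using z by (auto simp: P_def)
  obtain \<sigma> \<rho> where \<sigma>: "\<sigma> = 1 \<or> \<sigma> = -1" "- \<sigma> = 1 \<or> - \<sigma> = -1" and \<rho>: "\<rho> > 0"
      "\<And>x y. \<bar>x - x0\<bar> \<le> \<rho> \<Longrightarrow> \<bar>y - y0\<bar> \<le> \<rho> \<Longrightarrow> (x, y) \<in> B \<and> x \<noteq> 0"
    and H: "\<And>x1 x2 y. \<bar>x1 - x0\<bar> \<le> \<rho> \<Longrightarrow> \<bar>x2 - x0\<bar> \<le> \<rho> \<Longrightarrow> \<bar>y - y0\<bar> \<le> \<rho> \<Longrightarrow> \<sigma> * (x2 - x1) > 0 \<Longrightarrow>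
      f (x1, y) < f (x2, y)"
    and M: "\<And>x s t. \<bar>x - x0\<bar> \<le> \<rho> \<Longrightarrow> \<bar>s - y0\<bar> \<le> \<rho> \<Longrightarrow> \<bar>t - y0\<bar> \<le> \<rho> \<Longrightarrow> fy (x, s) = 0 \<Longrightarrow> t \<noteq> s \<Longrightarrow> f (x, s) < f (x, t)"
    and conv: "\<And>x s t w. \<bar>x - x0\<bar> \<le> \<rho> \<Longrightarrow> \<bar>s - y0\<bar> \<le> \<rho> \<Longrightarrow> \<bar>w - y0\<bar> \<le> \<rho> \<Longrightarrow> s < t \<Longrightarrow> t < w \<Longrightarrow>
      f (x, t) < max (f (x, s)) (f (x, w))"
    using tangency_box[OF z, of 1, unfolded mult_1, OF disjI1[OF refl] fyy] by blast
  define \<alpha> \<beta> where "\<alpha> = y0 - \<rho>" and "\<beta> = y0 + \<rho>"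
  let ?K = "{\<alpha><..<\<beta>}"
  have K: "\<bar>y - y0\<bar> \<le> \<rho> \<longleftrightarrow> \<alpha> \<le> y \<and> y \<le> \<beta>" for y by (auto simp: \<alpha>_def \<beta>_def)
  have x0ge: "f (x0, y) \<ge> \<epsilon>" if "\<bar>y - y0\<bar> \<le> \<rho>" for y
    using M[of x0 y0 y] that zP \<rho>(1) by (cases "y = y0") auto
  have "f (x0, \<alpha>) > \<epsilon>" "f (x0, \<beta>) > \<epsilon>" using M[of x0 y0 \<alpha>] M[of x0 y0 \<beta>] zP \<rho>(1) by (auto simp: \<alpha>_def \<beta>_def)
  then obtain \<delta>1 \<delta>2 where \<delta>12: "\<delta>1 > 0" "\<And>x. \<bar>x - x0\<bar> \<le> \<delta>1 \<Longrightarrow> f (x, \<alpha>) > \<epsilon>" "\<delta>2 > 0" "\<And>x. \<bar>x - x0\<bar> \<le> \<delta>2 \<Longrightarrow> f (x, \<beta>) > \<epsilon>"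
    using near_greater by metis
  define \<delta> where "\<delta> = min \<rho> (min \<delta>1 \<delta>2)"
  have \<delta>: "\<delta> > 0" "\<delta> \<le> \<rho>" "\<delta> \<le> \<delta>1" "\<delta> \<le> \<delta>2" using \<rho>(1) \<delta>12 by (auto simp: \<delta>_def)
  let ?S = "side x0 (- \<sigma>) \<delta>"
  let ?J = "insert x0 ?S"
  let ?N = "pc ?S ?K"
  have le: "\<bar>x - x0\<bar> \<le> \<rho>" "\<bar>x - x0\<bar> \<le> \<delta>1" "\<bar>x - x0\<bar> \<le> \<delta>2" if "x \<in> ?J" for x using that \<delta> by (auto simp: side_def)
  have lt: "f (x, y) < f (x0, y)" if "x \<in> ?S" "\<bar>y - y0\<bar> \<le> \<rho>" for x y
    using H[of x x0 y] le[of x] that \<rho>(1) by (auto simp: side_def algebra_simps)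
  have gt: "f (x, y) > f (x0, y)" if "x \<in> side x0 \<sigma> \<delta>" "\<bar>y - y0\<bar> \<le> \<rho>" for x y
    using H[of x0 x y] that \<delta> by (auto simp: side_def)
  \<comment> \<open>By vertical convexity, values between \<open>y0\<close> and \<open>y\<close> are
    at most the larger end value, so the sublevel set is star-shaped about
    \<open>y0\<close>.\<close>
  have strip: "strip ?J x0 y0 \<alpha> \<beta>"
    unfolding strip_def
  proof (intro conjI ballI allI impI)
    show "connected ?J" by (rule side_props(2)[OF \<sigma>(2) \<delta>(1)])
    show "\<alpha> < y0" "y0 < \<beta>" using \<rho>(1) by (auto simp: \<alpha>_def \<beta>_def)
    fix x assume x: "x \<in> ?J"
    show fc: "f (x, y0) \<le> \<epsilon>" using lt[of x y0] x zP \<rho>(1) by auto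
    fix y assume y: "\<alpha> < y" "y < \<beta>"
    have y': "\<bar>y - y0\<bar> \<le> \<rho>" using y K by simp
    show "(x, y) \<in> B" using \<rho>(2)[OF le(1)[OF x] y'] by blast
    fix t assume fxy: "f (x, y) \<le> \<epsilon>" and t: "t \<in> closed_segment y0 y"
    have "t = y0 \<or> t = y \<or> (y0 < t \<and> t < y) \<or> (y < t \<and> t < y0)"
      using t by (cases "y0 \<le> y"; simp add: closed_segment_eq_real_ivl; linarith)
    then consider "t = y0" | "t = y" | "y0 < t" "t < y" | "y < t" "t < y0" by blast
    then show "f (x, t) \<le> \<epsilon>"
    proof cases
      case 3 then show ?thesis using conv[OF le(1)[OF x], of y0 y t] y' fc fxy \<rho>(1) by auto
    next
      case 4 then show ?thesis using conv[OF le(1)[OF x], of y y0 t] y' fc fxy \<rho>(1) by auto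
    qed (use fc fxy in simp_all)
  qed (use zP in auto)
  have cap: "capped ?J \<alpha> \<beta>" unfolding capped_def using le(2,3) \<delta>12(2,4) by blast
  have S: "strip ?J x0 y0 \<alpha> \<beta>" "connected ?S" "?S \<subseteq> ?J" "capped ?S \<alpha> \<beta>"
    using strip side_props(1)[OF \<sigma>(2) \<delta>(1)] capped_subset[OF cap] by auto
  \<comment> \<open>A tangency over \<open>?S\<close> would be a strict vertical minimum of value
    \<epsilon>, although \<open>f (x, y0)\<close> is already smaller.\<close>
  have noP: "?S \<times> ?K \<inter> P = {}"
  proof -
    have "(x, y) \<notin> P" if x: "x \<in> ?S" and y: "\<alpha> < y" "y < \<beta>" for x y
    proof
      assume xy: "(x, y) \<in> P"
      have y': "\<bar>y - y0\<bar> \<le> \<rho>" using y K by simp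
      have l: "f (x, y0) < \<epsilon>" using lt[OF x, of y0] zP \<rho>(1) by simp
      then have "y \<noteq> y0" using xy by (auto simp: P_def)
      then have "f (x, y) < f (x, y0)" using M[of x y y0] le(1)[of x] x xy y' \<rho>(1) by (auto simp: P_def)
      then show False using l xy by (simp add: P_def)
    qed
    then show ?thesis by fastforce
  qed
  have no0: "(0, 0) \<notin> ?N" using \<rho>(2)[of 0 0] K[of 0] le(1)[of 0] by (auto simp: pc_def)
  note G = germ[OF S noP no0]
  have u: "cls (x0, y0) = pc {x0} ?K" using cap by (intro class_strip[OF strip]) (auto simp: capped_def)
  let ?W = "{x0 - \<delta><..<x0 + \<delta>} \<times> ?K"
  have W: "open ?W" by (simp add: open_Times)
  have out: "f (x, y) > \<epsilon>" if "x \<in> side x0 \<sigma> \<delta>" "y \<in> ?K" for x y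
    using gt[of x y] x0ge[of y] that K[of y] by auto
  have ex: "x = x0 \<or> x \<in> ?S \<or> x \<in> side x0 \<sigma> \<delta>" if "x \<in> {x0 - \<delta><..<x0 + \<delta>}" for x
    using side_exhaust[OF \<sigma>(1), of x x0 \<delta>] that by auto
  have "?W \<inter> P \<subseteq> {(x0, y0)}"
  proof clarify
    fix x y assume xy: "x \<in> {x0 - \<delta><..<x0 + \<delta>}" "y \<in> ?K" "(x, y) \<in> P"
    have "x \<notin> ?S" using noP xy by blast
    moreover have "x \<notin> side x0 \<sigma> \<delta>" using out[of x y] xy by (auto simp: P_def)
    ultimately have "x = x0" using ex[OF xy(1)] by blast
    then show "x = x0 \<and> y = y0" using P_fst_inj[OF xy(3) z] by simp
  qed
  moreover have "(x0, y0) \<in> ?W" using \<delta>(1) \<rho>(1) by (simp add: \<alpha>_def \<beta>_def)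
  ultimately show "\<exists>W. open W \<and> (x0, y0) \<in> W \<and> W \<inter> P \<subseteq> {(x0, y0)}" using W by blast
  have "is_star D (D - \<Union>V) (cls (x0, y0)) {?N}"
  proof (rule is_starI[OF zP(1) _ _ W _ _ \<delta>(1)])
    show "cls (x0, y0) \<subseteq> ?W" unfolding u using \<delta>(1) by (auto simp: pc_def)
    show "\<Union>{?N} = D \<inter> ?W - cls (x0, y0)"
    proof
      show "\<Union>{?N} \<subseteq> D \<inter> ?W - cls (x0, y0)"
        using G(1) unfolding u by (auto simp: pc_def side_def)
      show "D \<inter> ?W - cls (x0, y0) \<subseteq> \<Union>{?N}"
      proof clarify
        fix x y assume xy: "(x, y) \<in> D" "(x, y) \<notin> cls (x0, y0)" "x \<in> {x0 - \<delta><..<x0 + \<delta>}" "y \<in> ?K"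
        then have "x \<noteq> x0" using D_range(2)[OF xy(1)] unfolding u by auto
        moreover have "x \<notin> side x0 \<sigma> \<delta>" using out[of x y] D_range(2)[OF xy(1)] xy(4) by auto
        ultimately have "(x, y) \<in> ?N" using ex[OF xy(3)] xy(4) D_range(2)[OF xy(1)] by simp
        then show "(x, y) \<in> \<Union>{?N}" by simp
      qed
    qed
    fix N assume "N \<in> {?N}"
    then have N: "N = ?N" by simp
    show "N \<subseteq> D - \<Union>V" unfolding N by (rule G(1))
    show "connected N" unfolding N by (rule strip_piece(2)[OF S])
    show "cls p \<subseteq> N" if "p \<in> N" for p using that unfolding N by (rule G(2))
    have "(x0, y0) \<in> closure ?N" using side_props(3)[OF \<sigma>(2) \<delta>(1)] by (rule G(3))
    then show "closure N \<inter> cls (x0, y0) \<noteq> {}" unfolding N using reeb_class_refl[of "(x0, y0)" D] zP(1) by blast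
    have "side (fst (x0, y0)) (- \<sigma>) \<delta> \<subseteq> fst ` N" unfolding N fst_conv by (rule fst_piece[OF S])
    then show "side (fst (x0, y0)) 1 \<delta> \<subseteq> fst ` N \<or> side (fst (x0, y0)) (- 1) \<delta> \<subseteq> fst ` N" using \<sigma>(2) by auto
  qed (simp_all add: disjoint_def)
  then show "\<exists>\<N>. is_star D (D - \<Union>V) (cls (x0, y0)) \<N> \<and> card \<N> = 1" by (intro exI[of _ "{?N}"]) simp
qed

text \<open>Along \<open>x = x0\<close> the function has a strict local maximum of value \<epsilon>
  at \<open>y0\<close>, in the inside of the slice. Towards - \<sigma> the values drop and the slice
  stays whole; towards \<sigma> the value at \<open>y0\<close> exceeds \<epsilon> and splits it:
  there are three germs.\<close>

lemma saddle_star: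
  assumes z: "(x0, y0) \<in> P" and fyy: "fyy (x0, y0) < 0"
  shows "\<exists>\<N>. is_star D (D - \<Union>V) (cls (x0, y0)) \<N> \<and> card \<N> = 3" "\<exists>W. open W \<and> (x0, y0) \<in> W \<and> W \<inter> P \<subseteq> {(x0, y0)}"
proof -
  have zP: "(x0, y0) \<in> D" "f (x0, y0) = \<epsilon>" "fy (x0, y0) = 0" using z by (auto simp: P_def)
  obtain \<sigma> \<rho> where \<sigma>: "\<sigma> = 1 \<or> \<sigma> = -1" "- \<sigma> = 1 \<or> - \<sigma> = -1" and \<rho>: "\<rho> > 0"
      "\<And>x y. \<bar>x - x0\<bar> \<le> \<rho> \<Longrightarrow> \<bar>y - y0\<bar> \<le> \<rho> \<Longrightarrow> (x, y) \<in> B \<and> x \<noteq> 0"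
    and H: "\<And>x1 x2 y. \<bar>x1 - x0\<bar> \<le> \<rho> \<Longrightarrow> \<bar>x2 - x0\<bar> \<le> \<rho> \<Longrightarrow> \<bar>y - y0\<bar> \<le> \<rho> \<Longrightarrow> \<sigma> * (x2 - x1) > 0 \<Longrightarrow>
      f (x1, y) < f (x2, y)"
    and M': "\<And>x s t. \<bar>x - x0\<bar> \<le> \<rho> \<Longrightarrow> \<bar>s - y0\<bar> \<le> \<rho> \<Longrightarrow> \<bar>t - y0\<bar> \<le> \<rho> \<Longrightarrow> fy (x, s) = 0 \<Longrightarrow> t \<noteq> s \<Longrightarrow> - f (x, s) < - f (x, t)"
    and conv: "\<And>x s t w. \<bar>x - x0\<bar> \<le> \<rho> \<Longrightarrow> \<bar>s - y0\<bar> \<le> \<rho> \<Longrightarrow> \<bar>w - y0\<bar> \<le> \<rho> \<Longrightarrow> s < t \<Longrightarrow> t < w \<Longrightarrow>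
      - f (x, t) < max (- f (x, s)) (- f (x, w))"
    using tangency_box[OF z, of "-1", unfolded mult_minus1, OF disjI2[OF refl] fyy[unfolded neg_0_less_iff_less[symmetric]]] by blast
  note M = M'[unfolded neg_less_iff_less]
  have conc: "f (x, t) > min (f (x, s)) (f (x, w))" if "\<bar>x - x0\<bar> \<le> \<rho>" "\<bar>s - y0\<bar> \<le> \<rho>" "\<bar>w - y0\<bar> \<le> \<rho>" "s < t" "t < w" for x s t w
    using conv[OF that] by auto
  have x0lt: "f (x0, y) < \<epsilon>" if "\<bar>y - y0\<bar> \<le> \<rho>" "y \<noteq> y0" for y
    using M[of x0 y0 y] that zP \<rho>(1) by auto
  have x0le: "f (x0, y) \<le> \<epsilon>" if "\<bar>y - y0\<bar> \<le> \<rho>" for y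
    using x0lt[of y] that zP by (cases "y = y0") auto
  obtain a b where ab: "a \<le> y0" "y0 \<le> b" "cls (x0, y0) = {x0} \<times> {a..b}" "f (x0, a) = \<epsilon>" "f (x0, b) = \<epsilon>"
    using class_interval[OF zP(1)] by metis
  have "{x0} \<times> {y0 - \<rho>..y0 + \<rho>} \<subseteq> D"
  proof (rule grow[OF _ _ _ zP(1)])
    show "connected ({x0} \<times> {y0 - \<rho>..y0 + \<rho>})" by (intro connected_Times) auto
    show "{x0} \<times> {y0 - \<rho>..y0 + \<rho>} \<subseteq> B" using \<rho> by (auto simp: abs_le_iff)
  qed (use \<rho>(1) x0le in \<open>auto simp: abs_le_iff\<close>)
  then have "{x0} \<times> {y0 - \<rho>..y0 + \<rho>} \<subseteq> cls (x0, y0)"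
    using \<rho>(1) by (intro reeb_class_maximal connected_Times) auto
  then have "{y0 - \<rho>..y0 + \<rho>} \<subseteq> {a..b}" unfolding ab(3) by blast
  then have "a \<le> y0 - \<rho>" "y0 + \<rho> \<le> b" using \<rho>(1) by auto
  moreover have "a \<noteq> y0 - \<rho>" "b \<noteq> y0 + \<rho>" using x0lt[of a] x0lt[of b] ab(4,5) \<rho>(1) by auto
  ultimately have abr: "a < y0 - \<rho>" "y0 + \<rho> < b" by auto
  have noP: "(x0, t) \<notin> P" if "t \<noteq> y0" for t using P_fst_inj[OF _ z, of "(x0, t)"] that by auto
  note ends = class_ends[OF ab(3) zP(1) ab(4,5)]
  have e: "fy (x0, a) < 0" "fy (x0, b) > 0" using ends noP[of a] noP[of b] abr \<rho>(1) by auto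
  have mem: "(x0, t) \<in> D" "cls (x0, t) = {x0} \<times> {a..b}" if "t \<in> {a..b}" for t
    using reeb_class_sub(1)[of "(x0, t)" D "(x0, y0)"] reeb_class_same[of "(x0, t)" D "(x0, y0)"] ab(3) that by auto
  have inside: "f (x0, t) < \<epsilon>" if "a < t" "t < b" "t \<noteq> y0" for t
    using class_inside[OF mem that(1,2) noP[OF that(3)]] that by simp
  let ?U = "B \<inter> {p. fst p \<noteq> 0}"
  have U: "open ?U" by (intro open_Int open_B open_Collect_neq continuous_on_fst continuous_on_id continuous_on_const)
  have clsU: "(x0, t) \<in> ?U" if "t \<in> {a..b}" for t using mem(1)[OF that] D_sub_B P_fst_nonzero[OF z] by auto
  \<comment> \<open>Outside the box of radius \<rho> the slice is regular. Arms of lengths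
    \<open>L1\<close> and \<open>L2\<close> lead from \<open>y0 + \<rho>\<close> up to
    \<open>b\<close> and from \<open>y0 - \<rho>\<close> down to \<open>a\<close>.\<close>
  define L1 L2 where "L1 = b - (y0 + \<rho>)" and "L2 = (y0 - \<rho>) - a"
  have L: "L1 > 0" "L2 > 0" using abr by (auto simp: L1_def L2_def)
  have armf: "f (x0, (y0 + \<rho>) + 1 * L1) = \<epsilon>" "1 * fy (x0, (y0 + \<rho>) + 1 * L1) > 0"
    "f (x0, (y0 - \<rho>) + (-1) * L2) = \<epsilon>" "(-1) * fy (x0, (y0 - \<rho>) + (-1) * L2) > 0"
    using ab(4,5) e by (simp_all add: L1_def L2_def)
  have armi1: "f (x0, (y0 + \<rho>) + 1 * s) < \<epsilon>" if "0 \<le> s" "s < L1" for s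
    by (rule inside) (use that abr \<rho>(1) in \<open>auto simp: L1_def\<close>)
  have armi2: "f (x0, (y0 - \<rho>) + (-1) * s) < \<epsilon>" if "0 \<le> s" "s < L2" for s
    by (rule inside) (use that abr \<rho>(1) in \<open>auto simp: L2_def\<close>)
  have armU1: "(x0, (y0 + \<rho>) + 1 * s) \<in> ?U" if "0 \<le> s" "s \<le> L1" for s
    by (rule clsU) (use that abr \<rho>(1) in \<open>auto simp: L1_def\<close>)
  have armU2: "(x0, (y0 - \<rho>) + (-1) * s) \<in> ?U" if "0 \<le> s" "s \<le> L2" for s
    by (rule clsU) (use that abr \<rho>(1) in \<open>auto simp: L2_def\<close>)
  obtain S1 \<delta>1 where "is_arm F \<epsilon> ?U x0 (y0 + \<rho>) 1 S1 \<delta>1"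
    using arm[of 1 L1 F x0 "y0 + \<rho>" \<epsilon> ?U, OF disjI1[OF refl] L(1) armf(1,2) armi1 U armU1] by blast
  note up = is_armD[OF this]
  obtain S2 \<delta>2 where "is_arm F \<epsilon> ?U x0 (y0 - \<rho>) (-1) S2 \<delta>2"
    using arm[of "-1" L2 F x0 "y0 - \<rho>" \<epsilon> ?U, OF disjI2[OF refl] L(2) armf(3,4) armi2 U armU2] by blast
  note dn = is_armD[OF this]
  define \<alpha> \<beta> where "\<alpha> = y0 - \<rho> - S2" and "\<beta> = y0 + \<rho> + S1"
  have order: "\<alpha> < y0 - \<rho>" "y0 + \<rho> < \<beta>" using up(1) dn(1) by (auto simp: \<alpha>_def \<beta>_def)
  define \<delta> where "\<delta> = min \<rho> (min \<delta>1 \<delta>2)"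
  have \<delta>: "\<delta> > 0" "\<delta> \<le> \<rho>" "\<delta> \<le> \<delta>1" "\<delta> \<le> \<delta>2" using \<rho>(1) up(2) dn(2) by (auto simp: \<delta>_def)
  let ?S = "\<lambda>\<sigma>. side x0 \<sigma> \<delta>"
  let ?J = "\<lambda>\<sigma>. insert x0 (side x0 \<sigma> \<delta>)"
  have le: "\<bar>x - x0\<bar> \<le> \<delta>" if "x \<in> ?J \<sigma>" for x \<sigma> using that \<delta>(1) by (auto simp: side_def)
  have near: "\<bar>x - x0\<bar> \<le> \<rho>" "\<bar>x - x0\<bar> \<le> \<delta>1" "\<bar>x - x0\<bar> \<le> \<delta>2" if "\<bar>x - x0\<bar> \<le> \<delta>" for x using that \<delta> by auto
  have lt: "f (x, y) < f (x0, y)" if "x \<in> ?S (- \<sigma>)" "\<bar>y - y0\<bar> \<le> \<rho>" for x y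
    using H[of x x0 y] near(1)[of x] le[of x "- \<sigma>"] that \<rho>(1) by (auto simp: side_def algebra_simps)
  have gt: "f (x, y0) > \<epsilon>" if "x \<in> ?S \<sigma>" for x
    using H[of x0 x y0] that \<delta> zP(2) by (auto simp: side_def)
  have caps: "f (x, \<alpha>) > \<epsilon>" "f (x, \<beta>) > \<epsilon>" if "\<bar>x - x0\<bar> \<le> \<delta>" for x
    using up(3)[OF near(2)[OF that]] dn(3)[OF near(3)[OF that]] by (simp_all add: \<alpha>_def \<beta>_def)
  have BB: "(x, y) \<in> B \<and> x \<noteq> 0" if x: "\<bar>x - x0\<bar> \<le> \<delta>" and y: "\<alpha> < y" "y < \<beta>" for x y
  proof -
    consider "\<bar>y - y0\<bar> \<le> \<rho>" | "y > y0 + \<rho>" | "y < y0 - \<rho>" by linarith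
    then show ?thesis
    proof cases
      case 1 then show ?thesis using \<rho>(2)[OF near(1)[OF x]] by blast
    next
      case 2 then show ?thesis using up(5)[OF near(2)[OF x], of "y - (y0 + \<rho>)"] y by (auto simp: \<beta>_def)
    next
      case 3 then show ?thesis using dn(5)[OF near(3)[OF x], of "(y0 - \<rho>) - y"] y by (auto simp: \<alpha>_def)
    qed
  qed
  have starU: "f (x, t) \<le> \<epsilon>" if x: "\<bar>x - x0\<bar> \<le> \<delta>" and t: "y0 + \<rho> \<le> t" "t \<le> y" "y < \<beta>" "f (x, y) \<le> \<epsilon>" for x y t
    using up(7)[OF near(2)[OF x], of "t - (y0 + \<rho>)" "y - (y0 + \<rho>)"] t by (simp add: \<beta>_def)
  have starD: "f (x, t) \<le> \<epsilon>" if x: "\<bar>x - x0\<bar> \<le> \<delta>" and t: "t \<le> y0 - \<rho>" "y \<le> t" "\<alpha> < y" "f (x, y) \<le> \<epsilon>" for x y t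
    using dn(7)[OF near(3)[OF x], of "(y0 - \<rho>) - t" "(y0 - \<rho>) - y"] t by (simp add: \<alpha>_def)
  have inZ: "f (x, y) \<le> \<epsilon>" if "x \<in> ?J (- \<sigma>)" "\<bar>y - y0\<bar> \<le> \<rho>" for x y
    using lt[of x y] x0le[of y] that by auto
  have strip1: "strip (?J (- \<sigma>)) x0 y0 \<alpha> \<beta>"
    unfolding strip_def
  proof (intro conjI ballI allI impI)
    show "connected (?J (- \<sigma>))" by (rule side_props(2)[OF \<sigma>(2) \<delta>(1)])
    show "\<alpha> < y0" "y0 < \<beta>" using order \<rho>(1) by auto
    fix x assume x: "x \<in> ?J (- \<sigma>)"
    show "f (x, y0) \<le> \<epsilon>" using inZ[OF x, of y0] \<rho>(1) by simp
    fix y assume y: "\<alpha> < y" "y < \<beta>"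
    show "(x, y) \<in> B" using BB[OF le[OF x] y] by blast
    fix t assume fxy: "f (x, y) \<le> \<epsilon>" and t: "t \<in> closed_segment y0 y"
    consider "\<bar>t - y0\<bar> \<le> \<rho>" | "t > y0 + \<rho>" | "t < y0 - \<rho>" by linarith
    then show "f (x, t) \<le> \<epsilon>"
    proof cases
      case 1 then show ?thesis using inZ[OF x] by blast
    next
      case 2
      then have "t \<le> y" using t \<rho>(1) by (auto simp: closed_segment_eq_real_ivl split: if_splits)
      then show ?thesis using starU[OF le[OF x], of t y] 2 y fxy by simp
    next
      case 3
      then have "y \<le> t" using t \<rho>(1) by (auto simp: closed_segment_eq_real_ivl split: if_splits)
      then show ?thesis using starD[OF le[OF x], of t y] 3 y fxy by simp
    qed
  qed (use zP in auto)
  have cD: "(x0, y0 + \<rho>) \<in> D" "(x0, y0 - \<rho>) \<in> D" using mem(1)[of "y0 + \<rho>"] mem(1)[of "y0 - \<rho>"] abr \<rho>(1) by auto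
  \<comment> \<open>Vertical concavity: since \<open>f (x, y0)\<close> exceeds \<epsilon> and
    \<open>f (x, y)\<close> does not, the values beyond \<open>y\<close>, seen from
    \<open>y0\<close>, are even smaller.\<close>
  have between: "f (x, t) \<le> \<epsilon>" if x: "x \<in> ?J \<sigma>" and y: "y \<noteq> y0" "\<bar>c - y0\<bar> \<le> \<rho>" "y0 < y \<and> y < t \<and> t \<le> c \<or> c \<le> t \<and> t < y \<and> y < y0" "f (x, y) \<le> \<epsilon>" for x y t c
  proof (cases "x = x0")
    case True
    then show ?thesis using x0le[of t] y by auto
  next
    case False
    then have g: "f (x, y0) > \<epsilon>" using gt x by blast
    have "min (f (x, y0)) (f (x, t)) < f (x, y)"
      using y conc[of x y0 t y] conc[of x t y0 y] near(1)[OF le[OF x]] \<rho>(1) by (auto simp: min.commute)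
    then show ?thesis using g y(4) by (auto simp: min_def split: if_splits)
  qed
  have strip2: "strip (?J \<sigma>) x0 (y0 + \<rho>) y0 \<beta>"
    unfolding strip_def
  proof (intro conjI ballI allI impI)
    show "connected (?J \<sigma>)" by (rule side_props(2)[OF \<sigma>(1) \<delta>(1)])
    show "y0 < y0 + \<rho>" "y0 + \<rho> < \<beta>" using order \<rho>(1) by auto
    fix x assume x: "x \<in> ?J \<sigma>"
    show "f (x, y0 + \<rho>) \<le> \<epsilon>" using up(4)[OF near(2)[OF le[OF x]]] by simp
    fix y assume y: "y0 < y" "y < \<beta>"
    show "(x, y) \<in> B" using BB[OF le[OF x], of y] y order \<rho>(1) by auto
    fix t assume fxy: "f (x, y) \<le> \<epsilon>" and t: "t \<in> closed_segment (y0 + \<rho>) y"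
    show "f (x, t) \<le> \<epsilon>"
    proof (cases "y0 + \<rho> \<le> y")
      case True
      then show ?thesis using starU[OF le[OF x], of t y] t y fxy by (simp add: closed_segment_eq_real_ivl)
    next
      case False
      then show ?thesis using between[OF x, of y "y0 + \<rho>" t] t y fxy \<rho>(1)
        by (cases "t = y") (auto simp: closed_segment_eq_real_ivl)
    qed
  qed (use cD in auto)
  have strip3: "strip (?J \<sigma>) x0 (y0 - \<rho>) \<alpha> y0"
    unfolding strip_def
  proof (intro conjI ballI allI impI)
    show "connected (?J \<sigma>)" by (rule side_props(2)[OF \<sigma>(1) \<delta>(1)])
    show "\<alpha> < y0 - \<rho>" "y0 - \<rho> < y0" using order \<rho>(1) by auto
    fix x assume x: "x \<in> ?J \<sigma>"
    show "f (x, y0 - \<rho>) \<le> \<epsilon>" using dn(4)[OF near(3)[OF le[OF x]]] by simp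
    fix y assume y: "\<alpha> < y" "y < y0"
    show "(x, y) \<in> B" using BB[OF le[OF x], of y] y order \<rho>(1) by auto
    fix t assume fxy: "f (x, y) \<le> \<epsilon>" and t: "t \<in> closed_segment (y0 - \<rho>) y"
    show "f (x, t) \<le> \<epsilon>"
    proof (cases "y \<le> y0 - \<rho>")
      case True
      then show ?thesis using starD[OF le[OF x], of t y] t y fxy by (auto simp: closed_segment_eq_real_ivl split: if_splits)
    next
      case False
      then show ?thesis using between[OF x, of y "y0 - \<rho>" t] t y fxy \<rho>(1)
        by (cases "t = y") (auto simp: closed_segment_eq_real_ivl)
    qed
  qed (use cD in auto)
  \<comment> \<open>The arms have transversal ends, so a tangency must be within \<rho> of
    \<open>y0\<close>. On the side - \<sigma> all values there are below \<epsilon>; on the side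
    \<sigma> the tangency would be a strict vertical maximum, above
    \<open>f (x, y0) > \<epsilon>\<close>.\<close>
  have offside: "x \<notin> ?S \<sigma>" "x \<notin> ?S (- \<sigma>)" if xy: "(x, y) \<in> P" "\<alpha> < y" "y < \<beta>" for x y
  proof -
    have fP: "f (x, y) = \<epsilon>" "fy (x, y) = 0" using xy(1) by (auto simp: P_def)
    have Z: "\<bar>y - y0\<bar> \<le> \<rho>" if x: "\<bar>x - x0\<bar> \<le> \<delta>"
    proof (rule ccontr)
      assume "\<not> \<bar>y - y0\<bar> \<le> \<rho>"
      then consider "y > y0 + \<rho>" | "y < y0 - \<rho>" by linarith
      then show False
      proof cases
        case 1 then show ?thesis using up(6)[OF near(2)[OF x], of "y - (y0 + \<rho>)"] xy fP by (auto simp: \<beta>_def)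
      next
        case 2 then show ?thesis using dn(6)[OF near(3)[OF x], of "(y0 - \<rho>) - y"] xy fP by (auto simp: \<alpha>_def)
      qed
    qed
    show "x \<notin> ?S (- \<sigma>)"
    proof
      assume x: "x \<in> ?S (- \<sigma>)"
      then have "\<bar>y - y0\<bar> \<le> \<rho>" using Z le[of x "- \<sigma>"] by blast
      then show False using lt[OF x] x0le fP by fastforce
    qed
    show "x \<notin> ?S \<sigma>"
    proof
      assume x: "x \<in> ?S \<sigma>"
      then have y: "\<bar>y - y0\<bar> \<le> \<rho>" using Z le[of x \<sigma>] by blast
      have "y \<noteq> y0" using gt[OF x] fP by auto
      then have "f (x, y0) < f (x, y)" using M[of x y y0] y fP \<rho>(1) near(1)[OF le[of x \<sigma>]] x by auto
      then show False using gt[OF x] fP by simp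
    qed
  qed
  let ?N1 = "pc (?S (- \<sigma>)) {\<alpha><..<\<beta>}" and ?N2 = "pc (?S \<sigma>) {y0<..<\<beta>}" and ?N3 = "pc (?S \<sigma>) {\<alpha><..<y0}"
  have cap1: "capped (?J (- \<sigma>)) \<alpha> \<beta>" unfolding capped_def using caps[OF le] by blast
  have cap2: "capped (?S \<sigma>) y0 \<beta>" unfolding capped_def using caps[OF le[of _ \<sigma>]] gt by blast
  have cap3: "capped (?S \<sigma>) \<alpha> y0" unfolding capped_def using caps[OF le[of _ \<sigma>]] gt by blast
  have A1: "strip (?J (- \<sigma>)) x0 y0 \<alpha> \<beta>" "connected (?S (- \<sigma>))" "?S (- \<sigma>) \<subseteq> ?J (- \<sigma>)" "capped (?S (- \<sigma>)) \<alpha> \<beta>"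
    using strip1 side_props(1)[OF \<sigma>(2) \<delta>(1)] capped_subset[OF cap1] by auto
  have A2: "strip (?J \<sigma>) x0 (y0 + \<rho>) y0 \<beta>" "connected (?S \<sigma>)" "?S \<sigma> \<subseteq> ?J \<sigma>" "capped (?S \<sigma>) y0 \<beta>"
    using strip2 side_props(1)[OF \<sigma>(1) \<delta>(1)] cap2 by auto
  have A3: "strip (?J \<sigma>) x0 (y0 - \<rho>) \<alpha> y0" "connected (?S \<sigma>)" "?S \<sigma> \<subseteq> ?J \<sigma>" "capped (?S \<sigma>) \<alpha> y0"
    using strip3 side_props(1)[OF \<sigma>(1) \<delta>(1)] cap3 by auto
  have \<alpha>\<beta>: "\<alpha> < y0" "y0 < \<beta>" using order \<rho>(1) by auto
  have nP: "?S (- \<sigma>) \<times> {\<alpha><..<\<beta>} \<inter> P = {}" "?S \<sigma> \<times> {y0<..<\<beta>} \<inter> P = {}" "?S \<sigma> \<times> {\<alpha><..<y0} \<inter> P = {}"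
    using offside \<alpha>\<beta> by fastforce+
  have n0: "(0, 0) \<notin> ?N1" "(0, 0) \<notin> ?N2" "(0, 0) \<notin> ?N3"
    using BB[of 0 0] le[of 0 \<sigma>] le[of 0 "- \<sigma>"] \<alpha>\<beta> by auto
  note G1 = germ[OF A1 nP(1) n0(1)] and G2 = germ[OF A2 nP(2) n0(2)] and G3 = germ[OF A3 nP(3) n0(3)]
  have u: "cls (x0, y0) = pc {x0} {\<alpha><..<\<beta>}" using cap1 by (intro class_strip[OF strip1]) (auto simp: capped_def)
  let ?W = "{x0 - \<delta><..<x0 + \<delta>} \<times> {\<alpha><..<\<beta>}"
  have W: "open ?W" by (simp add: open_Times)
  have ex: "x = x0 \<or> x \<in> ?S (- \<sigma>) \<or> x \<in> ?S \<sigma>" if "x \<in> {x0 - \<delta><..<x0 + \<delta>}" for x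
    using side_exhaust[OF \<sigma>(1), of x x0 \<delta>] that by auto
  have "?W \<inter> P \<subseteq> {(x0, y0)}"
  proof clarify
    fix x y assume xy: "x \<in> {x0 - \<delta><..<x0 + \<delta>}" "y \<in> {\<alpha><..<\<beta>}" "(x, y) \<in> P"
    then have "x = x0" using ex[OF xy(1)] offside[OF xy(3)] by auto
    then show "x = x0 \<and> y = y0" using P_fst_inj[OF xy(3) z] by simp
  qed
  moreover have "(x0, y0) \<in> ?W" using \<delta>(1) \<alpha>\<beta> by simp
  ultimately show "\<exists>W. open W \<and> (x0, y0) \<in> W \<and> W \<inter> P \<subseteq> {(x0, y0)}" using W by blast
  have fst: "?S (- \<sigma>) \<subseteq> fst ` ?N1" "?S \<sigma> \<subseteq> fst ` ?N2" "?S \<sigma> \<subseteq> fst ` ?N3"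
    by (fact fst_piece[OF A1] fst_piece[OF A2] fst_piece[OF A3])+
  then have ne: "?N1 \<noteq> {}" "?N2 \<noteq> {}" "?N3 \<noteq> {}" using side_props(4)[OF \<sigma>(1) \<delta>(1)] side_props(4)[OF \<sigma>(2) \<delta>(1)] by blast+
  have disj: "?N1 \<inter> ?N2 = {}" "?N1 \<inter> ?N3 = {}" "?N2 \<inter> ?N3 = {}" by (auto simp: pc_def side_def)
  then have neq: "?N1 \<noteq> ?N2" "?N1 \<noteq> ?N3" "?N2 \<noteq> ?N3" using ne by (metis Int_absorb)+
  have uM: "(x0, t) \<in> cls (x0, y0)" if "t \<in> {a..b}" for t unfolding ab(3) using that by simp
  have "is_star D (D - \<Union>V) (cls (x0, y0)) {?N1, ?N2, ?N3}"
  proof (rule is_starI[OF zP(1) _ _ W _ _ \<delta>(1)])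
    show "cls (x0, y0) \<subseteq> ?W" unfolding u using \<delta>(1) by (auto simp: pc_def)
    show "disjoint {?N1, ?N2, ?N3}" using disj by (auto simp: disjoint_def)
    show "\<Union>{?N1, ?N2, ?N3} = D \<inter> ?W - cls (x0, y0)"
    proof
      have "?N1 \<subseteq> D" "?N2 \<subseteq> D" "?N3 \<subseteq> D" using G1(1) G2(1) G3(1) by blast+
      moreover have "?N1 \<subseteq> ?W" "?N2 \<subseteq> ?W" "?N3 \<subseteq> ?W" using \<alpha>\<beta> by (auto simp: pc_def side_def)
      moreover have "?N1 \<inter> cls (x0, y0) = {}" "?N2 \<inter> cls (x0, y0) = {}" "?N3 \<inter> cls (x0, y0) = {}"
        unfolding u by (auto simp: pc_def side_def)
      ultimately show "\<Union>{?N1, ?N2, ?N3} \<subseteq> D \<inter> ?W - cls (x0, y0)" by blast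
      show "D \<inter> ?W - cls (x0, y0) \<subseteq> \<Union>{?N1, ?N2, ?N3}"
      proof clarify
        fix x y assume xy: "(x, y) \<in> D" "(x, y) \<notin> cls (x0, y0)" "x \<in> {x0 - \<delta><..<x0 + \<delta>}" "y \<in> {\<alpha><..<\<beta>}"
        have fxy: "f (x, y) \<le> \<epsilon>" using D_range(2)[OF xy(1)] .
        then have "x \<noteq> x0" using xy(2,4) unfolding u by auto
        then consider "x \<in> ?S (- \<sigma>)" | "x \<in> ?S \<sigma>" using ex[OF xy(3)] by blast
        then show "(x, y) \<in> \<Union>{?N1, ?N2, ?N3}"
        proof cases
          case 1
          then have "(x, y) \<in> ?N1" using fxy xy(4) by simp
          then show ?thesis by blast
        next
          case 2
          then have "y \<noteq> y0" using gt[OF 2] fxy by auto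
          then have "(x, y) \<in> ?N2 \<or> (x, y) \<in> ?N3" using 2 fxy xy(4) by auto
          then show ?thesis by blast
        qed
      qed
    qed
    have c1: "(x0, y0) \<in> closure ?N1" using side_props(3)[OF \<sigma>(2) \<delta>(1)] by (rule G1(3))
    have c2: "(x0, y0 + \<rho>) \<in> closure ?N2" using side_props(3)[OF \<sigma>(1) \<delta>(1)] by (rule G2(3))
    have c3: "(x0, y0 - \<rho>) \<in> closure ?N3" using side_props(3)[OF \<sigma>(1) \<delta>(1)] by (rule G3(3))
    have cc: "(x0, y0) \<in> cls (x0, y0)" "(x0, y0 + \<rho>) \<in> cls (x0, y0)" "(x0, y0 - \<rho>) \<in> cls (x0, y0)"
      using abr \<rho>(1) zP(1) by (auto intro!: uM)
    fix N assume N: "N \<in> {?N1, ?N2, ?N3}"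
    show "N \<subseteq> D - \<Union>V" using N G1(1) G2(1) G3(1) by blast
    show "connected N" using N strip_piece(2)[OF A1] strip_piece(2)[OF A2] strip_piece(2)[OF A3] by blast
    show "cls p \<subseteq> N" if "p \<in> N" for p using N that G1(2) G2(2) G3(2) by blast
    show "closure N \<inter> cls (x0, y0) \<noteq> {}" using N c1 c2 c3 cc by blast
    show "side (fst (x0, y0)) 1 \<delta> \<subseteq> fst ` N \<or> side (fst (x0, y0)) (- 1) \<delta> \<subseteq> fst ` N"
      using N fst \<sigma> by auto
  qed simp
  moreover have "card {?N1, ?N2, ?N3} = 3" using neq by simp
  ultimately show "\<exists>\<N>. is_star D (D - \<Union>V) (cls (x0, y0)) \<N> \<and> card \<N> = 3" by blast
qed

text \<open>\<open>P\<close> is compact, and the boxes around leaves and saddles isolate each of its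
  points.\<close>

lemma finite_P: "finite P"
proof -
  have "P = D \<inter> {p. f p = \<epsilon>} \<inter> {p. fy p = 0}" by (auto simp: P_def)
  then have "compact P" by (auto intro!: compact_Int_closed compact_D closed_Collect_eq continuous_intros)
  moreover have "\<not> z islimpt P" if "z \<in> P" for z
  proof -
    obtain x y where z: "z = (x, y)" by force
    have "\<exists>W. open W \<and> (x, y) \<in> W \<and> W \<inter> P \<subseteq> {(x, y)}"
      using P_fyy[of "(x, y)"] leaf_star(2)[of x y] saddle_star(2)[of x y] that unfolding z by (cases "fyy (x, y) > 0") auto
    then show ?thesis unfolding z islimpt_def by blast
  qed
  ultimately show ?thesis using finite_not_islimpt_in_compact[of P P] by simp
qed

section \<open>The level disk as an instance of the abstract disk\<close>

lemma P_star: "z \<in> P \<Longrightarrow> \<exists>\<N>. is_star D (D - \<Union>V) (cls z) \<N> \<and> card \<N> \<in> {1, 3}"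
proof -
  assume z: "z \<in> P"
  obtain x y where xy: "z = (x, y)" by force
  have ne: "fyy (x, y) \<noteq> 0" using P_fyy z xy by blast
  show ?thesis
  proof (cases "fyy (x, y) > 0")
    case True
    then show ?thesis using leaf_star(1)[of x y] z xy by auto
  next
    case False
    then have "fyy (x, y) < 0" using ne by simp
    then show ?thesis using saddle_star(1)[of x y] z xy by auto
  qed
qed

lemma V_cases:
  assumes "v \<in> V" obtains "v = cls (0, 0)" | z where "z \<in> P" "v = cls z"
  using assms by (auto simp: V_def)

sublocale reeb: reeb_disk D V "cls (0, 0)"
proof
  show "compact D" "connected D" "unicoherent D" by (fact compact_D connected_D unicoherent_D)+
  show "finite V" using finite_P by (simp add: V_def)
  show "cls (0, 0) \<in> V" by (simp add: V_def)
  show "\<exists>p\<in>D. v = cls p" if "v \<in> V" for v using that zero_D P_sub by (auto simp: V_def)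
  \<comment> \<open>No tangency lies over \<open>x = 0\<close>, so the root shares its abscissa with
    no other vertex; for two tangencies this is the bitangent condition.\<close>
  show "u = v" if uv: "u \<in> V" "v \<in> V" and pq: "p \<in> u" "q \<in> v" "fst p = fst q" for u v p q
  proof -
    have fst: "fst p = fst z" if "p \<in> cls z" for p z using reeb_class_sub(2)[OF that] .
    show ?thesis
      using uv(1)
    proof (cases rule: V_cases)
      case 1
      show ?thesis using uv(2)
      proof (cases rule: V_cases)
        case (2 z)
        then show ?thesis using 1 pq fst[of p "(0, 0)"] fst[of q z] P_fst_nonzero[of z] by simp
      qed (use 1 in simp)
    next
      case (2 w)
      show ?thesis using uv(2)
      proof (cases rule: V_cases)
        case 1
        then show ?thesis using 2 pq fst[of q "(0, 0)"] fst[of p w] P_fst_nonzero[of w] by simp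
      next
        case (2 z)
        then show ?thesis using \<open>w \<in> P\<close> \<open>u = cls w\<close> pq fst[of p w] fst[of q z] P_fst_inj[of w z] by simp
      qed
    qed
  qed
  show "\<exists>z\<in>U \<inter> interior D. fst z = fst p" if "p \<in> D - \<Union>V" "open U" "p \<in> U" for p U
    using interior_point_nearby that .
  show "\<exists>N\<subseteq>U. p \<in> N \<and> is_tube D (D - \<Union>V) N" if "p \<in> D - \<Union>V" "open U" "cls p \<subseteq> U" for p U
    using regular_tube that .
  show "\<exists>\<N>. is_star D (D - \<Union>V) u \<N>" if "u \<in> V" for u
    using that by (cases rule: V_cases) (use root_star P_star in blast)+
qed

lemma tree_eq: "reeb.tree = poincare_reeb_tree f \<epsilon>"
  by (simp add: reeb.tree_def poincare_reeb_tree_def Let_def V_eq[symmetric])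

lemma level_tree:
  "complete_binary_tree (poincare_reeb_tree f \<epsilon>)"
  "linear_order_on (vertices (poincare_reeb_tree f \<epsilon>)) (vle (poincare_reeb_tree f \<epsilon>))"
proof -
  obtain \<N> where "is_star D (D - \<Union>V) (cls (0, 0)) \<N>" "card \<N> = 2" using root_star by blast
  then have "complete_binary_tree reeb.tree"
  proof (rule reeb.binary)
    show "\<exists>\<N>. is_star D (D - \<Union>V) u \<N> \<and> card \<N> \<in> {1, 3}" if "u \<in> V" "u \<noteq> cls (0, 0)" for u
      using that(1) by (cases rule: V_cases) (use that(2) P_star in blast)+
  qed
  then show "complete_binary_tree (poincare_reeb_tree f \<epsilon>)" by (simp only: tree_eq)
  show "linear_order_on (vertices (poincare_reeb_tree f \<epsilon>)) (vle (poincare_reeb_tree f \<epsilon>))"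
    using reeb.linear_order by (simp add: tree_eq[symmetric])
qed

end

lemma eventually_level_tree:
  assumes "real_polynomial_function f" "f (0, 0) = 0" "strict_local_min_at f (0, 0)"
    and gen: "\<forall>\<^sub>F \<epsilon> in at_right 0. generic_direction f \<epsilon> (0, 1)"
  shows "\<forall>\<^sub>F \<epsilon> in at_right 0. complete_binary_tree (poincare_reeb_tree f \<epsilon>) \<and>
    linear_order_on (vertices (poincare_reeb_tree f \<epsilon>)) (vle (poincare_reeb_tree f \<epsilon>))"
proof -
  obtain F r where F: "f = poly2 F" and r: "r > 0"
    and pos: "\<And>x y. \<bar>x\<bar> \<le> r \<Longrightarrow> \<bar>y\<bar> \<le> r \<Longrightarrow> (x, y) \<noteq> (0, 0) \<Longrightarrow> poly2 F (x, y) > 0"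
    and y0: "\<And>y. \<bar>y\<bar> \<le> r \<Longrightarrow> y \<noteq> 0 \<Longrightarrow> poly2 (pderiv F) (0, y) \<noteq> 0"
    and crit: "\<And>x y. \<bar>x\<bar> \<le> r \<Longrightarrow> \<bar>y\<bar> \<le> r \<Longrightarrow> (x, y) \<noteq> (0, 0) \<Longrightarrow> poly2 (poly2_dx F) (x, y) \<noteq> 0 \<or> poly2 (pderiv F) (x, y) \<noteq> 0"
    by (rule isolated_critical_point[OF assms(1-3)]) blast
  let ?S = "({-r..r} \<times> {-r..r}) - ({-r<..<r} \<times> {-r<..<r}) :: plane set"
  have S: "(x, y) \<in> ?S" if "\<bar>x\<bar> \<le> r" "\<bar>y\<bar> \<le> r" "\<bar>x\<bar> = r \<or> \<bar>y\<bar> = r" for x y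
    using that by auto
  have "compact ?S" by (intro compact_diff compact_Times compact_Icc open_Times open_greaterThanLessThan)
  moreover have "(r, 0) \<in> ?S" using r by simp
  then have "?S \<noteq> {}" by blast
  \<comment> \<open>The minimum of \<open>f\<close> on the boundary of the fixed square is positive
    and bounds the admissible \<epsilon>.\<close>
  ultimately have "\<exists>p\<in>?S. \<forall>q\<in>?S. f p \<le> f q" unfolding F by (intro continuous_attains_inf continuous_on_poly2)
  then obtain p where p: "p \<in> ?S" "\<And>q. q \<in> ?S \<Longrightarrow> f p \<le> f q" by blast
  have "f p > 0" using p(1) pos[of "fst p" "snd p"] F r by (cases p) auto
  then have "\<forall>\<^sub>F \<epsilon> in at_right 0. 0 < \<epsilon> \<and> \<epsilon> < f p" by (auto simp: eventually_at_right_field)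
  with gen show ?thesis
  proof eventually_elim
    case (elim \<epsilon>)
    interpret small_level F r \<epsilon>
    proof
      show "poly2 F (x, y) > \<epsilon>" if "\<bar>x\<bar> \<le> r" "\<bar>y\<bar> \<le> r" "\<bar>x\<bar> = r \<or> \<bar>y\<bar> = r" for x y
        using p(2)[OF S[OF that]] elim F by simp
    qed (use r elim assms(2) pos y0 crit F in auto)
    show ?case using level_tree F by simp
  qed
qed

text \<open>The second conjunct concerns each small level itself, so the statement has content
  independently of the choice of \<open>T\<close>.\<close>

theorem theorem1p1:
  fixes f :: "real \<times> real \<Rightarrow> real" and T :: "'v rooted_graph"
  assumes "real_polynomial_function f"
    and "f (0, 0) = 0"
    and "strict_local_min_at f (0, 0)"
    and "\<forall>\<^sub>F \<epsilon> in at_right 0. generic_direction f \<epsilon> (0, 1)"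
  shows "(asymptotic_poincare_reeb_tree f T \<longrightarrow>
            complete_binary_tree T \<and> linear_order_on (vertices T) (vle T)) \<and>
         (\<forall>\<^sub>F \<epsilon> in at_right 0.
            complete_binary_tree (poincare_reeb_tree f \<epsilon>) \<and>
            linear_order_on (vertices (poincare_reeb_tree f \<epsilon>)) (vle (poincare_reeb_tree f \<epsilon>)))"
proof -
  have ev: "\<forall>\<^sub>F \<epsilon> in at_right 0. complete_binary_tree (poincare_reeb_tree f \<epsilon>) \<and>
    linear_order_on (vertices (poincare_reeb_tree f \<epsilon>)) (vle (poincare_reeb_tree f \<epsilon>))"
    using eventually_level_tree assms .
  have "complete_binary_tree T \<and> linear_order_on (vertices T) (vle T)" if "asymptotic_poincare_reeb_tree f T"
  proof -
    from that have "\<forall>\<^sub>F \<epsilon> in at_right 0. same_combinatorial_type (poincare_reeb_tree f \<epsilon>) T"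
      by (simp add: asymptotic_poincare_reeb_tree_def)
    \<comment> \<open>The claim about \<open>T\<close> does not depend on \<epsilon> and the filter
      is nontrivial, so a single level at which both eventual properties hold is enough.\<close>
    with ev have "\<forall>\<^sub>F \<epsilon> in at_right (0::real). complete_binary_tree T \<and> linear_order_on (vertices T) (vle T)"
    proof eventually_elim
      case (elim \<epsilon>)
      then show ?case using same_combinatorial_type_tree by blast
    qed
    then show ?thesis by simp
  qed
  with ev show ?thesis by blast
qed

end
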